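(* In the setting described in the context, there exist constants $h_0>0$ and $C>0$, independent of $h$ and of the position of the surface relative to the mesh, such that for all $0<h\le h_0$ $$\|v\|_{\Omega_h}^2\le C\left(h\|v\|_{\Sigma_h}^2+h\,|\!|\!|v|\!|\!|_{\mathcal{F}_h}^2\right)\qquad\forall v\in V_h .$$
   Context: **Surface.** Let $d\in\{2,3\}$ and let $\Sigma\subset\mathbb{R}^d$ be a smooth closed (compact, without boundary) hypersurface of dimension $d-1$, with signed distance function $\rho$ such that the exterior unit normal is $\boldsymbol n=\nabla\rho$. For $\delta>0$ let $U_\delta(\Sigma)=\{\boldsymbol x\in\mathbb{R}^d: |\rho(\boldsymbol x)|<\delta\}$, and fix $\delta_0>0$ small enough that every $\boldsymbol x\in U_{\delta_0}(\Sigma)$ has a unique nearest point $\boldsymbol p(\boldsymbol x)\in\Sigma$. Write $\boldsymbol n^e=\boldsymbol n\circ\boldsymbol p$. $\|\cdot\|_\omega$ is the $L^2(\omega)$ norm. **Mesh and discrete surface.** Let $\mathcal{K}_{h,0}$ be a quasi-uniform conforming partition, with mesh parameter $h$, of a polygonal/polyhedral domain $\Omega_0\subset\mathbb{R}^d$ containing $U_{\delta_0}(\Sigma)$ into shape regular tetrahedra ($d=3$) or triangles ($d=2$). Let $V_{h,0}$ be the continuous piecewise linear functions on $\mathcal{K}_{h,0}$. Let $\rho_h\in V_{h,0}$ and $\Sigma_h=\{\boldsymbol x\in\Omega_0:\rho_h(\boldsymbol x)=0\}$, a piecewise linear surface with exterior unit normal $\boldsymbol n_h$. One considers a family of such surfaces,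 $0<h\le\bar h$, such that (a) $\Sigma_h\subset U_{\delta_0}(\Sigma)$; (b) $\boldsymbol p:\Sigma_h\to\Sigma$ is a bijection; (c) $\|\rho\|_{L^\infty(\Sigma_h)}\le c\,h^2$ and $\|\boldsymbol n^e-\boldsymbol n_h\|_{L^\infty(\Sigma_h)}\le c\,h$ with $c$ independent of $h$. **Finite element space and norm.** $\mathcal{K}_h=\{K\in\mathcal{K}_{h,0}:\overline K\cap\Sigma_h\ne\emptyset\}$, $\Omega_h=\bigcup_{K\in\mathcal{K}_h}K$, $V_h=\{v\in V_{h,0}|_{\Omega_h}:\int_{\Sigma_h}v=0\}$. $\mathcal{F}_h$ is the set of interior faces (edges if $d=2$) of $\mathcal{K}_h$, i.e. those shared by two elements of $\mathcal{K}_h$; $\boldsymbol n_F$ is a fixed unit normal to $F$; $[\boldsymbol n_F\cdot\nabla v]$ is the jump of $\boldsymbol n_F\cdot\nabla v$ across $F$. With $\tau_0>0$ a constant independent of $h$, $$|\!|\!|v|\!|\!|_{\mathcal{F}_h}^2=\sum_{F\in\mathcal{F}_h}\tau_0\|[\boldsymbol n_F\cdot\nabla v]\|_F^2 .$$ Constants may depend on $\Sigma$, $\delta_0$, $\tau_0$, $c$, and the shape-regularity and quasi-uniformity constants. *)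

theory Defs
  imports "HOL-Analysis.Analysis"
begin

section \<open>Surface measure and norms\<close>

definition hausdorff_pre :: "nat \<Rightarrow> real \<Rightarrow> 'a::metric_space set \<Rightarrow> ennreal" where
  "hausdorff_pre s \<epsilon> A =
     (INF C \<in> {C :: nat \<Rightarrow> 'a set. A \<subseteq> (\<Union>i. C i) \<and> (\<forall>i. bounded (C i) \<and> diameter (C i) \<le> \<epsilon>)}.
        \<Sum>i. ennreal (unit_ball_vol (real s) * (diameter (C i) / 2) ^ s))"

text \<open>The \<open>s\<close>-dimensional Hausdorff measure for \<open>s \<ge> 1\<close>, normalised so that it agrees with Lebesgue
  measure on \<open>s\<close>-dimensional planes. The supremum below is a metric outer measure, hence countably
  additive on the Borel sets (Caratheodory), so \<open>measure_of\<close> does not collapse to the zero measure.\<close>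

definition hausdorff_measure :: "nat \<Rightarrow> 'a::metric_space measure" where
  "hausdorff_measure s = measure_of UNIV (sets borel) (\<lambda>A. SUP \<epsilon>\<in>{0<..}. hausdorff_pre s \<epsilon> A)"

abbreviation surface_measure :: "'a::euclidean_space measure" where
  "surface_measure \<equiv> hausdorff_measure (DIM('a) - 1)"

definition L2_norm_on :: "'a measure \<Rightarrow> 'a set \<Rightarrow> ('a \<Rightarrow> real) \<Rightarrow> real" where
  "L2_norm_on M A f = sqrt (LINT x:A|M. (f x)\<^sup>2)"


section \<open>The smooth surface\<close>

fun C_k_on :: "nat \<Rightarrow> 'a::euclidean_space set \<Rightarrow> ('a \<Rightarrow> real) \<Rightarrow> bool" where
  "C_k_on 0 U f \<longleftrightarrow> continuous_on U f"
| "C_k_on (Suc k) U f \<longleftrightarrow>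
     (\<exists>g. (\<forall>x\<in>U. GDERIV f x :> g x) \<and> (\<forall>b\<in>Basis. C_k_on k U (\<lambda>x. g x \<bullet> b)))"

definition smooth_on :: "'a::euclidean_space set \<Rightarrow> ('a \<Rightarrow> real) \<Rightarrow> bool" where
  "smooth_on U f \<longleftrightarrow> (\<forall>k. C_k_on k U f)"

definition smooth_closed_hypersurface :: "'a::euclidean_space set \<Rightarrow> bool" where
  "smooth_closed_hypersurface S \<longleftrightarrow> compact S \<and> S \<noteq> {} \<and>
     (\<forall>x\<in>S. \<exists>U \<phi>. open U \<and> x \<in> U \<and> smooth_on U \<phi> \<and> (\<forall>y\<in>U. \<not> GDERIV \<phi> y :> 0) \<and>
        S \<inter> U = {y \<in> U. \<phi> y = 0})"

text \<open>\<open>D\<close> is the region enclosed by the closed hypersurface \<open>S\<close>, which need not be connected; the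
  complement of \<open>S \<union> D\<close> is the exterior. The condition on \<open>closure D\<close> says that \<open>D\<close> lies on one
  side of \<open>S\<close> only. By Jordan-Brouwer such a \<open>D\<close> exists and is unique; it is carried along as a
  parameter to fix orientations.\<close>

definition encloses :: "'a::euclidean_space set \<Rightarrow> 'a set \<Rightarrow> bool" where
  "encloses D S \<longleftrightarrow> open D \<and> bounded D \<and> frontier D = S \<and> frontier (closure D) = S"

definition signed_dist :: "'a::euclidean_space set \<Rightarrow> 'a \<Rightarrow> real" where
  "signed_dist D x = (if x \<in> D then - infdist x (frontier D) else infdist x (frontier D))"

text \<open>For a piecewise linear surface the signed distance is differentiable at a point of the surface
  exactly when the surface is flat near that point, so the same formula gives the almost everywhere
  defined normal of a discrete surface.\<close>

definition ext_normal :: "'a::euclidean_space set \<Rightarrow> 'a \<Rightarrow> 'a" where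
  "ext_normal D x = (THE g. GDERIV (signed_dist D) x :> g)"

definition tube :: "'a::euclidean_space set \<Rightarrow> real \<Rightarrow> 'a set" where
  "tube D \<delta> = {x. \<bar>signed_dist D x\<bar> < \<delta>}"


section \<open>Meshes and discrete surfaces\<close>

definition conforming_partition :: "'a::euclidean_space set set \<Rightarrow> 'a set \<Rightarrow> bool" where
  "conforming_partition \<K> \<Omega> \<longleftrightarrow> triangulation \<K> \<and> (\<forall>K\<in>\<K>. int DIM('a) simplex K) \<and>
     open \<Omega> \<and> connected \<Omega> \<and> closure \<Omega> = \<Union>\<K>"

definition shape_regular :: "real \<Rightarrow> 'a::euclidean_space set set \<Rightarrow> bool" where
  "shape_regular \<sigma> \<K> \<longleftrightarrow> (\<forall>K\<in>\<K>. \<exists>x r. cball x r \<subseteq> K \<and> 0 < r \<and> diameter K \<le> \<sigma> * r)"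

definition quasi_uniform :: "real \<Rightarrow> real \<Rightarrow> 'a::euclidean_space set set \<Rightarrow> bool" where
  "quasi_uniform q h \<K> \<longleftrightarrow> (\<forall>K\<in>\<K>. diameter K \<le> h \<and> h \<le> q * diameter K)"

definition P1_space :: "'a::euclidean_space set set \<Rightarrow> ('a \<Rightarrow> real) set" where
  "P1_space \<K> = {v. continuous_on (\<Union>\<K>) v \<and> (\<forall>K\<in>\<K>. \<exists>g b. \<forall>x\<in>K. v x = g \<bullet> x + b)}"

definition zero_level :: "'a set \<Rightarrow> ('a \<Rightarrow> real) \<Rightarrow> 'a set" where
  "zero_level \<Omega> \<rho>\<^sub>h = {x \<in> \<Omega>. \<rho>\<^sub>h x = 0}"

text \<open>\<open>D\<close> and \<open>D\<^sub>h\<close> are the regions enclosed by the smooth surface \<open>S\<close> and the discrete surface \<open>S\<^sub>h\<close>.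
  The maximum norms are suprema: the signed distance is continuous, and the discrete normal is
  compared at every point where it exists, where it is locally constant.\<close>

definition approximates ::
  "real \<Rightarrow> real \<Rightarrow> real \<Rightarrow> 'a::euclidean_space set \<Rightarrow> 'a set \<Rightarrow> 'a set \<Rightarrow> 'a set \<Rightarrow> bool" where
  "approximates \<delta> c h S D S\<^sub>h D\<^sub>h \<longleftrightarrow>
     S\<^sub>h \<subseteq> tube D \<delta> \<and>
     bij_betw (closest_point S) S\<^sub>h S \<and>
     (\<forall>x\<in>S\<^sub>h. \<bar>signed_dist D x\<bar> \<le> c * h\<^sup>2) \<and>
     (\<forall>x\<in>S\<^sub>h. signed_dist D\<^sub>h differentiable (at x) \<longrightarrow>
        norm (ext_normal D (closest_point S x) - ext_normal D\<^sub>h x) \<le> c * h)"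

definition cut_mesh :: "'a set set \<Rightarrow> 'a set \<Rightarrow> 'a set set" where
  "cut_mesh \<K> S\<^sub>h = {K \<in> \<K>. K \<inter> S\<^sub>h \<noteq> {}}"

text \<open>Functions are represented by arbitrary extensions of their restriction to the cut mesh.\<close>

definition cut_space :: "'a::euclidean_space set set \<Rightarrow> 'a set \<Rightarrow> ('a \<Rightarrow> real) set" where
  "cut_space \<K> S\<^sub>h = {v \<in> P1_space \<K>. (LINT x:S\<^sub>h|surface_measure. v x) = 0}"


section \<open>Face stabilisation\<close>

definition interior_faces :: "'a::euclidean_space set set \<Rightarrow> 'a set set" where
  "interior_faces \<K> = {F. \<exists>K\<in>\<K>. \<exists>K'\<in>\<K>. K \<noteq> K' \<and> F = K \<inter> K' \<and> F facet_of K \<and> F facet_of K'}"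

definition unit_normal_to :: "'a::euclidean_space set \<Rightarrow> 'a \<Rightarrow> bool" where
  "unit_normal_to F n \<longleftrightarrow> norm n = 1 \<and> (\<forall>x\<in>F. \<forall>y\<in>F. n \<bullet> (x - y) = 0)"

definition elem_grad :: "'a::euclidean_space set \<Rightarrow> ('a \<Rightarrow> real) \<Rightarrow> 'a" where
  "elem_grad K v = (THE g. \<exists>b. \<forall>x\<in>K. v x = g \<bullet> x + b)"

text \<open>The element of \<open>\<K>\<close> adjacent to the face \<open>F\<close> on the side into which \<open>n\<close> points.\<close>

definition side_elem :: "'a::euclidean_space set set \<Rightarrow> 'a set \<Rightarrow> 'a \<Rightarrow> 'a set" where
  "side_elem \<K> F n = (THE K. K \<in> \<K> \<and> F \<subseteq> K \<and> (\<forall>x\<in>K. \<forall>y\<in>F. 0 \<le> n \<bullet> (x - y)))"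

definition normal_jump :: "'a::euclidean_space set set \<Rightarrow> 'a set \<Rightarrow> 'a \<Rightarrow> ('a \<Rightarrow> real) \<Rightarrow> real" where
  "normal_jump \<K> F n v =
     n \<bullet> elem_grad (side_elem \<K> F n) v - n \<bullet> elem_grad (side_elem \<K> F (- n)) v"

definition face_norm ::
  "real \<Rightarrow> 'a::euclidean_space set set \<Rightarrow> ('a set \<Rightarrow> 'a) \<Rightarrow> ('a \<Rightarrow> real) \<Rightarrow> real" where
  "face_norm \<tau> \<K> n v =
     sqrt (\<Sum>F\<in>interior_faces \<K>. \<tau> * (L2_norm_on surface_measure F (\<lambda>_. normal_jump \<K> F (n F) v))\<^sup>2)"

end

(*
On each element the gradient of v is constant, and by continuity of v its jump across a facet is the
normal jump. Take two elements of the cut mesh that meet a connected piece of the discrete surface of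
diameter O(h). A segment in general position near a common point shows that they are joined by a chain
of boundedly many facet neighbours inside the cut mesh, so their gradients differ by the local jump
energy e. No element needs a large intersection with the surface: the closest point projection is a
homeomorphism onto S, so by Brouwer's theorem every ball of radius h centred on the discrete surface
contains surface measure of order h^(d-1), and a point value of v is controlled by its local L2 norm
plus h times the gradient plus h times e.

It remains to bound h^2 times the sum of the squared gradients over a net of spacing h on S. In a
chart the discrete Poincare inequality on a grid makes the gradient g nearly constant and v nearly
affine. If the patch of S lies in no hyperplane, the values of v on the patch control g; if g is
controlled on part of a patch, it is controlled on all of it. The points of S without control therefore
form a compact, relatively open set, which is locally flat and has a point of maximal norm: a
contradiction. The slack factor h^2 between jumps and Poincare constant (of order h^(-2)) is exactly
what the estimate needs.
*)
theory Submission
  imports Defs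
begin

section \<open>Hausdorff measure\<close>

text \<open>The obstacle is the normal derivative. Over a flat piece of surface an affine function
  vanishing on that piece has neither jumps nor trace, while its gradient is arbitrary; so no
  estimate confined to one patch can hold, and the closedness of \<open>S\<close> has to enter. It
  enters by compactness, without explicit constants. They still do not depend on \<open>h\<close>,
  because goodness of a point is quantified over all small \<open>h\<close> and all functions that
  obey \<open>macro_data\<close>, a predicate in which neither the mesh nor the position of the cut
  occurs. Surface measure is bounded from below by one device: if a set sweeps out a region of known
  volume under a Lipschitz motion, its Hausdorff measure is at least of the order of that volume
  divided by the length of the motion. The device serves facets, contracted to the opposite vertex,
  and pieces of the discrete surface, translated along a normal of \<open>S\<close>.\<close>

definition hausdorff_outer :: "nat \<Rightarrow> 'a::metric_space set \<Rightarrow> ennreal" where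
  "hausdorff_outer s A = (SUP \<epsilon>\<in>{0<..}. hausdorff_pre s \<epsilon> A)"

lemma hausdorff_pre_le:
  assumes "A \<subseteq> (\<Union>i. C i)" "\<And>i. bounded (C i)" "\<And>i. diameter (C i) \<le> \<epsilon>"
  shows "hausdorff_pre s \<epsilon> A \<le> (\<Sum>i. ennreal (unit_ball_vol (real s) * (diameter (C i) / 2) ^ s))"
  unfolding hausdorff_pre_def using assms by (intro INF_lower) auto

lemma hausdorff_pre_antimono:
  assumes "\<epsilon> \<le> \<epsilon>'"
  shows "hausdorff_pre s \<epsilon>' A \<le> hausdorff_pre s \<epsilon> A"
  unfolding hausdorff_pre_def using assms
  by (intro INF_superset_mono) (auto intro: order_trans)

lemma hausdorff_pre_mono: "A \<subseteq> B \<Longrightarrow> hausdorff_pre s \<epsilon> A \<le> hausdorff_pre s \<epsilon> B"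
  unfolding hausdorff_pre_def by (intro INF_superset_mono) auto

text \<open>In dimension \<open>s = 0\<close> every empty member of a cover would cost 1, because
  \<open>0 ^ 0 = 1\<close>; the condition on \<open>s\<close> recurs wherever members of a cover are
  emptied.\<close>

lemma hausdorff_pre_empty:
  assumes "s \<ge> 1" "\<epsilon> \<ge> 0"
  shows "hausdorff_pre s \<epsilon> ({} :: 'a::metric_space set) = 0"
proof -
  have "hausdorff_pre s \<epsilon> ({} :: 'a set) \<le> (\<Sum>i::nat. ennreal (unit_ball_vol (real s) * (diameter ({} :: 'a set) / 2) ^ s))"
    using assms by (intro hausdorff_pre_le[where C="\<lambda>_. {}"]) auto
  also have "\<dots> = 0" using assms by (simp add: diameter_empty power_0_left)
  finally show ?thesis by simp
qed

lemma hausdorff_pre_subadditive: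
  "hausdorff_pre s \<epsilon> (\<Union>n. A n) \<le> (\<Sum>n. hausdorff_pre s \<epsilon> (A n))"
proof (rule ennreal_le_epsilon)
  fix e :: real
  assume e: "0 < e" and fin: "(\<Sum>n. hausdorff_pre s \<epsilon> (A n)) < top"
  let ?t = "\<lambda>C :: 'a set. ennreal (unit_ball_vol (real s) * (diameter C / 2) ^ s)"
  let ?w = "\<lambda>n. ennreal (e * (1/2) ^ Suc n)"
  have "\<exists>C. A n \<subseteq> (\<Union>i. C i) \<and> (\<forall>i. bounded (C i) \<and> diameter (C i) \<le> \<epsilon>)
      \<and> (\<Sum>i. ?t (C i)) \<le> hausdorff_pre s \<epsilon> (A n) + ?w n" for n
  proof -
    have "hausdorff_pre s \<epsilon> (A n) < top"
      using fin by (metis ennreal_suminf_lessD)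
    then have "hausdorff_pre s \<epsilon> (A n) < hausdorff_pre s \<epsilon> (A n) + ?w n"
      using e by (simp add: less_top[symmetric])
    then show ?thesis
      by (subst (asm) (1) hausdorff_pre_def, subst (asm) INF_less_iff) (auto intro: less_imp_le)
  qed
  then obtain C where C: "\<And>n. A n \<subseteq> (\<Union>i. C n i)"
      "\<And>n i. bounded (C n i)" "\<And>n i. diameter (C n i) \<le> \<epsilon>"
      "\<And>n. (\<Sum>i. ?t (C n i)) \<le> hausdorff_pre s \<epsilon> (A n) + ?w n"
    by metis
  define D where "D = case_prod C \<circ> prod_decode"
  have "(\<Union>n. A n) \<subseteq> (\<Union>i. D i)"
  proof
    fix x assume "x \<in> (\<Union>n. A n)"
    then obtain n i where "x \<in> C n i" using C(1) by blast
    then have "x \<in> D (prod_encode (n, i))" by (simp add: D_def)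
    then show "x \<in> (\<Union>i. D i)" by blast
  qed
  then have "hausdorff_pre s \<epsilon> (\<Union>n. A n) \<le> (\<Sum>i. ?t (D i))"
    using C(2,3) by (intro hausdorff_pre_le) (auto simp: D_def split: prod.split)
  also have "\<dots> = (\<Sum>i. (\<lambda>(n, j). ?t (C n j)) (prod_decode i))"
    by (simp add: D_def split_beta)
  also have "\<dots> = (\<Sum>n. \<Sum>j. ?t (C n j))"
    by (rule suminf_ennreal_2dimen) simp
  also have "\<dots> \<le> (\<Sum>n. hausdorff_pre s \<epsilon> (A n) + ?w n)"
    by (intro suminf_le C) auto
  also have "\<dots> = (\<Sum>n. hausdorff_pre s \<epsilon> (A n)) + (\<Sum>n. ?w n)"
    by (intro suminf_add[symmetric]) auto
  also have "(\<Sum>n. ?w n) = ennreal e"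
  proof -
    have "(\<lambda>n. e * (1/2) ^ Suc n) sums (e * 1)"
      by (intro sums_mult power_half_series)
    then show ?thesis
      using e by (subst suminf_ennreal2) (auto simp: sums_iff)
  qed
  finally show "hausdorff_pre s \<epsilon> (\<Union>n. A n) \<le> (\<Sum>n. hausdorff_pre s \<epsilon> (A n)) + ennreal e" .
qed

lemma hausdorff_pre_le_outer: "\<epsilon> > 0 \<Longrightarrow> hausdorff_pre s \<epsilon> A \<le> hausdorff_outer s A"
  unfolding hausdorff_outer_def by (intro SUP_upper) auto

lemma hausdorff_outer_mono: "A \<subseteq> B \<Longrightarrow> hausdorff_outer s A \<le> hausdorff_outer s B"
  unfolding hausdorff_outer_def by (intro SUP_mono) (auto intro: hausdorff_pre_mono)

lemma hausdorff_outer_empty: "s \<ge> 1 \<Longrightarrow> hausdorff_outer s {} = 0"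
  unfolding hausdorff_outer_def by (simp add: hausdorff_pre_empty)

lemma hausdorff_outer_subadditive:
  "hausdorff_outer s (\<Union>n. A n) \<le> (\<Sum>n. hausdorff_outer s (A n))"
  unfolding hausdorff_outer_def[of s "\<Union>n. A n"]
proof (rule SUP_least)
  fix \<epsilon> :: real assume "\<epsilon> \<in> {0<..}"
  then have "(\<Sum>n. hausdorff_pre s \<epsilon> (A n)) \<le> (\<Sum>n. hausdorff_outer s (A n))"
    by (intro suminf_le hausdorff_pre_le_outer) auto
  with hausdorff_pre_subadditive show "hausdorff_pre s \<epsilon> (\<Union>n. A n) \<le> (\<Sum>n. hausdorff_outer s (A n))"
    by (rule order_trans)
qed

lemma hausdorff_outer_Un_le:
  assumes "s \<ge> 1"
  shows "hausdorff_outer s (A \<union> B) \<le> hausdorff_outer s A + hausdorff_outer s B"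
proof -
  have "hausdorff_outer s (A \<union> B) \<le> (\<Sum>n. hausdorff_outer s (binaryset A B n))"
    using hausdorff_outer_subadditive[of s "binaryset A B"] by (simp add: UN_binaryset_eq)
  also have "\<dots> = hausdorff_outer s A + hausdorff_outer s B"
    using assms by (intro suminf_binaryset_eq) (simp add: hausdorff_outer_empty)
  finally show ?thesis .
qed

text \<open>A member of a cover with diameter below the gap \<eta> cannot meet both sets, so every
  cover splits into a cover of \<open>A\<close> and one of \<open>B\<close>.\<close>

lemma hausdorff_pre_separated:
  assumes "s \<ge> 1" "\<epsilon> > 0" "\<epsilon> < \<eta>" and sep: "\<And>a b. a \<in> A \<Longrightarrow> b \<in> B \<Longrightarrow> \<eta> \<le> dist a b"
  shows "hausdorff_pre s \<epsilon> A + hausdorff_pre s \<epsilon> B \<le> hausdorff_pre s \<epsilon> (A \<union> B)"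
  unfolding hausdorff_pre_def[of s \<epsilon> "A \<union> B"]
proof (rule INF_greatest, clarify)
  fix C :: "nat \<Rightarrow> 'a set"
  assume cov: "A \<union> B \<subseteq> (\<Union>i. C i)" and C: "\<forall>i. bounded (C i) \<and> diameter (C i) \<le> \<epsilon>"
  let ?t = "\<lambda>C :: 'a set. ennreal (unit_ball_vol (real s) * (diameter C / 2) ^ s)"
  let ?CA = "\<lambda>i. if C i \<inter> A = {} then {} else C i"
  let ?CB = "\<lambda>i. if C i \<inter> B = {} then {} else C i"
  have t0: "?t {} = 0" using assms by (simp add: diameter_empty power_0_left)
  have *: "C i \<inter> A = {} \<or> C i \<inter> B = {}" for i
  proof (rule ccontr)
    assume "\<not> ?thesis"
    then obtain a b where ab: "a \<in> C i" "a \<in> A" "b \<in> C i" "b \<in> B" by auto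
    then have "dist a b \<le> diameter (C i)" using C by (intro diameter_bounded_bound) auto
    with ab sep C \<open>\<epsilon> < \<eta>\<close> show False by (smt (verit))
  qed
  have "hausdorff_pre s \<epsilon> A + hausdorff_pre s \<epsilon> B \<le> (\<Sum>i. ?t (?CA i)) + (\<Sum>i. ?t (?CB i))"
    using cov C \<open>\<epsilon> > 0\<close> by (intro add_mono hausdorff_pre_le) (auto split: if_splits, blast+)
  also have "\<dots> = (\<Sum>i. ?t (?CA i) + ?t (?CB i))"
    by (intro suminf_add) auto
  also have "\<dots> \<le> (\<Sum>i. ?t (C i))"
    proof (intro suminf_le)
    fix i show "?t (?CA i) + ?t (?CB i) \<le> ?t (C i)"
      using *[of i] t0 by (cases "C i \<inter> A = {}"; cases "C i \<inter> B = {}") (simp_all del: diameter_empty)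
  qed auto
  finally show "hausdorff_pre s \<epsilon> A + hausdorff_pre s \<epsilon> B \<le> (\<Sum>i. ?t (C i))" .
qed

lemma hausdorff_outer_separated:
  assumes "s \<ge> 1" "\<eta> > 0" and sep: "\<And>a b. a \<in> A \<Longrightarrow> b \<in> B \<Longrightarrow> \<eta> \<le> dist a b"
  shows "hausdorff_outer s A + hausdorff_outer s B \<le> hausdorff_outer s (A \<union> B)"
proof -
  \<comment> \<open>Independent scales for the two sets allow the two suprema to be taken one after
    the other; a common smaller scale only increases the left side.\<close>
  have *: "hausdorff_pre s \<epsilon>1 A + hausdorff_pre s \<epsilon>2 B \<le> hausdorff_outer s (A \<union> B)"
    if "\<epsilon>1 > 0" "\<epsilon>2 > 0" for \<epsilon>1 \<epsilon>2
  proof -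
    define \<epsilon> where "\<epsilon> = min (min \<epsilon>1 \<epsilon>2) (\<eta>/2)"
    have e: "\<epsilon> > 0" "\<epsilon> < \<eta>" "\<epsilon> \<le> \<epsilon>1" "\<epsilon> \<le> \<epsilon>2" using that assms by (auto simp: \<epsilon>_def min_def)
    have "hausdorff_pre s \<epsilon>1 A + hausdorff_pre s \<epsilon>2 B \<le> hausdorff_pre s \<epsilon> A + hausdorff_pre s \<epsilon> B"
      using e by (intro add_mono hausdorff_pre_antimono)
    also have "\<dots> \<le> hausdorff_pre s \<epsilon> (A \<union> B)"
      using assms e by (intro hausdorff_pre_separated[of s \<epsilon> \<eta>])
    also have "\<dots> \<le> hausdorff_outer s (A \<union> B)" using e by (intro hausdorff_pre_le_outer)
    finally show ?thesis .
  qed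
  have "hausdorff_pre s \<epsilon>1 A + hausdorff_outer s B \<le> hausdorff_outer s (A \<union> B)" if "\<epsilon>1 > 0" for \<epsilon>1
  proof -
    have "hausdorff_pre s \<epsilon>1 A + hausdorff_outer s B = (SUP \<epsilon>2\<in>{0<..}. hausdorff_pre s \<epsilon>1 A + hausdorff_pre s \<epsilon>2 B)"
      unfolding hausdorff_outer_def by (subst ennreal_SUP_add_right) auto
    also have "\<dots> \<le> hausdorff_outer s (A \<union> B)" using * that by (intro SUP_least) auto
    finally show ?thesis .
  qed
  note ** = this
  have "hausdorff_outer s A + hausdorff_outer s B = (SUP \<epsilon>1\<in>{0<..}. hausdorff_pre s \<epsilon>1 A + hausdorff_outer s B)"
    unfolding hausdorff_outer_def[of s A] by (intro ennreal_SUP_add_left[symmetric]) auto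
  also have "\<dots> \<le> hausdorff_outer s (A \<union> B)" using ** by (intro SUP_least) auto
  finally show ?thesis .
qed

text \<open>This is Caratheodory's criterion for a closed set. The part of \<open>X\<close> off
  \<open>F\<close> is cut into shells \<open>R k\<close> by the distance to \<open>F\<close>. Shells
  of equal parity are separated, so the shell measures sum to at most twice the measure of
  \<open>X\<close>. The tail of this series bounds what lies off \<open>F\<close> and outside
  \<open>Y n\<close>, and \<open>Y n\<close> has positive distance from \<open>F\<close>.\<close>

lemma hausdorff_outer_closed_split:
  fixes F X :: "'a::metric_space set"
  assumes s: "s \<ge> 1" and F: "closed F" "F \<noteq> {}"
  shows "hausdorff_outer s (F \<inter> X) + hausdorff_outer s (X - F) \<le> hausdorff_outer s X"
proof (cases "hausdorff_outer s X = top")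
  case False
  let ?H = "hausdorff_outer s :: 'a set \<Rightarrow> ennreal"
  let ?g = "\<lambda>x. infdist x F"
  define Y where "Y n = {x \<in> X. 1 / Suc n \<le> ?g x}" for n
  define R where "R k = {x \<in> X. 1 / (k + 2) \<le> ?g x \<and> ?g x < 1 / Suc k}" for k :: nat
  have lip: "?g x - ?g y \<le> dist x y" for x y
    by (smt (verit) infdist_triangle dist_commute)
  have split: "X - F \<subseteq> Y n \<union> (\<Union>k. R (k + n))" for n
  proof
    fix x assume x: "x \<in> X - F"
    then have gp: "?g x > 0" using F by (simp add: infdist_pos_not_in_closed)
    show "x \<in> Y n \<union> (\<Union>k. R (k + n))"
    proof (cases "1 / Suc n \<le> ?g x")
      case True then show ?thesis using x by (simp add: Y_def)
    next
      case False
      obtain m where m: "1 / Suc m < ?g x" using gp reals_Archimedean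
        by (metis inverse_eq_divide)
      define j where "j = (LEAST j. 1 / Suc j \<le> ?g x)"
      have j: "1 / Suc j \<le> ?g x" unfolding j_def by (rule LeastI[of _ m]) (use m in simp)
      have jn: "j > n"
      proof (rule ccontr)
        assume "\<not> n < j"
        then have "1 / Suc n \<le> 1 / real (Suc j)" by (intro divide_left_mono) auto
        with j False show False by linarith
      qed
      have "\<not> 1 / Suc (j - 1) \<le> ?g x" unfolding j_def
        by (rule not_less_Least) (use jn j_def in linarith)
      then have "x \<in> R (j - 1 - n + n)" using j jn x by (auto simp: R_def of_nat_diff)
      then show ?thesis by blast
    qed
  qed
  \<comment> \<open>The shell \<open>R (m + 1)\<close> between the two sets is skipped, and its
    width is the gap.\<close>
  have sepR: "?H A + ?H (R (m + 2)) \<le> ?H (A \<union> R (m + 2))"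
    if A: "A \<subseteq> {x. 1 / real (m + 2) \<le> ?g x}" for A m
  proof (rule hausdorff_outer_separated[OF s, of "1 / real (m + 2) - 1 / real (m + 3)"])
    show "0 < 1 / real (m + 2) - 1 / real (m + 3)" by (auto intro!: divide_strict_left_mono)
    fix a b assume "a \<in> A" "b \<in> R (m + 2)"
    then show "1 / real (m + 2) - 1 / real (m + 3) \<le> dist a b"
      using lip[of a b] A by (auto simp: R_def algebra_simps)
  qed
  have sum_le: "(\<Sum>k<n. ?H (R (2 * k + p))) \<le> ?H (\<Union>k<n. R (2 * k + p))" for n p
  proof (induction n)
    case (Suc n)
    show ?case
    proof (cases n)
      case 0 then show ?thesis by (simp add: lessThan_Suc)
    next
      case (Suc m)
      have "(\<Union>k<n. R (2 * k + p)) \<subseteq> {x. 1 / ((2 * m + p) + 2) \<le> ?g x}"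
      proof safe
        fix x k assume "k < n" "x \<in> R (2 * k + p)"
        then have "1 / (real (2 * k + p) + 2) \<le> ?g x" by (simp add: R_def algebra_simps)
        moreover have "1 / (real (2 * m + p) + 2) \<le> 1 / (real (2 * k + p) + 2)"
          using \<open>k < n\<close> Suc by (intro divide_left_mono) auto
        ultimately show "1 / ((2 * m + p) + 2) \<le> ?g x" by (simp add: algebra_simps)
      qed
      from sepR[of _ "2 * m + p", OF this]
      have "?H (\<Union>k<n. R (2 * k + p)) + ?H (R (2 * n + p)) \<le> ?H ((\<Union>k<n. R (2 * k + p)) \<union> R (2 * n + p))"
        using Suc by (simp add: algebra_simps)
      moreover have "(\<Union>k<n. R (2 * k + p)) \<union> R (2 * n + p) = (\<Union>k<Suc n. R (2 * k + p))"
        by (auto simp: lessThan_Suc)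
      ultimately show ?thesis using order_trans[OF add_right_mono[OF Suc.IH]] by simp
    qed
  qed (simp add: hausdorff_outer_empty s)
  have subX: "?H (\<Union>k<n. R (2 * k + p)) \<le> ?H X" for n p
    by (intro hausdorff_outer_mono) (auto simp: R_def)
  have even_odd: "(\<Sum>k<2*n. ?H (R k)) = (\<Sum>k<n. ?H (R (2 * k + 0))) + (\<Sum>k<n. ?H (R (2 * k + 1)))" for n
    by (induction n) (auto simp: algebra_simps)
  have even: "(\<Sum>k<2*n. ?H (R k)) \<le> ?H X + ?H X" for n
    unfolding even_odd by (intro add_mono order_trans[OF sum_le subX])
  have "(\<Sum>k<n. ?H (R k)) \<le> ?H X + ?H X" for n
    by (rule order_trans[OF sum_mono2 even[of n]]) auto
  then have "(\<Sum>k. ?H (R k)) \<le> ?H X + ?H X" by (intro suminf_le_const) auto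
  also have "\<dots> < top" using False by (simp add: less_top)
  finally have fin: "(\<Sum>k. ?H (R k)) < top" .
  show ?thesis
  proof (rule ennreal_le_epsilon)
    fix e :: real assume e: "0 < e"
    have "\<exists>n. (\<Sum>k. ?H (R (k + n))) < ennreal e"
    proof -
      have "(\<lambda>n. (\<Sum>k. ?H (R k)) - (\<Sum>k<n. ?H (R k))) \<longlonglongrightarrow> (\<Sum>k. ?H (R k)) - (\<Sum>k. ?H (R k))"
        using fin by (intro tendsto_diff_ennreal tendsto_const summable_LIMSEQ) auto
      moreover have "(\<Sum>k. ?H (R k)) - (\<Sum>k<n. ?H (R k)) = (\<Sum>k. ?H (R (k + n)))" for n
      proof -
        have eq: "(\<Sum>k. ?H (R k)) = (\<Sum>k. ?H (R (k + n))) + (\<Sum>k<n. ?H (R k))"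
          by (rule suminf_offset) auto
        then have "(\<Sum>k<n. ?H (R k)) < top" using fin
          by (metis ennreal_add_eq_top less_top)
        then show ?thesis unfolding eq by (intro ennreal_add_diff_cancel_right) (simp add: less_top)
      qed
      ultimately have "(\<lambda>n. (\<Sum>k. ?H (R (k + n)))) \<longlonglongrightarrow> 0" using fin by simp
      then have "eventually (\<lambda>n. (\<Sum>k. ?H (R (k + n))) < ennreal e) sequentially"
        using e by (intro order_tendstoD(2)) auto
      then show ?thesis by (meson eventually_sequentially order_refl)
    qed
    then obtain n where n: "(\<Sum>k. ?H (R (k + n))) < ennreal e" by blast
    have "?H (X - F) \<le> ?H (Y n \<union> (\<Union>k. R (k + n)))" by (intro hausdorff_outer_mono split)
    also have "\<dots> \<le> ?H (Y n) + ?H (\<Union>k. R (k + n))" by (rule hausdorff_outer_Un_le[OF s])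
    also have "\<dots> \<le> ?H (Y n) + ennreal e"
      using hausdorff_outer_subadditive[of s "\<lambda>k. R (k + n)"] n by (intro add_left_mono) auto
    finally have 1: "?H (F \<inter> X) + ?H (X - F) \<le> (?H (F \<inter> X) + ?H (Y n)) + ennreal e"
      by (simp add: add.assoc add_left_mono)
    have "?H (F \<inter> X) + ?H (Y n) \<le> ?H ((F \<inter> X) \<union> Y n)"
    proof (rule hausdorff_outer_separated[OF s, of "1 / Suc n"])
      fix a b assume "a \<in> F \<inter> X" "b \<in> Y n"
      then show "1 / real (Suc n) \<le> dist a b"
        using infdist_le[of a F b] by (auto simp: Y_def dist_commute)
    qed simp
    also have "\<dots> \<le> ?H X" by (intro hausdorff_outer_mono) (auto simp: Y_def)
    finally show "?H (F \<inter> X) + ?H (X - F) \<le> ?H X + ennreal e"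
      using 1 by (meson add_right_mono order_trans)
  qed
qed simp

lemma hausdorff_outer_space:
  "s \<ge> 1 \<Longrightarrow> outer_measure_space (Pow UNIV) (hausdorff_outer s :: 'a::metric_space set \<Rightarrow> ennreal)"
  unfolding outer_measure_space_def positive_def increasing_def countably_subadditive_def
  by (auto simp: hausdorff_outer_empty hausdorff_outer_mono hausdorff_outer_subadditive)

lemma sets_hausdorff_measure [simp, measurable_cong]: "sets (hausdorff_measure s) = sets borel"
  unfolding hausdorff_measure_def by (simp add: sets.sigma_sets_eq[of borel, simplified])

text \<open>\<open>measure_of\<close> keeps the given set function only if it is countably additive
  on the Borel sets. On the Caratheodory sets it is, and these form a sigma algebra that contains
  the closed sets.\<close>

lemma emeasure_hausdorff_measure:
  fixes A :: "'a::metric_space set"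
  assumes s: "s \<ge> 1" and A: "A \<in> sets borel"
  shows "emeasure (hausdorff_measure s) A = hausdorff_outer s A"
proof -
  let ?H = "hausdorff_outer s :: 'a set \<Rightarrow> ennreal"
  define L where "L = lambda_system UNIV (Pow UNIV) ?H"
  interpret P: sigma_algebra "UNIV :: 'a set" "Pow UNIV" by (rule sigma_algebra_Pow)
  have ms: "measure_space UNIV L ?H"
    unfolding L_def by (rule P.caratheodory_lemma[OF hausdorff_outer_space[OF s]])
  then interpret L: sigma_algebra UNIV L by (simp add: measure_space_def)
  have cl: "F \<in> L" if "closed F" for F
  proof (cases "F = {}")
    case False
    have "?H (F \<inter> X) + ?H ((UNIV - F) \<inter> X) = ?H X" for X
    proof (rule antisym)
      have "(UNIV - F) \<inter> X = X - F" by auto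
      then show "?H (F \<inter> X) + ?H ((UNIV - F) \<inter> X) \<le> ?H X"
        using hausdorff_outer_closed_split[OF s that False, of X] by simp
      have "X = (F \<inter> X) \<union> ((UNIV - F) \<inter> X)" by auto
      then show "?H X \<le> ?H (F \<inter> X) + ?H ((UNIV - F) \<inter> X)"
        by (metis hausdorff_outer_Un_le[OF s])
    qed
    then show ?thesis by (auto simp: L_def lambda_system_def)
  qed simp
  have "sets (borel :: 'a measure) \<subseteq> L"
    unfolding borel_eq_closed by (subst sets_measure_of) (auto intro!: L.sigma_sets_subset cl)
  then have "measure_space UNIV (sets borel) ?H"
    using ms sets.sigma_algebra_axioms[of "borel :: 'a measure"]
    by (auto simp: measure_space_def positive_def countably_additive_def)
  then show ?thesis
    unfolding hausdorff_measure_def hausdorff_outer_def[symmetric]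
    using A by (intro emeasure_measure_of_sigma) (auto simp: measure_space_def)
qed

section \<open>Packing bounds and volumes swept by moving sets\<close>

lemma ball_packing:
  fixes c :: "'i \<Rightarrow> 'a::euclidean_space"
  assumes fin: "finite I" and disj: "disjoint_family_on (\<lambda>i. ball (c i) r) I"
    and sub: "\<And>i. i \<in> I \<Longrightarrow> ball (c i) r \<subseteq> cball p R" and r: "r > 0" and R: "R \<ge> 0"
  shows "real (card I) * r ^ DIM('a) \<le> R ^ DIM('a)"
proof -
  let ?V = "unit_ball_vol (real DIM('a))"
  have "real (card I) * (?V * r ^ DIM('a)) = (\<Sum>i\<in>I. measure lborel (ball (c i) r))"
    using r by (simp add: content_ball)
  also have "\<dots> = measure lborel (\<Union>i\<in>I. ball (c i) r)"
    using fin disj by (intro measure_finite_Union[symmetric]) (auto simp: emeasure_ball r less_imp_le)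
  also have "\<dots> \<le> measure lborel (cball p R)"
    using sub fin by (intro measure_mono_fmeasurable) (auto intro: lmeasurable_cball simp: fmeasurable_def emeasure_cball R)
  also have "\<dots> = ?V * R ^ DIM('a)" using R by (simp add: content_cball)
  finally have "?V * (real (card I) * r ^ DIM('a)) \<le> ?V * R ^ DIM('a)" by (simp add: algebra_simps)
  then show ?thesis by (simp add: mult_le_cancel_left_pos)
qed

lemma emeasure_cover_le:
  fixes p :: "nat \<Rightarrow> 'a::euclidean_space"
  assumes "r \<ge> 0"
  shows "emeasure lborel (\<Union>k\<le>n. cball (p k) r)
    \<le> ennreal (real (Suc n) * (unit_ball_vol (real DIM('a)) * r ^ DIM('a)))"
proof -
  have "emeasure lborel (\<Union>k\<in>{..n}. cball (p k) r) \<le> (\<Sum>k\<in>{..n}. emeasure lborel (cball (p k) r))"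
    by (rule emeasure_subadditive_finite) auto
  also have "\<dots> = ennreal (real (Suc n) * (unit_ball_vol (real DIM('a)) * r ^ DIM('a)))"
    using assms by (simp add: emeasure_cball ennreal_mult ennreal_of_nat_eq_real_of_nat)
  finally show ?thesis .
qed

text \<open>The homotopy \<open>\<Psi>\<close> sweeps a set of diameter \<open>d\<close> through a region that is covered by about
  \<open>L / d\<close> balls of radius \<open>2 * d\<close>.\<close>

lemma sweep_small:
  fixes C :: "'a::euclidean_space set" and \<Psi> :: "'a \<Rightarrow> real \<Rightarrow> 'a"
  assumes d: "0 < d" "d \<le> L" "bounded C" "diameter C \<le> d"
    and \<Psi>1: "\<And>a a' s. s \<in> {0..1} \<Longrightarrow> norm (\<Psi> a s - \<Psi> a' s) \<le> norm (a - a')"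
    and \<Psi>2: "\<And>a s s'. a \<in> C \<Longrightarrow> norm (\<Psi> a s - \<Psi> a s') \<le> L * \<bar>s - s'\<bar>"
  shows "\<exists>U. U \<in> sets lborel \<and> {\<Psi> a s |a s. a \<in> C \<and> s \<in> {0..1}} \<subseteq> U \<and>
     emeasure lborel U \<le> ennreal (3 * 2 ^ DIM('a) * unit_ball_vol (real DIM('a)) * L * d ^ (DIM('a) - 1))"
proof (cases "C = {}")
  case False
  then obtain c where c: "c \<in> C" by blast
  let ?V = "unit_ball_vol (real DIM('a))"
  define n where "n = nat \<lceil>L / d\<rceil>"
  have Ld: "L / d \<ge> 1" using d by simp
  then have n: "L / d \<le> n" "n > 0" "real n \<le> L / d + 1" unfolding n_def by linarith+
  \<comment> \<open>Radius \<open>2 * d\<close>: one \<open>d\<close> for the diameter of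
    \<open>C\<close>, one for the motion of its centre between consecutive times
    \<open>k / n\<close>.\<close>
  define U where "U = (\<Union>k\<le>n. cball (\<Psi> c (k / n)) (2 * d))"
  have "\<Psi> a s \<in> U" if a: "a \<in> C" "s \<in> {0..1}" for a s
  proof -
    define k where "k = nat \<lfloor>s * n\<rfloor>"
    have sn: "0 \<le> s * n" "s * n \<le> n" using that n by (auto simp: mult_le_cancel_right1)
    then have k: "k \<le> n" "k \<le> s * n" "s * n \<le> k + 1" unfolding k_def by linarith+
    have "k / n \<le> s" "s \<le> (k + 1) / n" using k n by (auto simp: field_simps)
    then have "\<bar>s - k / n\<bar> \<le> 1 / n" by (simp add: add_divide_distrib)
    then have "L * \<bar>s - k / n\<bar> \<le> L * (1 / n)" using d by (intro mult_left_mono) auto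
    also have "\<dots> \<le> d" using n d by (simp add: field_simps)
    finally have 1: "norm (\<Psi> c s - \<Psi> c (k / n)) \<le> d" using \<Psi>2[OF c, of s "k/n"] by linarith
    have "norm (a - c) \<le> d"
      using diameter_bounded_bound[OF \<open>bounded C\<close> a(1) c] d by (simp add: dist_norm)
    then have 2: "norm (\<Psi> a s - \<Psi> c s) \<le> d" using \<Psi>1[OF a(2), of a c] by linarith
    have "dist (\<Psi> c (k / n)) (\<Psi> a s) \<le> 2 * d"
      using 1 2 norm_triangle_ineq[of "\<Psi> a s - \<Psi> c s" "\<Psi> c s - \<Psi> c (k / n)"]
      by (simp add: dist_norm norm_minus_commute)
    then show ?thesis using k(1) by (auto simp: U_def)
  qed
  then have 1: "{\<Psi> a s |a s. a \<in> C \<and> s \<in> {0..1}} \<subseteq> U" by blast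
  have "emeasure lborel U \<le> ennreal (real (Suc n) * (?V * (2 * d) ^ DIM('a)))"
    unfolding U_def by (rule emeasure_cover_le) (use d in auto)
  also have "\<dots> \<le> ennreal (3 * 2 ^ DIM('a) * ?V * L * d ^ (DIM('a) - 1))"
  proof (rule ennreal_leI)
    have "real (Suc n) \<le> 3 * (L / d)" using n Ld by simp
    then have "real (Suc n) * (?V * (2 * d) ^ DIM('a)) \<le> 3 * (L / d) * (?V * (2 * d) ^ DIM('a))"
      using d by (intro mult_right_mono) auto
    also have "\<dots> = 3 * 2 ^ DIM('a) * ?V * L * d ^ (DIM('a) - 1)"
      using d by (simp add: power_mult_distrib power_eq_if[of d "DIM('a)"])
    finally show "real (Suc n) * (?V * (2 * d) ^ DIM('a)) \<le> 3 * 2 ^ DIM('a) * ?V * L * d ^ (DIM('a) - 1)" .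
  qed
  finally show ?thesis using 1 by (intro exI[of _ U]) (auto simp: U_def)
qed (intro exI[of _ "{}"], auto)

text \<open>The factors before \<open>2 ^ (d - 1)\<close> are those of \<open>sweep_small\<close>;
  the rest converts the power \<open>d - 1\<close> of a diameter into the normalised summand of the
  Hausdorff measure.\<close>

definition sweep_const :: "nat \<Rightarrow> real" where
  "sweep_const d = 3 * 2 ^ d * unit_ball_vol (real d) * 2 ^ (d - 1) / unit_ball_vol (real (d - 1))"

lemma sweep_const_pos: "sweep_const d > 0"
  by (simp add: sweep_const_def)

text \<open>Sweeping every member of a cover of \<open>A\<close> yields a cover of \<open>Z\<close>.
  The bound is used backwards: a region of known volume forces a lower bound on the measure of
  \<open>A\<close>.\<close>

lemma sweep_volume:
  fixes A Z :: "'a::euclidean_space set" and \<Psi> :: "'a \<Rightarrow> real \<Rightarrow> 'a"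
  assumes dim: "DIM('a) \<ge> 2" and L: "L > 0" and Z: "Z \<in> sets lborel"
    and ZA: "Z \<subseteq> {\<Psi> a s |a s. a \<in> A \<and> s \<in> {0..1}}"
    and \<Psi>1: "\<And>a a' s. s \<in> {0..1} \<Longrightarrow> norm (\<Psi> a s - \<Psi> a' s) \<le> norm (a - a')"
    and \<Psi>2: "\<And>a s s'. a \<in> A \<Longrightarrow> norm (\<Psi> a s - \<Psi> a s') \<le> L * \<bar>s - s'\<bar>"
  shows "emeasure lborel Z \<le> ennreal (sweep_const DIM('a) * L) * hausdorff_outer (DIM('a) - 1) A"
proof -
  let ?s = "DIM('a) - 1"
  let ?u = "unit_ball_vol (real ?s)"
  define B where "B = 3 * 2 ^ DIM('a) * unit_ball_vol (real DIM('a)) * L"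
  have B: "B > 0" using L by (simp add: B_def)
  have s1: "?s \<ge> 1" using dim by simp
  have u: "?u \<noteq> 0" using unit_ball_vol_pos[of "real ?s"] by linarith
  have Bu: "B * d ^ ?s = sweep_const DIM('a) * L * (?u * (d / 2) ^ ?s)" for d
    using u by (simp add: B_def sweep_const_def power_divide del: of_nat_diff)
  have main: "emeasure lborel Z \<le> ennreal (sweep_const DIM('a) * L) * (\<Sum>i. ennreal (?u * (diameter (C i) / 2) ^ ?s))"
    if cov: "A \<subseteq> (\<Union>i. C i)" and C: "\<forall>i. bounded (C i) \<and> diameter (C i) \<le> L" for C :: "nat \<Rightarrow> 'a set"
  proof (rule ennreal_le_epsilon)
    fix e :: real assume e: "e > 0"
    \<comment> \<open>Sets of diameter 0 get an artificial positive width, since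
      \<open>sweep_small\<close> needs \<open>0 < d\<close>; the widths are so small that together
      they cost at most \<open>e\<close>.\<close>
    define w where "w i = (min (min L 1) (e / B * (1/2) ^ Suc i))" for i
    define d where "d i = (if diameter (C i) = 0 then w i else diameter (C i))" for i
    have w: "0 < w i" "w i \<le> L" "w i \<le> 1" "w i \<le> e / B * (1/2) ^ Suc i" for i
      using L e B by (auto simp: w_def)
    have d: "0 < d i" "d i \<le> L" "diameter (C i) \<le> d i" for i
      using w[of i] C diameter_ge_0[of "C i"] by (auto simp: d_def less_le)
    have dp: "B * d i ^ ?s \<le> B * diameter (C i) ^ ?s + e * (1/2) ^ Suc i" for i
    proof (cases "diameter (C i) = 0")
      case True
      have "w i ^ ?s \<le> w i ^ 1" using w[of i] s1 by (intro power_decreasing) auto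
      also have "\<dots> \<le> e / B * (1/2) ^ Suc i" using w[of i] by simp
      finally have "B * w i ^ ?s \<le> B * (e / B * (1/2) ^ Suc i)" using B by (intro mult_left_mono) auto
      then show ?thesis using True B s1 by (simp add: d_def zero_power)
    next
      case False then show ?thesis using e by (simp add: d_def)
    qed
    have exU: "\<exists>U. U \<in> sets lborel \<and> {\<Psi> a s |a s. a \<in> C i \<inter> A \<and> s \<in> {0..1}} \<subseteq> U \<and>
       emeasure lborel U \<le> ennreal (B * d i ^ ?s)" for i
    proof -
      have "bounded (C i \<inter> A)" using C by (meson bounded_Int)
      moreover have "diameter (C i \<inter> A) \<le> d i"
        using d(3)[of i] diameter_subset[of "C i \<inter> A" "C i"] C by (meson inf_le1 order_trans)
      ultimately show ?thesis
        unfolding B_def using d \<Psi>1 \<Psi>2 by (intro sweep_small) auto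
    qed
    from choice[OF allI[OF exU]] obtain U where "\<forall>i. U i \<in> sets lborel \<and>
        {\<Psi> a s |a s. a \<in> C i \<inter> A \<and> s \<in> {0..1}} \<subseteq> U i \<and> emeasure lborel (U i) \<le> ennreal (B * d i ^ ?s)"
      by (rule exE)
    then have U: "\<And>i. U i \<in> sets lborel"
        "\<And>i. {\<Psi> a s |a s. a \<in> C i \<inter> A \<and> s \<in> {0..1}} \<subseteq> U i"
        "\<And>i. emeasure lborel (U i) \<le> ennreal (B * d i ^ ?s)" by simp_all
    have "Z \<subseteq> (\<Union>i. U i)"
    proof
      fix z assume "z \<in> Z"
      then obtain a s where "a \<in> A" "s \<in> {0..1}" "z = \<Psi> a s" using ZA by blast
      moreover then obtain i where "a \<in> C i" using cov by blast
      ultimately show "z \<in> (\<Union>i. U i)" using U(2)[of i] by blast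
    qed
    then have "emeasure lborel Z \<le> emeasure lborel (\<Union>i. U i)"
      using U(1) by (intro emeasure_mono) auto
    also have "\<dots> \<le> (\<Sum>i. emeasure lborel (U i))"
      using U(1) by (intro emeasure_subadditive_countably) auto
    also have "\<dots> \<le> (\<Sum>i. ennreal (B * diameter (C i) ^ ?s + e * (1/2) ^ Suc i))"
      by (intro suminf_le allI order_trans[OF U(3)] ennreal_leI dp) auto
    also have "\<dots> = (\<Sum>i. ennreal (B * diameter (C i) ^ ?s) + ennreal (e * (1/2) ^ Suc i))"
      using B e C by (intro arg_cong[where f=suminf] ext ennreal_plus) (auto simp: diameter_ge_0)
    also have "\<dots> = (\<Sum>i. ennreal (B * diameter (C i) ^ ?s)) + (\<Sum>i. ennreal (e * (1/2) ^ Suc i))"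
      by (intro suminf_add[symmetric]) auto
    also have "(\<Sum>i. ennreal (B * diameter (C i) ^ ?s))
        = (\<Sum>i. ennreal (sweep_const DIM('a) * L) * ennreal (?u * (diameter (C i) / 2) ^ ?s))"
      unfolding Bu using L sweep_const_pos[of "DIM('a)"] C
      by (intro arg_cong[where f=suminf] ext ennreal_mult) (auto simp: diameter_ge_0)
    also have "\<dots> = ennreal (sweep_const DIM('a) * L) * (\<Sum>i. ennreal (?u * (diameter (C i) / 2) ^ ?s))"
      by simp
    also have "(\<Sum>i. ennreal (e * (1/2) ^ Suc i)) = ennreal e"
    proof -
      have "(\<lambda>n. e * (1/2) ^ Suc n) sums (e * 1)"
        by (intro sums_mult power_half_series)
      then show ?thesis
        using e by (subst suminf_ennreal2) (auto simp: sums_iff)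
    qed
    finally show "emeasure lborel Z \<le> ennreal (sweep_const DIM('a) * L) * (\<Sum>i. ennreal (?u * (diameter (C i) / 2) ^ ?s)) + ennreal e" .
  qed
  have K: "ennreal (sweep_const DIM('a) * L) \<noteq> 0" using L sweep_const_pos[of "DIM('a)"] by simp
  \<comment> \<open>Covers at scale \<open>L\<close> already suffice, because
    \<open>sweep_small\<close> asks only for \<open>d \<le> L\<close>.\<close>
  have "emeasure lborel Z / ennreal (sweep_const DIM('a) * L) \<le> hausdorff_pre ?s L A"
    unfolding hausdorff_pre_def
  proof (rule INF_greatest, clarify)
    fix C :: "nat \<Rightarrow> 'a set"
    assume "A \<subseteq> (\<Union>i. C i)" "\<forall>i. bounded (C i) \<and> diameter (C i) \<le> L"
    from main[OF this] show "emeasure lborel Z / ennreal (sweep_const DIM('a) * L)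
        \<le> (\<Sum>i. ennreal (?u * (diameter (C i) / 2) ^ ?s))"
      using divide_right_mono_ennreal[of "emeasure lborel Z" _ "ennreal (sweep_const DIM('a) * L)"]
        mult_divide_eq_ennreal[OF K ennreal_neq_top] by (metis mult.commute)
  qed
  also have "\<dots> \<le> hausdorff_outer ?s A" using L by (rule hausdorff_pre_le_outer)
  finally have "emeasure lborel Z / ennreal (sweep_const DIM('a) * L) * ennreal (sweep_const DIM('a) * L)
     \<le> hausdorff_outer ?s A * ennreal (sweep_const DIM('a) * L)" by (rule mult_right_mono) simp
  moreover have "emeasure lborel Z / ennreal (sweep_const DIM('a) * L) * ennreal (sweep_const DIM('a) * L) = emeasure lborel Z"
    using mult_divide_eq_ennreal[OF K ennreal_neq_top] by (metis ennreal_times_divide mult.commute)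
  ultimately show ?thesis by (simp only: mult.commute)
qed

text \<open>A maximal \<epsilon>-separated subset is an \<epsilon>-net, so counting separated points
  bounds the measure. They are counted with full-dimensional volume, by stacking about
  \<open>1 / \<epsilon>\<close> copies of the subset along the normal. Finiteness makes the
  integrals over facets and over the discrete surface meaningful.\<close>

lemma hausdorff_outer_hyperplane_finite:
  fixes A :: "'a::euclidean_space set"
  assumes "DIM('a) \<ge> 2" "bounded A" "\<nu> \<noteq> 0" and A: "A \<subseteq> {x. \<nu> \<bullet> x = b}"
  shows "hausdorff_outer (DIM('a) - 1) A < top"
proof -
  let ?d = "DIM('a)"
  define \<mu> where "\<mu> = sgn \<nu>"
  have \<mu>: "norm \<mu> = 1" "\<mu> \<bullet> \<mu> = 1" using \<open>\<nu> \<noteq> 0\<close> by (auto simp: \<mu>_def norm_sgn dot_square_norm)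
  have A\<mu>: "\<mu> \<bullet> (x - y) = 0" if "x \<in> A" "y \<in> A" for x y
    using that A by (auto simp: \<mu>_def sgn_div_norm inner_diff_right)
  obtain p R where R: "A \<subseteq> cball p R" using \<open>bounded A\<close> bounded_subset_cball by blast
  \<comment> \<open>The 3 leaves room for a stack of height at most 2 and balls of radius at most
    1.\<close>
  define R' where "R' = \<bar>R\<bar> + 3"
  have R0: "R' \<ge> 0" by (simp add: R'_def)
  define M where "M = 2 ^ ?d * R' ^ ?d"
  have sep_card: "real (card Z) * \<epsilon> ^ (?d - 1) \<le> M"
    if Z: "Z \<subseteq> A" "finite Z" and \<epsilon>: "0 < \<epsilon>" "\<epsilon> \<le> 1" and sep: "\<And>x y. x \<in> Z \<Longrightarrow> y \<in> Z \<Longrightarrow> x \<noteq> y \<Longrightarrow> dist x y \<ge> \<epsilon>"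
    for Z \<epsilon>
  proof -
    define n where "n = nat \<lceil>1 / \<epsilon>\<rceil>"
    have "1 / \<epsilon> \<ge> 1" using \<epsilon> by simp
    then have n: "1 / \<epsilon> \<le> n" "real n \<le> 1 / \<epsilon> + 1" "n > 0" unfolding n_def by linarith+
    \<comment> \<open>By Pythagoras the shifted copies are still \<epsilon>-separated, inside one
      copy and across copies.\<close>
    define c where "c = (\<lambda>(z :: 'a, k :: nat). z + (k * \<epsilon>) *\<^sub>R \<mu>)"
    have cd: "dist (c (z, k)) (c (z', k')) \<ge> \<epsilon>"
      if zz: "z \<in> Z" "z' \<in> Z" "(z, k) \<noteq> (z', k')" for z z' k k'
    proof -
      have "(norm (c (z, k) - c (z', k')))\<^sup>2 = (norm (z - z'))\<^sup>2 + ((real k - real k') * \<epsilon>)\<^sup>2"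
      proof -
        have "c (z, k) - c (z', k') = (z - z') + ((real k - real k') * \<epsilon>) *\<^sub>R \<mu>"
          by (simp add: c_def algebra_simps)
        moreover have "\<mu> \<bullet> (z - z') = 0" "(z - z') \<bullet> \<mu> = 0" using A\<mu> zz Z by (auto simp: inner_commute)
        ultimately show ?thesis
          unfolding power2_norm_eq_inner by (simp add: inner_add_left inner_add_right \<mu> power2_eq_square)
      qed
      moreover have "(norm (z - z'))\<^sup>2 \<ge> \<epsilon>\<^sup>2 \<or> ((real k - real k') * \<epsilon>)\<^sup>2 \<ge> \<epsilon>\<^sup>2"
      proof (cases "z = z'")
        case True
        then have "1 \<le> \<bar>real k - real k'\<bar>" using zz by auto
        then have "1 \<le> (real k - real k')\<^sup>2" by (metis abs_le_square_iff abs_one one_power2)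
        then show ?thesis by (simp add: power_mult_distrib mult_le_cancel_right1)
      next
        case False then show ?thesis using sep[of z z'] zz \<epsilon> by (auto simp: dist_norm)
      qed
      ultimately have "\<epsilon>\<^sup>2 \<le> (norm (c (z, k) - c (z', k')))\<^sup>2"
        by (smt (verit) zero_le_power2)
      then show ?thesis using \<epsilon> by (simp add: dist_norm abs_le_square_iff[symmetric])
    qed
    have "real (card (Z \<times> {..<n})) * (\<epsilon> / 2) ^ ?d \<le> R' ^ ?d"
    proof (rule ball_packing[where c=c and p=p])
      show "disjoint_family_on (\<lambda>i. ball (c i) (\<epsilon> / 2)) (Z \<times> {..<n})"
        unfolding disjoint_family_on_def
      proof (intro ballI impI equals0I)
        fix i j x
        assume ij: "i \<in> Z \<times> {..<n}" "j \<in> Z \<times> {..<n}" "i \<noteq> j"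
          and "x \<in> ball (c i) (\<epsilon> / 2) \<inter> ball (c j) (\<epsilon> / 2)"
        then have "dist (c i) (c j) < \<epsilon>"
          using dist_triangle_half_l[of "c i" x \<epsilon> "c j"] by (auto simp: dist_commute)
        then show False using cd[of "fst i" "fst j" "snd i" "snd j"] ij by auto
      qed
      fix i assume "i \<in> Z \<times> {..<n}"
      then obtain z k where i: "i = (z, k)" "z \<in> Z" "k < n" by auto
      have "k * \<epsilon> \<le> n * \<epsilon>" using i \<epsilon> by auto
      also have "\<dots> \<le> (1 / \<epsilon> + 1) * \<epsilon>" using n \<epsilon> by (intro mult_right_mono) auto
      also have "\<dots> \<le> 2" using \<epsilon> by (simp add: field_simps)
      finally have k2: "k * \<epsilon> \<le> 2" .
      show "ball (c i) (\<epsilon> / 2) \<subseteq> cball p R'"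
      proof
        fix x assume "x \<in> ball (c i) (\<epsilon> / 2)"
        then have "dist (c i) x \<le> 1" using \<epsilon> by simp
        moreover have "dist z (c i) \<le> 2" using k2 \<epsilon> \<mu> by (simp add: i c_def dist_norm)
        moreover have "dist p z \<le> \<bar>R\<bar>" using R Z i by force
        ultimately show "x \<in> cball p R'"
          using dist_triangle[of p x z] dist_triangle[of z x "c i"] by (simp add: R'_def)
      qed
    qed (use \<epsilon> Z R0 in auto)
    then have "real (card Z) * n * \<epsilon> ^ ?d \<le> M"
      by (simp add: M_def power_divide field_simps card_cartesian_product)
    moreover have "real (card Z) * \<epsilon> ^ (?d - 1) \<le> real (card Z) * n * \<epsilon> ^ ?d"
    proof -
      have "\<epsilon> ^ (?d - 1) = 1 / \<epsilon> * \<epsilon> ^ ?d" using \<epsilon> by (simp add: power_eq_if[of \<epsilon> ?d])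
      also have "\<dots> \<le> n * \<epsilon> ^ ?d" using n \<epsilon> by (intro mult_right_mono) auto
      finally show ?thesis by (simp add: mult.assoc mult_left_mono)
    qed
    ultimately show ?thesis by linarith
  qed
  define s where "s = ?d - 1"
  have s0: "s \<noteq> 0" using assms by (simp add: s_def)
    have "hausdorff_pre s \<delta> A \<le> ennreal (unit_ball_vol (real s) * M)" if "\<delta> > 0" for \<delta>
    proof -
      define \<epsilon> where "\<epsilon> = min 1 (\<delta> / 2)"
      have \<epsilon>: "0 < \<epsilon>" "\<epsilon> \<le> 1" "2 * \<epsilon> \<le> \<delta>" using that by (auto simp: \<epsilon>_def)
      define \<Z> where "\<Z> = {Z. finite Z \<and> Z \<subseteq> A \<and> (\<forall>x\<in>Z. \<forall>y\<in>Z. x \<noteq> y \<longrightarrow> dist x y \<ge> \<epsilon>)}"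
      have bnd: "card Z \<le> nat \<lceil>M / \<epsilon> ^ s\<rceil>" if "Z \<in> \<Z>" for Z
      proof -
        have "real (card Z) * \<epsilon> ^ s \<le> M" using sep_card[of Z \<epsilon>] that \<epsilon> unfolding s_def \<Z>_def by auto
        then have "real (card Z) \<le> M / \<epsilon> ^ s" using \<epsilon> by (simp add: field_simps)
        then show ?thesis by linarith
      qed
      have "{} \<in> \<Z>" by (auto simp: \<Z>_def)
      then have "\<exists>Z. Z \<in> \<Z> \<and> (\<forall>Z'. Z' \<in> \<Z> \<longrightarrow> card Z' \<le> card Z)"
        by (intro ex_has_greatest_nat[of _ _ _ "Suc (nat \<lceil>M / \<epsilon> ^ s\<rceil>)"]) (auto simp: less_Suc_eq_le bnd)
      then obtain Z where Z: "Z \<in> \<Z>" and max: "\<And>Z'. Z' \<in> \<Z> \<Longrightarrow> card Z' \<le> card Z" by blast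
      have finZ: "finite Z" using Z by (auto simp: \<Z>_def)
      have cov: "\<exists>z\<in>Z. dist z x \<le> \<epsilon>" if "x \<in> A" for x
      proof (rule ccontr)
        assume *: "\<not> ?thesis"
        then have xZ: "x \<notin> Z" using \<epsilon> by force
        have "insert x Z \<in> \<Z>" using * Z that by (auto simp: \<Z>_def dist_commute not_le less_imp_le)
        then show False using max[of "insert x Z"] xZ finZ by simp
      qed
      obtain f where f: "bij_betw f {..<card Z} Z"
        using ex_bij_betw_nat_finite[OF finZ] by (auto simp: atLeast0LessThan)
      define C where "C i = (if i < card Z then cball (f i) \<epsilon> else {})" for i
      have "A \<subseteq> (\<Union>i. C i)"
      proof
        fix x assume "x \<in> A"
        then obtain z where z: "z \<in> Z" "dist z x \<le> \<epsilon>" using cov by blast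
        then obtain i where "i < card Z" "f i = z" using f unfolding bij_betw_def by (metis imageE lessThan_iff)
        then have "x \<in> C i" using z by (simp add: C_def)
        then show "x \<in> (\<Union>i. C i)" by blast
      qed
      then have "hausdorff_pre s \<delta> A \<le> (\<Sum>i. ennreal (unit_ball_vol (real s) * (diameter (C i) / 2) ^ s))"
        using \<epsilon> that by (intro hausdorff_pre_le) (auto simp: C_def)
      also have "\<dots> = (\<Sum>i<card Z. ennreal (unit_ball_vol (real s) * (diameter (C i) / 2) ^ s))"
        using s0 by (intro suminf_finite) (auto simp: C_def)
      also have "\<dots> = (\<Sum>i<card Z. ennreal (unit_ball_vol (real s) * \<epsilon> ^ s))"
        using \<epsilon> by (intro sum.cong) (auto simp: C_def)
      also have "\<dots> = of_nat (card Z) * ennreal (unit_ball_vol (real s) * \<epsilon> ^ s)"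
        by (simp only: sum_constant card_lessThan)
      also have "\<dots> = ennreal (card Z * (unit_ball_vol (real s) * \<epsilon> ^ s))"
        using \<epsilon> by (subst ennreal_mult) (auto simp: ennreal_of_nat_eq_real_of_nat)
      also have "\<dots> = ennreal (unit_ball_vol (real s) * (card Z * \<epsilon> ^ s))"
        by (simp only: mult.left_commute)
      also have "\<dots> \<le> ennreal (unit_ball_vol (real s) * M)"
        using sep_card[of Z \<epsilon>] Z \<epsilon> unfolding s_def \<Z>_def by (intro ennreal_leI mult_left_mono) auto
      finally show ?thesis .
    qed
    then have "hausdorff_outer s A \<le> ennreal (unit_ball_vol (real s) * M)"
      unfolding hausdorff_outer_def by (intro SUP_least) blast
    then have "hausdorff_outer s A < top" by (rule le_less_trans) simp
    then show ?thesis by (simp add: s_def)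
qed

section \<open>Local graph charts\<close>

text \<open>Tangent vectors stay in the ambient space, which avoids a second type of dimension one
  less and lets Brouwer's theorem act on a flat disc.\<close>

definition tangent_disc :: "'a::euclidean_space \<Rightarrow> real \<Rightarrow> 'a set" where
  "tangent_disc \<nu> r = {t. \<nu> \<bullet> t = 0 \<and> norm t \<le> r}"

text \<open>The last clause excludes further sheets of \<open>S\<close> near \<open>y\<close>. It
  uses only half of the disc, so that around each parameter it yields the domain extends by a
  further \<open>r / 2\<close>.\<close>

definition graph_chart :: "'a::euclidean_space set \<Rightarrow> 'a \<Rightarrow> 'a \<Rightarrow> real \<Rightarrow> real \<Rightarrow> ('a \<Rightarrow> 'a) \<Rightarrow> bool" where
  "graph_chart S y \<nu> r \<rho> \<phi> \<longleftrightarrow> norm \<nu> = 1 \<and> 0 < r \<and> 0 < \<rho> \<and>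
     (\<forall>t\<in>tangent_disc \<nu> r. \<phi> t \<in> S \<and> (\<exists>s. \<phi> t = y + t + s *\<^sub>R \<nu>)) \<and>
     (\<forall>t\<in>tangent_disc \<nu> r. \<forall>t'\<in>tangent_disc \<nu> r. norm (\<phi> t - \<phi> t') \<le> 2 * norm (t - t')) \<and>
     S \<inter> cball y \<rho> \<subseteq> \<phi> ` tangent_disc \<nu> (r / 2)"

lemma convex_tangent_disc: "convex (tangent_disc \<nu> r)"
proof -
  have "tangent_disc \<nu> r = {t. \<nu> \<bullet> t = 0} \<inter> cball 0 r" by (auto simp: tangent_disc_def)
  then show ?thesis by (simp add: convex_Int convex_hyperplane)
qed

text \<open>A hands-on implicit function theorem: where the gradient of the defining function varies by at
  most a quarter of its size, the zero set satisfies a cone condition around the tangent plane.\<close>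

lemma smooth_closed_hypersurface_chart:
  fixes S :: "'a::euclidean_space set"
  assumes S: "smooth_closed_hypersurface S" and y0: "y0 \<in> S"
  shows "\<exists>\<nu> r \<rho> \<phi>. graph_chart S y0 \<nu> r \<rho> \<phi>"
proof -
  obtain U F where U: "open U" "y0 \<in> U" and sm: "smooth_on U F" and reg: "\<forall>y\<in>U. \<not> GDERIV F y :> 0"
    and SU: "S \<inter> U = {y \<in> U. F y = 0}"
    using S y0 unfolding smooth_closed_hypersurface_def by blast
  have "C_k_on (Suc 0) U F" using sm unfolding smooth_on_def by blast
  then obtain g where g: "\<And>x. x \<in> U \<Longrightarrow> GDERIV F x :> g x" and gc: "\<forall>b\<in>Basis. continuous_on U (\<lambda>x. g x \<bullet> b)"
    by auto
  have gcont: "continuous_on U g" using gc by (subst continuous_on_componentwise) auto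
  define a where "a = norm (g y0)"
  have a: "a > 0" using g[OF U(2)] reg U(2) unfolding a_def by auto
  define \<nu> where "\<nu> = g y0 /\<^sub>R a"
  have \<nu>: "norm \<nu> = 1" "\<nu> \<bullet> \<nu> = 1" "g y0 = a *\<^sub>R \<nu>"
    using a by (auto simp: \<nu>_def a_def dot_square_norm power2_eq_square)
  have "\<exists>d>0. \<forall>x\<in>U. dist x y0 < d \<longrightarrow> dist (g x) (g y0) < a / 4"
    using gcont[unfolded continuous_on_iff, rule_format, OF U(2), of "a / 4"] a by auto
  then obtain d where d: "d > 0" "\<And>x. x \<in> U \<Longrightarrow> dist x y0 < d \<Longrightarrow> dist (g x) (g y0) < a / 4" by blast
  obtain d' where d': "d' > 0" "cball y0 d' \<subseteq> U" using U open_contains_cball by metis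
  define R where "R = min (d / 2) d'"
  have R: "R > 0" "cball y0 R \<subseteq> U" "\<And>x. x \<in> cball y0 R \<Longrightarrow> norm (g x - g y0) \<le> a / 4"
  proof -
    show "R > 0" "cball y0 R \<subseteq> U" using d d' by (auto simp: R_def)
    fix x assume x: "x \<in> cball y0 R"
    then have "x \<in> U" "dist x y0 < d" using d d' by (auto simp: R_def dist_commute)
    then show "norm (g x - g y0) \<le> a / 4" using d(2)[of x] by (simp add: dist_norm)
  qed
  \<comment> \<open>The mean value inequality for \<open>F\<close> minus its linear part at
    \<open>y0\<close>; the gradient of this difference is at most \<open>a / 4\<close>.\<close>
  have mvt: "\<bar>F x - F x' - a * (\<nu> \<bullet> (x - x'))\<bar> \<le> a / 4 * norm (x - x')"
    if "x \<in> cball y0 R" "x' \<in> cball y0 R" for x x'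
  proof -
    have "norm ((F x - g y0 \<bullet> x) - (F x' - g y0 \<bullet> x')) \<le> a / 4 * norm (x - x')"
    proof (rule differentiable_bound[where S="cball y0 R" and f'="\<lambda>x h. h \<bullet> (g x - g y0)"])
      fix z assume z: "z \<in> cball y0 R"
      have "(F has_derivative (\<lambda>h. h \<bullet> g z)) (at z)" using g R(2) z by (auto simp: gderiv_def)
      then show "((\<lambda>x. F x - g y0 \<bullet> x) has_derivative (\<lambda>h. h \<bullet> (g z - g y0))) (at z within cball y0 R)"
        by (auto intro!: derivative_eq_intros intro: has_derivative_at_withinI simp: inner_diff_right inner_commute)
      show "onorm (\<lambda>h. h \<bullet> (g z - g y0)) \<le> a / 4"
      proof (rule onorm_le)
        fix h show "norm (h \<bullet> (g z - g y0)) \<le> a / 4 * norm h"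
          using Cauchy_Schwarz_ineq2[of h "g z - g y0"] mult_left_mono[OF R(3)[OF z], of "norm h"]
          by (simp add: mult.commute)
      qed
    qed (use that in auto)
    moreover have "(F x - g y0 \<bullet> x) - (F x' - g y0 \<bullet> x') = F x - F x' - a * (\<nu> \<bullet> (x - x'))"
      by (simp add: \<nu>(3) inner_diff_right algebra_simps)
    ultimately show ?thesis by simp
  qed
  have F0: "F x = 0" if "x \<in> S" "x \<in> cball y0 R" for x using that SU R(2) by blast
  have cone: "\<bar>\<nu> \<bullet> (x - x')\<bar> \<le> norm (x - x') / 4"
    if "x \<in> S" "x' \<in> S" "x \<in> cball y0 R" "x' \<in> cball y0 R" for x x'
    using mvt[OF that(3,4)] F0 that a by (simp add: abs_mult)
  \<comment> \<open>Offsets \<open>t\<close> and \<open>s\<close> of size at most \<open>r\<close>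
    move a point by at most \<open>2 * r\<close>, which stays inside the ball of radius
    \<open>R\<close>.\<close>
  define r where "r = R / 4"
  have r: "r > 0" using R by (simp add: r_def)
  have "\<exists>x. x \<in> S \<and> x \<in> cball y0 R \<and> (\<exists>s. x = y0 + t + s *\<^sub>R \<nu>)" if t: "t \<in> tangent_disc \<nu> r" for t
  proof -
    have t': "\<nu> \<bullet> t = 0" "norm t \<le> r" using t by (auto simp: tangent_disc_def)
    have inR: "y0 + t + s *\<^sub>R \<nu> \<in> cball y0 R" "norm (t + s *\<^sub>R \<nu>) \<le> 2 * r" if "\<bar>s\<bar> \<le> r" for s
    proof -
      have "norm (t + s *\<^sub>R \<nu>) \<le> norm t + norm (s *\<^sub>R \<nu>)" by (rule norm_triangle_ineq)
      then show "norm (t + s *\<^sub>R \<nu>) \<le> 2 * r" using that t' \<nu> by simp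
      then show "y0 + t + s *\<^sub>R \<nu> \<in> cball y0 R" using R norm_minus_cancel[of "t + s *\<^sub>R \<nu>"] by (simp add: dist_norm r_def)
    qed
    have y0R: "y0 \<in> cball y0 R" using R by simp
    have est: "\<bar>F (y0 + t + s *\<^sub>R \<nu>) - a * s\<bar> \<le> a / 4 * (2 * r)" if "\<bar>s\<bar> \<le> r" for s
    proof -
      have "\<bar>F (y0 + t + s *\<^sub>R \<nu>) - a * s\<bar> \<le> a / 4 * norm (t + s *\<^sub>R \<nu>)"
        using mvt[OF inR(1)[OF that] y0R] F0[OF y0 y0R] t' \<nu> by (simp add: inner_add_right add.assoc)
      also have "\<dots> \<le> a / 4 * (2 * r)" using inR(2)[OF that] a by (intro mult_left_mono) auto
      finally show ?thesis .
    qed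
    \<comment> \<open>This makes \<open>F\<close> change sign between \<open>s = - r\<close> and
      \<open>s = r\<close>.\<close>
    have ar: "a / 4 * (2 * r) < a * r" using a r by simp
    have "\<exists>s\<ge>-r. s \<le> r \<and> F (y0 + t + s *\<^sub>R \<nu>) = 0"
    proof (rule IVT')
      show "F (y0 + t + (- r) *\<^sub>R \<nu>) \<le> 0" using abs_le_D1[OF est[of "-r"]] ar r by simp
      show "0 \<le> F (y0 + t + r *\<^sub>R \<nu>)" using abs_le_D2[OF est[of r]] ar r by simp
      have "continuous_on U F"
        using g by (auto intro!: has_derivative_continuous_on[of U F] simp: gderiv_def intro: has_derivative_at_withinI)
      then show "continuous_on {- r..r} (\<lambda>s. F (y0 + t + s *\<^sub>R \<nu>))"
        by (rule continuous_on_compose2) (use inR R(2) in \<open>auto intro!: continuous_intros simp: abs_le_iff\<close>)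
    qed (use r in auto)
    then obtain s where "-r \<le> s" "s \<le> r" and s0: "F (y0 + t + s *\<^sub>R \<nu>) = 0" by blast
    then have s: "\<bar>s\<bar> \<le> r" "F (y0 + t + s *\<^sub>R \<nu>) = 0" by auto
    then have "y0 + t + s *\<^sub>R \<nu> \<in> S" using inR(1) R(2) SU by blast
    then show ?thesis using inR(1)[OF s(1)] by blast
  qed
  then obtain \<phi> where \<phi>: "\<And>t. t \<in> tangent_disc \<nu> r \<Longrightarrow> \<phi> t \<in> S \<and> \<phi> t \<in> cball y0 R \<and> (\<exists>s. \<phi> t = y0 + t + s *\<^sub>R \<nu>)"
    by metis
  have lip: "norm (\<phi> t - \<phi> t') \<le> 2 * norm (t - t')"
    if t: "t \<in> tangent_disc \<nu> r" "t' \<in> tangent_disc \<nu> r" for t t'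
  proof -
    obtain s s' where s: "\<phi> t = y0 + t + s *\<^sub>R \<nu>" "\<phi> t' = y0 + t' + s' *\<^sub>R \<nu>" using \<phi> t by meson
    then have eq: "\<phi> t - \<phi> t' = (t - t') + (s - s') *\<^sub>R \<nu>" by (simp add: algebra_simps)
    have "\<nu> \<bullet> (\<phi> t - \<phi> t') = s - s'" using t \<nu> unfolding eq by (simp add: tangent_disc_def inner_add_right inner_diff_right)
    \<comment> \<open>The normal increment is at most a quarter of the distance, which gives the
      Lipschitz constant 4/3, below the required 2.\<close>
    then have "\<bar>s - s'\<bar> \<le> norm (\<phi> t - \<phi> t') / 4" using cone[of "\<phi> t" "\<phi> t'"] \<phi> t by simp
    moreover have "norm (\<phi> t - \<phi> t') \<le> norm (t - t') + \<bar>s - s'\<bar>"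
      using norm_triangle_ineq[of "t - t'" "(s - s') *\<^sub>R \<nu>"] \<nu> by (simp add: eq)
    ultimately show ?thesis using norm_ge_zero[of "t - t'"] by argo
  qed
  have img: "S \<inter> cball y0 (r / 2) \<subseteq> \<phi> ` tangent_disc \<nu> (r / 2)"
  proof
    fix x assume x: "x \<in> S \<inter> cball y0 (r / 2)"
    define s where "s = \<nu> \<bullet> (x - y0)"
    define t where "t = (x - y0) - s *\<^sub>R \<nu>"
    have "\<nu> \<bullet> t = 0" using \<nu> by (simp add: t_def s_def inner_diff_right)
    have "(norm (x - y0))\<^sup>2 = (norm t)\<^sup>2 + s\<^sup>2"
    proof -
      have "x - y0 = t + s *\<^sub>R \<nu>" by (simp add: t_def)
      then show ?thesis using \<open>\<nu> \<bullet> t = 0\<close> \<nu>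
        by (simp add: power2_norm_eq_inner inner_add_left inner_add_right inner_commute power2_eq_square[of s])
    qed
    then have "(norm t)\<^sup>2 \<le> (norm (x - y0))\<^sup>2" by (smt (verit) zero_le_power2)
    then have "norm t \<le> norm (x - y0)" by (rule power2_le_imp_le) simp
    then have tr: "norm t \<le> r / 2" using x by (simp add: dist_norm norm_minus_commute)
    then have t2: "t \<in> tangent_disc \<nu> (r / 2)" "t \<in> tangent_disc \<nu> r"
      using \<open>\<nu> \<bullet> t = 0\<close> r by (auto simp: tangent_disc_def)
    obtain s' where s': "\<phi> t = y0 + t + s' *\<^sub>R \<nu>" using \<phi>[OF t2(2)] by blast
    have eq: "x - \<phi> t = (s - s') *\<^sub>R \<nu>" unfolding s' by (simp add: t_def algebra_simps)
    have "x \<in> cball y0 R" using x r by (simp add: r_def)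
    \<comment> \<open>Two points of \<open>S\<close> on one normal line violate the cone condition
      unless they coincide, so there is only one sheet.\<close>
    then have "\<bar>s - s'\<bar> \<le> \<bar>s - s'\<bar> / 4" using cone[of x "\<phi> t"] \<phi>[OF t2(2)] x \<nu> unfolding eq by simp
    then have "x = \<phi> t" using eq by simp
    then show "x \<in> \<phi> ` tangent_disc \<nu> (r / 2)" using t2 by blast
  qed
  have "graph_chart S y0 \<nu> r (r / 2) \<phi>"
    unfolding graph_chart_def using \<nu> r \<phi> lip img by auto
  then show ?thesis by blast
qed

text \<open>Orthogonal projection to the tangent plane undoes \<open>\<phi>\<close> up to a
  translation and does not increase distances.\<close>

lemma graph_chart_proj:
  assumes "graph_chart S y \<nu> r \<rho> \<phi>" "t \<in> tangent_disc \<nu> r" "t' \<in> tangent_disc \<nu> r"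
  shows "norm (t - t') \<le> norm (\<phi> t - \<phi> t')"
proof -
  obtain s s' where s: "\<phi> t = y + t + s *\<^sub>R \<nu>" "\<phi> t' = y + t' + s' *\<^sub>R \<nu>"
    using assms unfolding graph_chart_def by meson
  then have eq: "\<phi> t - \<phi> t' = (t - t') + (s - s') *\<^sub>R \<nu>" by (simp add: algebra_simps)
  have "\<nu> \<bullet> (t - t') = 0" using assms by (simp add: tangent_disc_def inner_diff_right)
  then have "(norm (\<phi> t - \<phi> t'))\<^sup>2 = (norm (t - t'))\<^sup>2 + (s - s')\<^sup>2 * (\<nu> \<bullet> \<nu>)"
    unfolding eq by (simp add: power2_norm_eq_inner inner_add_left inner_add_right inner_commute power2_eq_square[of "s - s'"])
  then have "(norm (t - t'))\<^sup>2 \<le> (norm (\<phi> t - \<phi> t'))\<^sup>2"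
    using mult_nonneg_nonneg[OF zero_le_power2[of "s - s'"] inner_ge_zero[of \<nu>]] by linarith
  then show ?thesis by (rule power2_le_imp_le) simp
qed

text \<open>The point \<open>y\<close> is itself of the form \<open>\<phi> t\<close>, and then
  \<open>t\<close> is both tangential and a multiple of \<open>\<nu>\<close>.\<close>

lemma graph_chart_zero:
  assumes ch: "graph_chart S y \<nu> r \<rho> \<phi>" and "y \<in> S"
  shows "\<phi> 0 = y"
proof -
  have "y \<in> \<phi> ` tangent_disc \<nu> (r / 2)" using assms unfolding graph_chart_def by force
  then obtain t where t: "y = \<phi> t" "t \<in> tangent_disc \<nu> r" using ch by (auto simp: graph_chart_def tangent_disc_def)
  then obtain s where "\<phi> t = y + t + s *\<^sub>R \<nu>" using ch unfolding graph_chart_def by meson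
  then have s: "t = - s *\<^sub>R \<nu>" using t(1) by (simp add: eq_neg_iff_add_eq_0)
  moreover have "\<nu> \<bullet> t = 0" using t by (simp add: tangent_disc_def)
  moreover have "\<nu> \<bullet> \<nu> = 1" using ch by (simp add: graph_chart_def dot_square_norm)
  ultimately have "t = 0" by simp
  then show ?thesis using t by simp
qed

lemma graph_chart_image_small:
  assumes ch: "graph_chart S y \<nu> r \<rho> \<phi>" and x: "x \<in> S" "y \<in> S" "dist y x \<le> \<rho>" "dist y x \<le> \<epsilon>"
  obtains t where "t \<in> tangent_disc \<nu> r" "norm t \<le> \<epsilon>" "norm t \<le> r / 2" "x = \<phi> t"
proof -
  obtain t where t: "t \<in> tangent_disc \<nu> (r / 2)" "x = \<phi> t" using ch x unfolding graph_chart_def by force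
  then have t': "t \<in> tangent_disc \<nu> r" using ch by (auto simp: graph_chart_def tangent_disc_def)
  have "0 \<in> tangent_disc \<nu> r" using ch by (simp add: graph_chart_def tangent_disc_def)
  then have "norm t \<le> norm (x - y)" using graph_chart_proj[OF ch t', of 0] graph_chart_zero[OF ch x(2)] t by simp
  then show ?thesis using that[OF t'] t x by (simp add: tangent_disc_def dist_norm norm_minus_commute)
qed

lemma graph_chart_continuous:
  assumes "graph_chart S y \<nu> r \<rho> \<phi>"
  shows "continuous_on (tangent_disc \<nu> r) \<phi>"
  unfolding continuous_on_iff
proof (intro ballI allI impI)
  fix t e assume t: "t \<in> tangent_disc \<nu> r" and e: "0 < (e::real)"
  show "\<exists>d>0. \<forall>x'\<in>tangent_disc \<nu> r. dist x' t < d \<longrightarrow> dist (\<phi> x') (\<phi> t) < e"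
  proof (intro exI[of _ "e / 2"] conjI ballI impI)
    fix x' assume "x' \<in> tangent_disc \<nu> r" "dist x' t < e / 2"
    moreover then have "norm (\<phi> x' - \<phi> t) \<le> 2 * norm (x' - t)"
      using assms t unfolding graph_chart_def by blast
    ultimately show "dist (\<phi> x') (\<phi> t) < e" by (simp add: dist_norm)
  qed (use e in simp)
qed

text \<open>Images of chords are the connected sets along which the increments in
  \<open>macro_data\<close> are taken.\<close>

lemma graph_chart_segment:
  assumes ch: "graph_chart S y \<nu> r \<rho> \<phi>" and t: "t \<in> tangent_disc \<nu> r" "t' \<in> tangent_disc \<nu> r"
  shows "connected (\<phi> ` closed_segment t t')" "\<phi> ` closed_segment t t' \<subseteq> S"
    "\<phi> ` closed_segment t t' \<subseteq> cball (\<phi> t) (2 * norm (t - t'))"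
proof -
  have sub: "closed_segment t t' \<subseteq> tangent_disc \<nu> r"
    using t by (intro closed_segment_subset convex_tangent_disc)
  show "connected (\<phi> ` closed_segment t t')"
    using sub by (intro connected_continuous_image continuous_on_subset[OF graph_chart_continuous[OF ch]]) auto
  show "\<phi> ` closed_segment t t' \<subseteq> S" using sub ch unfolding graph_chart_def by blast
  show "\<phi> ` closed_segment t t' \<subseteq> cball (\<phi> t) (2 * norm (t - t'))"
  proof
    fix z assume "z \<in> \<phi> ` closed_segment t t'"
    then obtain u where u: "u \<in> closed_segment t t'" "z = \<phi> u" by blast
    then have "norm (\<phi> t - \<phi> u) \<le> 2 * norm (t - u)" using sub t ch unfolding graph_chart_def by blast
    moreover have "norm (t - u) \<le> norm (t - t')" using segment_bound[OF u(1)] by (simp add: norm_minus_commute)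
    ultimately show "z \<in> cball (\<phi> t) (2 * norm (t - t'))" using u by (simp add: dist_norm)
  qed
qed

text \<open>A finite subcover makes a statement that is local in the point and in the scale uniform.
  The same \<open>r\<close> limits the neighbourhood and \<open>h\<close>.\<close>

lemma compact_uniform_scale:
  fixes S :: "'a::metric_space set"
  assumes "compact S" and loc: "\<And>y. y \<in> S \<Longrightarrow> \<exists>r>0. \<forall>z\<in>S \<inter> ball y r. \<forall>h. 0 < h \<and> h \<le> r \<longrightarrow> Q z (h::real)"
  shows "\<exists>h1>0. \<forall>z\<in>S. \<forall>h. 0 < h \<and> h \<le> h1 \<longrightarrow> Q z h"
proof -
  have "\<forall>y. \<exists>r. y \<in> S \<longrightarrow> r > 0 \<and> (\<forall>z\<in>S \<inter> ball y r. \<forall>h. 0 < h \<and> h \<le> r \<longrightarrow> Q z h)"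
    using loc by blast
  from choice[OF this] obtain r where "\<forall>y. y \<in> S \<longrightarrow> r y > 0 \<and> (\<forall>z\<in>S \<inter> ball y (r y). \<forall>h. 0 < h \<and> h \<le> r y \<longrightarrow> Q z h)"
    by blast
  then have r: "\<And>y. y \<in> S \<Longrightarrow> r y > 0" "\<And>y z h. y \<in> S \<Longrightarrow> z \<in> S \<inter> ball y (r y) \<Longrightarrow> 0 < h \<Longrightarrow> h \<le> r y \<Longrightarrow> Q z h"
    by blast+
  have "S \<subseteq> (\<Union>y\<in>S. ball y (r y))" using r by force
  then obtain T where T: "T \<subseteq> S" "finite T" "S \<subseteq> (\<Union>y\<in>T. ball y (r y))"
    by (rule compactE_image[OF \<open>compact S\<close> open_ball])
  define h1 where "h1 = Min (insert 1 (r ` T))"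
  have "h1 > 0" using T r by (auto simp: h1_def)
  moreover have "Q z h" if "z \<in> S" "0 < h" "h \<le> h1" for z h
  proof -
    have "z \<in> (\<Union>y\<in>T. ball y (r y))" using T(3) \<open>z \<in> S\<close> by (rule subsetD)
    then obtain y where y: "y \<in> T" "z \<in> ball y (r y)" by (rule UN_E)
    then have "h1 \<le> r y" using T by (auto simp: h1_def)
    then show ?thesis using r(2)[of y z h] y T that by auto
  qed
  ultimately show ?thesis by blast
qed

text \<open>Nearby points of \<open>S\<close> lie in one chart, so they are also close along
  \<open>S\<close>. Their parameters are at distance at most \<open>2 * h\<close> and
  \<open>\<phi>\<close> at most doubles distances; the resulting \<open>4 * h\<close> is rounded
  up.\<close>

lemma uniformly_locally_connected:
  fixes S :: "'a::euclidean_space set"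
  assumes S: "compact S" and charts: "\<And>y. y \<in> S \<Longrightarrow> \<exists>\<nu> r \<rho> \<phi>. graph_chart S y \<nu> r \<rho> \<phi>"
  shows "\<exists>h1>0. \<forall>y\<in>S. \<forall>h. 0 < h \<and> h \<le> h1 \<longrightarrow>
    (\<forall>y'\<in>S. dist y y' \<le> 2 * h \<longrightarrow> (\<exists>\<Gamma>. \<Gamma> \<subseteq> S \<and> connected \<Gamma> \<and> y \<in> \<Gamma> \<and> y' \<in> \<Gamma> \<and> \<Gamma> \<subseteq> cball y (5 * h)))"
proof (rule compact_uniform_scale[OF S])
  fix y0 assume y0: "y0 \<in> S"
  then obtain \<nu> r \<rho> \<phi> where ch: "graph_chart S y0 \<nu> r \<rho> \<phi>" using charts by blast
  have \<rho>: "\<rho> > 0" using ch by (simp add: graph_chart_def)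
  show "\<exists>r>0. \<forall>y\<in>S \<inter> ball y0 r. \<forall>h. 0 < h \<and> h \<le> r \<longrightarrow>
    (\<forall>y'\<in>S. dist y y' \<le> 2 * h \<longrightarrow> (\<exists>\<Gamma>. \<Gamma> \<subseteq> S \<and> connected \<Gamma> \<and> y \<in> \<Gamma> \<and> y' \<in> \<Gamma> \<and> \<Gamma> \<subseteq> cball y (5 * h)))"
  proof (intro exI[of _ "\<rho> / 4"] conjI ballI allI impI)
    fix y h y' assume y: "y \<in> S \<inter> ball y0 (\<rho> / 4)" and "0 < h \<and> h \<le> \<rho> / 4" and y': "y' \<in> S" "dist y y' \<le> 2 * h"
    then have h: "0 < h" "h \<le> \<rho> / 4" by auto
    have "dist y0 y' \<le> \<rho>" using y h y' dist_triangle[of y0 y' y] by simp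
    then obtain t' where t': "t' \<in> tangent_disc \<nu> r" "y' = \<phi> t'"
      using graph_chart_image_small[OF ch y'(1) y0] by blast
    have "dist y0 y \<le> \<rho>" using y \<rho> by simp
    then obtain t where t: "t \<in> tangent_disc \<nu> r" "y = \<phi> t"
      using graph_chart_image_small[OF ch _ y0, of y] y by blast
    have "norm (t - t') \<le> 2 * h" using graph_chart_proj[OF ch t(1) t'(1)] t t' y' by (simp add: dist_norm)
    then have "\<phi> ` closed_segment t t' \<subseteq> cball y (5 * h)"
      using order_trans[OF graph_chart_segment(3)[OF ch t(1) t'(1)] subset_cball] t h by simp
    then show "\<exists>\<Gamma>. \<Gamma> \<subseteq> S \<and> connected \<Gamma> \<and> y \<in> \<Gamma> \<and> y' \<in> \<Gamma> \<and> \<Gamma> \<subseteq> cball y (5 * h)"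
      using graph_chart_segment(1,2)[OF ch t(1) t'(1)] t t'
      by (intro exI[of _ "\<phi> ` closed_segment t t'"]) (simp add: image_eqI[of _ \<phi> t] image_eqI[of _ \<phi> t'])
  qed (use \<rho> in auto)
qed

section \<open>Discrete Poincare inequality\<close>

lemma norm_add_sq_le: "(norm (x + y :: 'b::real_normed_vector))\<^sup>2 \<le> 2 * (norm x)\<^sup>2 + 2 * (norm y)\<^sup>2"
proof -
  have "(norm (x + y))\<^sup>2 \<le> (norm x + norm y)\<^sup>2" by (intro power_mono norm_triangle_ineq) auto
  also have "\<dots> \<le> 2 * (norm x)\<^sup>2 + 2 * (norm y)\<^sup>2"
    using sum_squares_bound[of "norm x" "norm y"] by (simp add: power2_sum)
  finally show ?thesis .
qed

lemma real_diff_sq_le: "(x - y)\<^sup>2 \<le> 2 * x\<^sup>2 + 2 * (y::real)\<^sup>2"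
  using norm_add_sq_le[of x "- y"] by simp

lemma norm_sq_le_diff: "(norm (x :: 'b::real_normed_vector))\<^sup>2 \<le> 2 * (norm y)\<^sup>2 + 2 * (norm (x - y))\<^sup>2"
  using norm_add_sq_le[of y "x - y"] by simp

text \<open>Telescoping along the path, followed by the Cauchy-Schwarz inequality.\<close>

lemma path_increment_sq:
  fixes u :: "nat \<Rightarrow> 'b::real_normed_vector" and e :: "nat \<Rightarrow> real"
  assumes e: "\<And>i. Suc i < n \<Longrightarrow> norm (u (Suc i) - u i) \<le> e i" and ij: "i < n" "j < n"
  shows "(norm (u i - u j))\<^sup>2 \<le> n * (\<Sum>k<n. (e k)\<^sup>2)"
proof -
  have *: "norm (u j - u i) \<le> (\<Sum>k<n. \<bar>e k\<bar>)" if "i \<le> j" "j < n" for i j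
  proof -
    have "u j - u i = (\<Sum>k=i..<j. u (Suc k) - u k)" using that by (simp add: sum_Suc_diff')
    then have "norm (u j - u i) \<le> (\<Sum>k=i..<j. norm (u (Suc k) - u k))" by (simp add: norm_sum)
    also have "\<dots> \<le> (\<Sum>k=i..<j. \<bar>e k\<bar>)" proof (intro sum_mono)
      fix k assume "k \<in> {i..<j}"
      then have "Suc k < n" using that by simp
      then show "norm (u (Suc k) - u k) \<le> \<bar>e k\<bar>" using e[of k] abs_ge_self[of "e k"] by linarith
    qed
    also have "\<dots> \<le> (\<Sum>k<n. \<bar>e k\<bar>)" using that by (intro sum_mono2) auto
    finally show ?thesis .
  qed
  have "norm (u i - u j) \<le> (\<Sum>k<n. \<bar>e k\<bar>)"
    using *[of i j] *[of j i] ij by (cases "i \<le> j") (auto simp: norm_minus_commute)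
  then have "(norm (u i - u j))\<^sup>2 \<le> (\<Sum>k<n. \<bar>e k\<bar>)\<^sup>2" by (intro power_mono) auto
  also have "\<dots> \<le> card {..<n} * (\<Sum>k<n. \<bar>e k\<bar>\<^sup>2)" using sum_squared_le_sum_of_squares[of "\<lambda>k. \<bar>e k\<bar>" "{..<n}"]
    by (simp add: mult.commute)
  finally show ?thesis by simp
qed

lemma sum_PiE_insert:
  fixes F :: "('c \<Rightarrow> nat) \<Rightarrow> real"
  assumes "finite B" "b \<notin> B"
  shows "(\<Sum>f\<in>PiE (insert b B) (\<lambda>_. {..<n::nat}). F f) = (\<Sum>i<n. \<Sum>f\<in>PiE B (\<lambda>_. {..<n}). F (f(b := i)))"
proof -
  have "(\<Sum>f\<in>PiE (insert b B) (\<lambda>_. {..<n}). F f)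
      = (\<Sum>(i, f)\<in>{..<n} \<times> PiE B (\<lambda>_. {..<n}). F (f(b := i)))"
    unfolding PiE_insert_eq
    by (subst sum.reindex[OF inj_combinator[OF assms(2)]]) (simp add: o_def split_beta)
  then show ?thesis by (simp add: sum.cartesian_product)
qed

text \<open>The induction changes one coordinate at a time, so the constant stays of order \<open>n\<^sup>2\<close> in every
  dimension.\<close>

lemma grid_poincare:
  fixes u :: "('c \<Rightarrow> nat) \<Rightarrow> 'b::real_normed_vector" and e :: "('c \<Rightarrow> nat) \<Rightarrow> real"
  assumes B: "finite B"
    and e: "\<And>f b. f \<in> PiE B (\<lambda>_. {..<n}) \<Longrightarrow> b \<in> B \<Longrightarrow> Suc (f b) < n \<Longrightarrow> norm (u (f(b := Suc (f b))) - u f) \<le> e f"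
  shows "(\<Sum>f\<in>PiE B (\<lambda>_. {..<n}). \<Sum>g\<in>PiE B (\<lambda>_. {..<n}). (norm (u f - u g))\<^sup>2)
    \<le> 4 ^ card B * real n ^ (card B + 2) * (\<Sum>f\<in>PiE B (\<lambda>_. {..<n}). (e f)\<^sup>2)"
  using assms
proof (induction B arbitrary: u e rule: finite_induct)
  case empty
  then show ?case by simp
next
  case (insert b B)
  let ?G = "PiE B (\<lambda>_. {..<n})"
  let ?E = "\<Sum>i<n. \<Sum>f\<in>?G. (e (f(b := i)))\<^sup>2"
  have fG: "finite ?G" using insert by (intro finite_PiE) auto
  have cG: "real (card ?G) = real n ^ card B" using insert by (simp add: card_PiE)
  have mem: "f(b := i) \<in> PiE (insert b B) (\<lambda>_. {..<n})" if "f \<in> ?G" "i < n" for f i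
    using that by (auto simp: PiE_iff extensional_def)
  have line: "(norm (u (f(b := i)) - u (f(b := j))))\<^sup>2 \<le> n * (\<Sum>k<n. (e (f(b := k)))\<^sup>2)"
    if "f \<in> ?G" "i < n" "j < n" for f i j
  proof (rule path_increment_sq)
    fix k assume "Suc k < n"
    then show "norm (u (f(b := Suc k)) - u (f(b := k))) \<le> e (f(b := k))"
      using insert.prems[of "f(b := k)" b] mem[of f k] that by (simp del: fun_upd_apply add: fun_upd_same)
  qed (use that in auto)
  have IH: "(\<Sum>f\<in>?G. \<Sum>g\<in>?G. (norm (u (f(b := j)) - u (g(b := j))))\<^sup>2)
      \<le> 4 ^ card B * real n ^ (card B + 2) * (\<Sum>f\<in>?G. (e (f(b := j)))\<^sup>2)" if "j < n" for j
  proof (rule insert.IH[where u="\<lambda>f. u (f(b := j))" and e="\<lambda>f. e (f(b := j))"])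
    fix f b' assume f: "f \<in> ?G" "b' \<in> B" "Suc (f b') < n"
    then have "b' \<noteq> b" using insert by auto
    then show "norm (u ((f(b' := Suc (f b')))(b := j)) - u (f(b := j))) \<le> e (f(b := j))"
      using insert.prems[of "f(b := j)" b'] mem[of f j] f that
      by (simp del: fun_upd_apply add: fun_upd_other fun_upd_twist)
  qed
  have "(\<Sum>f\<in>PiE (insert b B) (\<lambda>_. {..<n}). \<Sum>g\<in>PiE (insert b B) (\<lambda>_. {..<n}). (norm (u f - u g))\<^sup>2)
      = (\<Sum>i<n. \<Sum>f\<in>?G. \<Sum>j<n. \<Sum>g\<in>?G. (norm (u (f(b := i)) - u (g(b := j))))\<^sup>2)"
    using insert by (simp add: sum_PiE_insert)
  also have "\<dots> \<le> (\<Sum>i<n. \<Sum>f\<in>?G. \<Sum>j<n. \<Sum>g\<in>?G.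
      2 * (n * (\<Sum>k<n. (e (f(b := k)))\<^sup>2)) + 2 * (norm (u (f(b := j)) - u (g(b := j))))\<^sup>2)"
  proof (intro sum_mono)
    fix i f j g assume *: "i \<in> {..<n}" "f \<in> ?G" "j \<in> {..<n}" "g \<in> ?G"
    \<comment> \<open>The route between the two points changes coordinate \<open>b\<close> first and
      then, inside the slice \<open>j\<close>, the remaining ones.\<close>
    have "(norm (u (f(b := i)) - u (g(b := j))))\<^sup>2 \<le>
        2 * (norm (u (f(b := i)) - u (f(b := j))))\<^sup>2 + 2 * (norm (u (f(b := j)) - u (g(b := j))))\<^sup>2"
      using norm_add_sq_le[of "u (f(b := i)) - u (f(b := j))" "u (f(b := j)) - u (g(b := j))"] by simp
    then show "(norm (u (f(b := i)) - u (g(b := j))))\<^sup>2 \<le>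
        2 * (n * (\<Sum>k<n. (e (f(b := k)))\<^sup>2)) + 2 * (norm (u (f(b := j)) - u (g(b := j))))\<^sup>2"
      using line[of f i j] * by simp
  qed
  also have "\<dots> = 2 * real n ^ (card B + 3) * ?E
      + 2 * real n * (\<Sum>j<n. \<Sum>f\<in>?G. \<Sum>g\<in>?G. (norm (u (f(b := j)) - u (g(b := j))))\<^sup>2)"
  proof -
    have sw: "(\<Sum>f\<in>?G. \<Sum>j<n. \<Sum>g\<in>?G. (norm (u (f(b := j)) - u (g(b := j))))\<^sup>2)
      = (\<Sum>j<n. \<Sum>f\<in>?G. \<Sum>g\<in>?G. (norm (u (f(b := j)) - u (g(b := j))))\<^sup>2)" by (rule sum.swap)
    have sw2: "(\<Sum>f\<in>?G. \<Sum>k<n. (e (f(b := k)))\<^sup>2) = ?E" by (rule sum.swap)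
    show ?thesis
      by (simp add: sum.distrib sum_distrib_left[symmetric] sw sw2 cG algebra_simps power_add power3_eq_cube)
  qed
  also have "\<dots> \<le> 2 * real n ^ (card B + 3) * ?E
      + 2 * real n * (\<Sum>j<n. 4 ^ card B * real n ^ (card B + 2) * (\<Sum>f\<in>?G. (e (f(b := j)))\<^sup>2))"
    using IH by (intro add_left_mono mult_left_mono sum_mono) auto
  also have "\<dots> = (2 + 2 * 4 ^ card B) * (real n ^ (card B + 3) * ?E)"
    by (simp add: sum_distrib_left[symmetric] algebra_simps power_add power3_eq_cube power2_eq_square)
  also have "\<dots> \<le> 4 ^ Suc (card B) * (real n ^ (card B + 3) * ?E)"
  proof (rule mult_right_mono)
    have "(1::real) \<le> 4 ^ card B" by simp
    then show "2 + 2 * 4 ^ card B \<le> (4::real) ^ Suc (card B)" by simp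
  qed (auto intro!: mult_nonneg_nonneg sum_nonneg)
  also have "\<dots> = 4 ^ card (insert b B) * real n ^ (card (insert b B) + 2)
      * (\<Sum>f\<in>PiE (insert b B) (\<lambda>_. {..<n}). (e f)\<^sup>2)"
    using insert by (simp add: sum_PiE_insert eval_nat_numeral)
  finally show ?case .
qed

lemma ex_le_average:
  fixes F :: "'c \<Rightarrow> real" and M :: real
  assumes "finite G" "G \<noteq> {}" "(\<Sum>g\<in>G. F g) \<le> card G * M"
  shows "\<exists>g\<in>G. F g \<le> M"
proof (rule ccontr)
  assume "\<not> ?thesis"
  then have "(\<Sum>g\<in>G. M) < (\<Sum>g\<in>G. F g)" using assms by (intro sum_strict_mono) auto
  then show False using assms by simp
qed

text \<open>Averaging the double sum over its second index yields one grid point whose value can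
  replace the mean of \<open>u\<close>; division by the number of grid points leaves only the square
  of \<open>n\<close>.\<close>

lemma grid_poincare_center:
  fixes u :: "('c \<Rightarrow> nat) \<Rightarrow> 'b::real_normed_vector" and e :: "('c \<Rightarrow> nat) \<Rightarrow> real"
  assumes B: "finite B" and n: "n > 0"
    and e: "\<And>f b. f \<in> PiE B (\<lambda>_. {..<n}) \<Longrightarrow> b \<in> B \<Longrightarrow> Suc (f b) < n \<Longrightarrow> norm (u (f(b := Suc (f b))) - u f) \<le> e f"
  shows "\<exists>g\<in>PiE B (\<lambda>_. {..<n}). (\<Sum>f\<in>PiE B (\<lambda>_. {..<n}). (norm (u f - u g))\<^sup>2)
    \<le> 4 ^ card B * real n ^ 2 * (\<Sum>f\<in>PiE B (\<lambda>_. {..<n}). (e f)\<^sup>2)"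
proof (rule ex_le_average)
  let ?G = "PiE B (\<lambda>_. {..<n})"
  show "finite ?G" using B by (intro finite_PiE) auto
  show "?G \<noteq> {}" using n by (auto simp: PiE_eq_empty_iff)
  have "(\<Sum>g\<in>?G. \<Sum>f\<in>?G. (norm (u f - u g))\<^sup>2) \<le> 4 ^ card B * real n ^ (card B + 2) * (\<Sum>f\<in>?G. (e f)\<^sup>2)"
    using grid_poincare[OF B e] by (subst sum.swap) blast
  also have "\<dots> = card ?G * (4 ^ card B * real n ^ 2 * (\<Sum>f\<in>?G. (e f)\<^sup>2))"
    using B by (simp add: card_PiE power_add power2_eq_square)
  finally show "(\<Sum>g\<in>?G. \<Sum>f\<in>?G. (norm (u f - u g))\<^sup>2) \<le> card ?G * (4 ^ card B * real n ^ 2 * (\<Sum>f\<in>?G. (e f)\<^sup>2))" .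
qed

text \<open>Every value is compared with all values on \<open>Q\<close> and the result is averaged.
  As \<open>Q\<close> contains a fixed fraction \<kappa> of the grid, \<open>n\<close> enters only
  through the Poincare factor.\<close>

lemma grid_spread:
  fixes u :: "('c \<Rightarrow> nat) \<Rightarrow> 'b::real_normed_vector" and e :: "('c \<Rightarrow> nat) \<Rightarrow> real"
  assumes B: "finite B" and n: "n > 0"
    and e: "\<And>f b. f \<in> PiE B (\<lambda>_. {..<n}) \<Longrightarrow> b \<in> B \<Longrightarrow> Suc (f b) < n \<Longrightarrow> norm (u (f(b := Suc (f b))) - u f) \<le> e f"
    and Q: "Q \<subseteq> PiE B (\<lambda>_. {..<n})" and \<kappa>: "\<kappa> > 0" "\<kappa> * real n ^ card B \<le> card Q"
  shows "(\<Sum>f\<in>PiE B (\<lambda>_. {..<n}). (norm (u f))\<^sup>2) \<le> 2 / \<kappa> * (\<Sum>f\<in>Q. (norm (u f))\<^sup>2)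
    + 2 / \<kappa> * 4 ^ card B * real n ^ 2 * (\<Sum>f\<in>PiE B (\<lambda>_. {..<n}). (e f)\<^sup>2)"
proof -
  let ?G = "PiE B (\<lambda>_. {..<n})"
  have fG: "finite ?G" using B by (intro finite_PiE) auto
  have cG: "real (card ?G) = real n ^ card B" using B by (simp add: card_PiE)
  let ?T = "\<Sum>f\<in>?G. (norm (u f))\<^sup>2" let ?SQ = "\<Sum>f\<in>Q. (norm (u f))\<^sup>2" let ?E = "\<Sum>f\<in>?G. (e f)\<^sup>2"
  have "card Q * ?T = (\<Sum>g\<in>Q. \<Sum>f\<in>?G. (norm (u f))\<^sup>2)" by simp
  also have "\<dots> \<le> (\<Sum>g\<in>Q. \<Sum>f\<in>?G. 2 * (norm (u g))\<^sup>2 + 2 * (norm (u f - u g))\<^sup>2)"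
    by (intro sum_mono norm_sq_le_diff)
  also have "\<dots> = 2 * real n ^ card B * ?SQ + 2 * (\<Sum>g\<in>Q. \<Sum>f\<in>?G. (norm (u f - u g))\<^sup>2)"
    by (simp add: sum.distrib sum_distrib_left[symmetric] cG algebra_simps)
  also have "(\<Sum>g\<in>Q. \<Sum>f\<in>?G. (norm (u f - u g))\<^sup>2) \<le> (\<Sum>g\<in>?G. \<Sum>f\<in>?G. (norm (u f - u g))\<^sup>2)"
    using fG Q by (intro sum_mono2 sum_nonneg) auto
  also have "\<dots> \<le> 4 ^ card B * real n ^ (card B + 2) * ?E"
    using grid_poincare[OF B e] by (subst sum.swap) blast
  finally have "card Q * ?T \<le> real n ^ card B * (2 * ?SQ + 2 * 4 ^ card B * real n ^ 2 * ?E)"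
    by (simp add: power_add power2_eq_square algebra_simps)
  moreover have "\<kappa> * real n ^ card B * ?T \<le> card Q * ?T" using \<kappa> by (intro mult_right_mono sum_nonneg) auto
  ultimately have "real n ^ card B * (\<kappa> * ?T) \<le> real n ^ card B * (2 * ?SQ + 2 * 4 ^ card B * real n ^ 2 * ?E)"
    by (simp add: algebra_simps)
  then have "\<kappa> * ?T \<le> 2 * ?SQ + 2 * 4 ^ card B * real n ^ 2 * ?E" using n by (simp add: mult_le_cancel_left_pos)
  then have "?T \<le> (2 * ?SQ + 2 * 4 ^ card B * real n ^ 2 * ?E) / \<kappa>" using \<kappa> by (simp add: pos_le_divide_eq mult.commute)
  then show ?thesis by (simp add: add_divide_distrib algebra_simps)
qed

section \<open>Grids in the tangent plane\<close>

text \<open>Bounded multiplicity at scale \<open>h\<close> replaces the notion of a net. It passes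
  to subsets of finite sets, and the radius \<open>10 * h\<close> exceeds the reach of the local
  energies, so that a sum of them counts nothing more than \<open>m\<close> times.\<close>

definition overlap_le :: "real \<Rightarrow> nat \<Rightarrow> 'a::metric_space set \<Rightarrow> bool" where
  "overlap_le h m Y \<longleftrightarrow> (\<forall>z. card (Y \<inter> cball z (10 * h)) \<le> m)"

text \<open>The part of the problem that does not mention the mesh: \<open>X\<close> maps a point of \<open>S\<close> to the discrete
  surface, \<open>W\<close> and \<open>val\<close> are the gradient and the value of the finite element function there, \<open>e\<close> is
  the local energy and \<open>E\<close> the total energy.\<close>

definition macro_data :: "'a::euclidean_space set \<Rightarrow> real \<Rightarrow> real \<Rightarrow> real \<Rightarrow>
    ('a \<Rightarrow> 'a) \<Rightarrow> ('a \<Rightarrow> 'a) \<Rightarrow> ('a \<Rightarrow> real) \<Rightarrow> ('a \<Rightarrow> real) \<Rightarrow> real \<Rightarrow> bool" where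
  "macro_data S C c h X W val e E \<longleftrightarrow> 0 \<le> E \<and>
    (\<forall>y\<in>S. norm (X y - y) \<le> c * h\<^sup>2) \<and>
    (\<forall>\<Gamma> y y'. \<Gamma> \<subseteq> S \<longrightarrow> connected \<Gamma> \<longrightarrow> y \<in> \<Gamma> \<longrightarrow> y' \<in> \<Gamma> \<longrightarrow> \<Gamma> \<subseteq> cball y (5 * h) \<longrightarrow>
        norm (W y' - W y) \<le> C * e y \<and> \<bar>val y' - val y - W y \<bullet> (X y' - X y)\<bar> \<le> C * h * e y) \<and>
    (\<forall>y\<in>S. (val y)\<^sup>2 \<le> C * ((e y)\<^sup>2 + h\<^sup>2 * (norm (W y))\<^sup>2)) \<and>
    (\<forall>Y m. finite Y \<longrightarrow> Y \<subseteq> S \<longrightarrow> overlap_le h m Y \<longrightarrow> (\<Sum>y\<in>Y. (e y)\<^sup>2) \<le> real m * C * E)"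

lemma macro_data_sum:
  assumes "macro_data S C c h X W val e E" "finite Y" "Y \<subseteq> S" "overlap_le h m Y"
  shows "(\<Sum>y\<in>Y. (e y)\<^sup>2) \<le> real m * C * E"
  by (rule assms(1)[unfolded macro_data_def, THEN conjunct2, THEN conjunct2, THEN conjunct2, THEN conjunct2, rule_format, OF assms(2-4)])

text \<open>The radius and both constants are chosen before \<open>h\<close>, the data and the
  points \<open>Y\<close>; this order makes them independent of the mesh, the cut and the finite
  element function.\<close>

definition good_point :: "'a::euclidean_space set \<Rightarrow> real \<Rightarrow> real \<Rightarrow> 'a \<Rightarrow> bool" where
  "good_point S C c y \<longleftrightarrow> (\<exists>r>0. \<exists>K. \<exists>h1>0. \<forall>h X W val e E Y m.
     0 < h \<longrightarrow> h \<le> h1 \<longrightarrow> macro_data S C c h X W val e E \<longrightarrow> finite Y \<longrightarrow> Y \<subseteq> S \<inter> ball y r \<longrightarrow>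
     overlap_le h m Y \<longrightarrow> h\<^sup>2 * (\<Sum>y\<in>Y. (norm (W y))\<^sup>2) \<le> real m * K * E)"

text \<open>Compactness of the unit sphere leaves finitely many vectors of \<open>V\<close> to
  consider and makes the lower bound uniform in the direction of \<open>g\<close>.\<close>

lemma nonflat_quantitative:
  fixes V :: "'a::euclidean_space set"
  assumes nf: "\<And>m. m \<noteq> 0 \<Longrightarrow> \<exists>v\<in>V. m \<bullet> v \<noteq> 0"
  shows "\<exists>J c0. J \<subseteq> V \<and> finite J \<and> 0 < c0 \<and> (\<forall>g. \<exists>v\<in>J. c0 * norm g \<le> \<bar>g \<bullet> v\<bar>)"
proof -
  let ?O = "\<lambda>(v :: 'a, j :: nat). {g :: 'a. 1 / Suc j < \<bar>g \<bullet> v\<bar>}"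
  have op: "open (?O p)" for p
    by (cases p) (auto intro!: open_Collect_less continuous_intros)
  have "sphere 0 1 \<subseteq> (\<Union>p\<in>V \<times> UNIV. ?O p)"
  proof
    fix m :: 'a assume "m \<in> sphere 0 1"
    then have "m \<noteq> 0" by auto
    then obtain v where v: "v \<in> V" "m \<bullet> v \<noteq> 0" using nf by blast
    then obtain j where "inverse (real (Suc j)) < \<bar>m \<bullet> v\<bar>" using reals_Archimedean[of "\<bar>m \<bullet> v\<bar>"] by auto
    then have "m \<in> ?O (v, j)" by (simp add: inverse_eq_divide)
    then show "m \<in> (\<Union>p\<in>V \<times> UNIV. ?O p)" using v by blast
  qed
  then obtain T where T: "T \<subseteq> V \<times> UNIV" "finite T" "sphere 0 1 \<subseteq> (\<Union>p\<in>T. ?O p)"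
    by (rule compactE_image[OF compact_sphere op])
  obtain b :: 'a where b: "b \<in> Basis" using nonempty_Basis by blast
  then have "b \<in> sphere 0 1" by simp
  then have Tne: "T \<noteq> {}" using T by blast
  define c0 where "c0 = Min ((\<lambda>(v, j). 1 / real (Suc j)) ` T)"
  have c0: "0 < c0" using T Tne by (auto simp: c0_def)
  have c0le: "c0 \<le> 1 / real (Suc j)" if "(v, j) \<in> T" for v j
    unfolding c0_def using T that by (intro Min_le) force+
  have "\<exists>v\<in>fst ` T. c0 * norm g \<le> \<bar>g \<bullet> v\<bar>" for g
  proof (cases "g = 0")
    case True then show ?thesis using Tne by auto
  next
    case False
    then have "sgn g \<in> sphere 0 1" by (simp add: norm_sgn)
    then have "sgn g \<in> (\<Union>p\<in>T. ?O p)" using T(3) by (rule subsetD[rotated])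
    then obtain p where p: "p \<in> T" "sgn g \<in> ?O p" by (rule UN_E)
    obtain v j where vj: "p = (v, j)" by (cases p)
    have "c0 \<le> \<bar>sgn g \<bullet> v\<bar>" using c0le[of v j] p vj by auto
    also have "\<bar>sgn g \<bullet> v\<bar> = \<bar>g \<bullet> v\<bar> / norm g" by (simp add: sgn_div_norm abs_mult divide_inverse mult.commute)
    finally have "c0 * norm g \<le> \<bar>g \<bullet> v\<bar>" using False by (simp add: pos_le_divide_eq)
    then show ?thesis using p vj by force
  qed
  then show ?thesis using T c0 by (intro exI[of _ "fst ` T"] exI[of _ c0]) auto
qed

text \<open>Here \<open>x\<close> is a tangential coordinate in units of the grid step,
  \<open>R\<close> is \<open>r / h\<close>, \<open>n\<close> its integer part and \<open>w\<close> a
  margin: around a point in the inner half of the grid, the indices within \<open>w\<close> stay in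
  range.\<close>

lemma grid_index_bound:
  fixes x R w :: real and n :: nat
  assumes "\<bar>x\<bar> \<le> R / 2" "R - 1 < n" "4 \<le> R - 2 * w" "0 \<le> w"
  shows "0 \<le> x + n - w \<and> x + n + w < real (2 * n)"
proof -
  have "- (R / 2) \<le> x" "x \<le> R / 2" using assms(1) by (simp_all add: abs_le_iff)
  then show ?thesis using assms(2-4) by (intro conjI) (simp_all add: field_simps)
qed

section \<open>A cubical grid over one chart\<close>

locale chart_grid =
  fixes S :: "'a::euclidean_space set" and y0 \<nu> :: 'a and r \<rho> :: real and \<phi> :: "'a \<Rightarrow> 'a" and B :: "'a set"
    and D :: real
  assumes ch: "graph_chart S y0 \<nu> r \<rho> \<phi>" and y0: "y0 \<in> S"
    and B_fin: "finite B" and B_card: "card B \<le> DIM('a)"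
    and B_norm: "\<And>b. b \<in> B \<Longrightarrow> norm b = 1" and B_orth: "pairwise orthogonal B"
    and B_span: "span B = {t. \<nu> \<bullet> t = 0}"
    and D_eq: "D = real DIM('a)"
begin

definition N :: "real \<Rightarrow> nat" where "N h = nat \<lfloor>r / h\<rfloor>"
text \<open>Indices are natural numbers, so \<open>N h\<close> shifts the centre of the grid to the
  parameter 0. With the step \<open>h / D\<close>, errors of at most one step in every coordinate
  add up to at most \<open>h\<close>.\<close>

definition pt :: "real \<Rightarrow> ('a \<Rightarrow> nat) \<Rightarrow> 'a" where
  "pt h f = (\<Sum>b\<in>B. ((real (f b) - N h) * (h / D)) *\<^sub>R b)"
definition P :: "real \<Rightarrow> ('a \<Rightarrow> nat) \<Rightarrow> 'a" where "P h f = \<phi> (pt h f)"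
definition G :: "real \<Rightarrow> ('a \<Rightarrow> nat) set" where "G h = PiE B (\<lambda>_. {..<2 * N h})"
text \<open>Two grid points in one ball of radius \<open>10 * h\<close> have indices that differ by
  at most \<open>20 * DIM('a)\<close> in each coordinate.\<close>

definition M0 :: nat where "M0 = (40 * DIM('a) + 1) ^ card B"
text \<open>Within this distance of \<open>y0\<close> the parameters lie in the inner half of the
  grid, which leaves room for clusters around them.\<close>

definition r1 :: real where "r1 = min \<rho> (r / (2 * D))"

lemma D_pos: "D \<ge> 1" by (simp add: D_eq Suc_le_eq)

lemma D_simps [simp]: "\<bar>D\<bar> = D" "D > 0" "D \<noteq> 0" "D \<ge> 0"
  using D_pos by auto

lemma r_pos: "r > 0" and r1_pos: "r1 > 0"
  using ch D_pos by (auto simp: graph_chart_def r1_def)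

lemma N_bounds: "0 < h \<Longrightarrow> r / h - 1 < N h" "0 < h \<Longrightarrow> N h \<le> r / h"
  using r_pos by (auto simp: N_def)

lemma finite_G: "finite (G h)" unfolding G_def using B_fin by (intro finite_PiE) auto

lemma B_tan: "b \<in> B \<Longrightarrow> \<nu> \<bullet> b = 0"
  using span_base[of b B] B_span by auto

lemma inner_sum_B: "b \<in> B \<Longrightarrow> (\<Sum>b'\<in>B. k b' *\<^sub>R b') \<bullet> b = k b"
proof -
  assume b: "b \<in> B"
  have "(\<Sum>b'\<in>B. k b' *\<^sub>R b') \<bullet> b = (\<Sum>b'\<in>B. if b' = b then k b else 0)"
    unfolding inner_sum_left
  proof (intro sum.cong refl)
    fix b' assume "b' \<in> B"
    then show "(k b' *\<^sub>R b') \<bullet> b = (if b' = b then k b else 0)"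
      using B_orth b B_norm[of b] by (auto simp: pairwise_def orthogonal_def dot_square_norm)
  qed
  also have "\<dots> = k b" using B_fin b by simp
  finally show ?thesis .
qed

lemma inner_pt: "b \<in> B \<Longrightarrow> pt h f \<bullet> b = (real (f b) - N h) * (h / D)"
  unfolding pt_def by (rule inner_sum_B)

lemma expand: "\<nu> \<bullet> t = 0 \<Longrightarrow> t = (\<Sum>b\<in>B. (t \<bullet> b) *\<^sub>R b)"
  using orthonormal_basis_expand[OF B_orth B_norm _ B_fin, of t] B_span by auto

lemma norm_le_coords:
  assumes "\<nu> \<bullet> t = 0" "\<And>b. b \<in> B \<Longrightarrow> \<bar>t \<bullet> b\<bar> \<le> k" "k \<ge> 0"
  shows "norm t \<le> D * k"
proof -
  have "norm t = norm (\<Sum>b\<in>B. (t \<bullet> b) *\<^sub>R b)" using expand[OF assms(1)] by simp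
  also have "\<dots> \<le> (\<Sum>b\<in>B. norm ((t \<bullet> b) *\<^sub>R b))" by (rule norm_sum)
  also have "\<dots> \<le> (\<Sum>b\<in>B. k)" using assms B_norm by (intro sum_mono) simp
  also have "\<dots> \<le> D * k" using B_card assms by (simp add: D_eq mult_right_mono)
  finally show ?thesis .
qed

lemma pt_tan: "\<nu> \<bullet> pt h f = 0"
  unfolding pt_def by (simp add: inner_sum_right B_tan)

lemma pt_mem:
  assumes h: "h > 0" and f: "f \<in> G h"
  shows "pt h f \<in> tangent_disc \<nu> r"
proof -
  have "norm (pt h f) \<le> D * (N h * (h / D))"
  proof (rule norm_le_coords[OF pt_tan])
    fix b assume b: "b \<in> B"
    then have "f b < 2 * N h" using f by (auto simp: G_def)
    then have "\<bar>real (f b) - N h\<bar> \<le> N h" by linarith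
    then show "\<bar>pt h f \<bullet> b\<bar> \<le> N h * (h / D)"
      using h by (simp add: inner_pt[OF b] abs_mult divide_right_mono mult_right_mono)
  qed (use h in auto)
  also have "\<dots> = N h * h" by simp
  also have "\<dots> \<le> r" using N_bounds(2)[OF h] h by (simp add: pos_le_divide_eq)
  finally show ?thesis by (simp add: tangent_disc_def pt_tan)
qed

lemma P_in_S: "h > 0 \<Longrightarrow> f \<in> G h \<Longrightarrow> P h f \<in> S"
  using ch pt_mem unfolding P_def graph_chart_def by blast

lemma pt_step: "b \<in> B \<Longrightarrow> pt h (f(b := Suc (f b))) - pt h f = (h / D) *\<^sub>R b"
proof -
  assume b: "b \<in> B"
  have "pt h (f(b := Suc (f b))) - pt h f = (\<Sum>b'\<in>B. (if b' = b then (h / D) *\<^sub>R b else 0))"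
    unfolding pt_def sum_subtractf[symmetric] scaleR_diff_left[symmetric] left_diff_distrib[symmetric]
    by (intro sum.cong refl) simp
  also have "\<dots> = (h / D) *\<^sub>R b" using b B_fin by simp
  finally show ?thesis .
qed

lemma P_dist_le:
  assumes h: "h > 0" and f: "f \<in> G h" and t: "t \<in> tangent_disc \<nu> r"
  shows "norm (\<phi> t - P h f) \<le> 2 * norm (t - pt h f)"
  using ch t pt_mem[OF h f] unfolding P_def graph_chart_def by blast

lemma near_grid_point:
  assumes h: "h > 0" "h \<le> r / 4" and t: "\<nu> \<bullet> t = 0" "norm t \<le> r / (2 * D)"
  shows "\<exists>f\<in>G h. norm (t - pt h f) \<le> h"
proof -
  define a where "a b = (t \<bullet> b) / (h / D) + N h" for b
  define f where "f = (\<lambda>b\<in>B. nat \<lfloor>a b\<rfloor>)"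
  have r4: "r / h \<ge> 4" using h by (simp add: field_simps)
  have a: "0 \<le> a b" "a b < 2 * N h" if b: "b \<in> B" for b
  proof -
    have "\<bar>t \<bullet> b\<bar> \<le> norm t" using Cauchy_Schwarz_ineq2[of t b] B_norm[OF b] by simp
    then have "\<bar>t \<bullet> b\<bar> \<le> r / (2 * D)" using t by linarith
    then have "\<bar>t \<bullet> b\<bar> / (h / D) \<le> r / (2 * D) / (h / D)" using h D_pos by (intro divide_right_mono) auto
    also have "\<dots> = (r / h) / 2" using D_pos by simp
    finally have "\<bar>(t \<bullet> b) / (h / D)\<bar> \<le> (r / h) / 2" using h by (simp add: abs_mult)
    then have "0 \<le> a b \<and> a b < 2 * N h" using N_bounds(1)[OF h(1)] r4 unfolding a_def
      using grid_index_bound[of "(t \<bullet> b) / (h / D)" "r / h" "N h" 0] by simp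
    then show "0 \<le> a b" "a b < 2 * N h" by auto
  qed
  have fG: "f \<in> G h"
  proof -
    have "nat \<lfloor>a b\<rfloor> < 2 * N h" if "b \<in> B" for b using a[OF that] by linarith
    then show ?thesis by (auto simp: G_def f_def)
  qed
  have "norm (t - pt h f) \<le> D * (h / D)"
  proof (rule norm_le_coords)
    show "\<nu> \<bullet> (t - pt h f) = 0" using t pt_tan by (simp add: inner_diff_right)
    fix b assume b: "b \<in> B"
    have "real (f b) = of_int \<lfloor>a b\<rfloor>" using a(1)[OF b] b by (simp add: f_def)
    then have 1: "\<bar>a b - real (f b)\<bar> \<le> 1" by linarith
    have "(t - pt h f) \<bullet> b = (a b - real (f b)) * (h / D)"
      using h D_pos by (simp add: inner_diff_left inner_pt[OF b] a_def field_simps)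
    then have "\<bar>(t - pt h f) \<bullet> b\<bar> = \<bar>a b - real (f b)\<bar> * (h / D)" using h by (simp add: abs_mult)
    also have "\<dots> \<le> 1 * (h / D)" using 1 h by (intro mult_right_mono) auto
    finally show "\<bar>(t - pt h f) \<bullet> b\<bar> \<le> h / D" by simp
  qed (use h in auto)
  then show ?thesis using fG by auto
qed

lemma grid_coord_close:
  assumes h: "h > 0" and fg: "f \<in> G h" "g \<in> G h" "dist (P h f) (P h g) \<le> 20 * h" and b: "b \<in> B"
  shows "f b \<in> {g b - 20 * DIM('a)..g b + 20 * DIM('a)}"
proof -
  have "\<bar>(pt h f - pt h g) \<bullet> b\<bar> \<le> norm (pt h f - pt h g)"
    using Cauchy_Schwarz_ineq2[of "pt h f - pt h g" b] B_norm[OF b] by simp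
  also have "\<dots> \<le> 20 * h"
    using graph_chart_proj[OF ch pt_mem[OF h fg(1)] pt_mem[OF h fg(2)]] fg(3) by (simp add: dist_norm P_def)
  also have "(pt h f - pt h g) \<bullet> b = (real (f b) - real (g b)) * (h / D)"
    by (simp add: inner_diff_left inner_pt[OF b] algebra_simps add_divide_distrib diff_divide_distrib)
  finally have "\<bar>real (f b) - real (g b)\<bar> * (h / D) \<le> 20 * h" using h by (simp add: abs_mult)
  then have "\<bar>real (f b) - real (g b)\<bar> \<le> 20 * D" using h D_pos by (simp add: field_simps)
  then have "\<bar>int (f b) - int (g b)\<bar> \<le> 20 * int DIM('a)" unfolding D_eq by linarith
  then show ?thesis by auto
qed

lemma inj_P: "h > 0 \<Longrightarrow> inj_on (P h) (G h)"
proof (rule inj_onI)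
  fix f g assume h: "h > 0" and fg: "f \<in> G h" "g \<in> G h" "P h f = P h g"
  have eq: "pt h f = pt h g" using graph_chart_proj[OF ch pt_mem[OF h fg(1)] pt_mem[OF h fg(2)]] fg(3) by (simp add: P_def)
  show "f = g"
  proof (rule PiE_ext)
    show "f \<in> PiE B (\<lambda>_. {..<2 * N h})" "g \<in> PiE B (\<lambda>_. {..<2 * N h})" using fg by (auto simp: G_def)
    fix b assume b: "b \<in> B"
    have "(real (f b) - N h) * (h / D) = (real (g b) - N h) * (h / D)"
      using inner_pt[OF b, of h f] inner_pt[OF b, of h g] eq by metis
    then show "f b = g b" using h D_pos by simp
  qed
qed

lemma grid_overlap:
  assumes h: "h > 0" and Y: "Y \<subseteq> P h ` G h"
  shows "overlap_le h M0 Y"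
  unfolding overlap_le_def
proof
  fix z
  show "card (Y \<inter> cball z (10 * h)) \<le> M0"
  proof (cases "Y \<inter> cball z (10 * h) = {}")
    case False
    then obtain y where "y \<in> Y" "dist z y \<le> 10 * h" by auto
    then obtain g where g: "g \<in> G h" "dist z (P h g) \<le> 10 * h" using Y by blast
    let ?A = "\<lambda>b. {g b - 20 * DIM('a)..g b + 20 * DIM('a)}"
    have "Y \<inter> cball z (10 * h) \<subseteq> P h ` PiE B ?A"
    proof
      fix y assume y: "y \<in> Y \<inter> cball z (10 * h)"
      then obtain f where f: "f \<in> G h" "y = P h f" using Y by auto
      have "dist (P h f) (P h g) \<le> 20 * h" using y f g dist_triangle3[of "P h f" "P h g" z] by simp
      then have "f \<in> PiE B ?A" using grid_coord_close[OF h f(1) g(1)] f(1) by (auto simp: G_def PiE_iff)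
      then show "y \<in> P h ` PiE B ?A" using f by blast
    qed
    then have "card (Y \<inter> cball z (10 * h)) \<le> card (P h ` PiE B ?A)"
      using B_fin by (intro card_mono finite_imageI finite_PiE) auto
    also have "\<dots> \<le> card (PiE B ?A)" using B_fin by (intro card_image_le finite_PiE) auto
    also have "\<dots> = (\<Prod>b\<in>B. card (?A b))" using B_fin by (simp add: card_PiE)
    also have "\<dots> \<le> (\<Prod>b\<in>B. 40 * DIM('a) + 1)" by (intro prod_mono) auto
    also have "\<dots> = M0" by (simp add: M0_def)
    finally show ?thesis .
  qed simp
qed

text \<open>The product of index intervals of half-width \<open>\<epsilon> / h\<close> contains a
  fraction of the grid that does not depend on \<open>h\<close>. A single grid point would not do,
  since the Poincare inequality controls sums over the grid and no single value.\<close>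

lemma grid_cluster:
  assumes t1: "\<nu> \<bullet> t1 = 0" "norm t1 \<le> r / (2 * D)" and \<epsilon>: "0 < \<epsilon>" "\<epsilon> \<le> r / 4" and h: "0 < h" "h \<le> r / 8" "h \<le> \<epsilon>"
  shows "\<exists>Q\<subseteq>G h. (\<forall>f\<in>Q. norm (pt h f - t1) \<le> \<epsilon>) \<and> (\<epsilon> / (2 * r)) ^ card B * real (2 * N h) ^ card B \<le> card Q"
proof -
  define a where "a b = (t1 \<bullet> b) / (h / D) + N h" for b
  define w where "w = \<epsilon> / h"
  define A where "A b = {nat \<lceil>a b - w\<rceil>..nat \<lfloor>a b + w\<rfloor>}" for b
  have r8: "r / h \<ge> 8" using h by (simp add: field_simps)
  have w1: "w \<ge> 1" using h by (simp add: w_def)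
  have w2: "w \<le> (r / h) / 4" using h \<epsilon> by (simp add: w_def field_simps)
  have a: "0 \<le> a b - w" "a b + w < 2 * N h" if b: "b \<in> B" for b
  proof -
    have "\<bar>t1 \<bullet> b\<bar> \<le> norm t1" using Cauchy_Schwarz_ineq2[of t1 b] B_norm[OF b] by simp
    then have "\<bar>t1 \<bullet> b\<bar> \<le> r / (2 * D)" using t1 by linarith
    then have "\<bar>t1 \<bullet> b\<bar> / (h / D) \<le> r / (2 * D) / (h / D)" using h D_pos by (intro divide_right_mono) auto
    also have "\<dots> = (r / h) / 2" using D_pos by simp
    finally have "\<bar>(t1 \<bullet> b) / (h / D)\<bar> \<le> (r / h) / 2" using h by (simp add: abs_mult)
    then have "0 \<le> a b - w \<and> a b + w < 2 * N h" using N_bounds(1)[OF h(1)] unfolding a_def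
      by (rule grid_index_bound) (use r8 w1 w2 in auto)
    then show "0 \<le> a b - w" "a b + w < 2 * N h" by auto
  qed
  have Aab: "\<bar>real i - a b\<bar> \<le> w" "i < 2 * N h" if "b \<in> B" "i \<in> A b" for b i
  proof -
    have "a b - w \<le> real i" "real i \<le> a b + w" using that a[OF that(1)] w1 unfolding A_def by auto linarith+
    then show "\<bar>real i - a b\<bar> \<le> w" "i < 2 * N h" using a[OF that(1)] by linarith+
  qed
  have cA: "\<epsilon> / (2 * r) * real (2 * N h) \<le> card (A b)" if "b \<in> B" for b
  proof -
    have "\<epsilon> / (2 * r) * real (2 * N h) \<le> \<epsilon> / (2 * r) * (2 * (r / h))"
      using N_bounds(2)[OF h(1)] \<epsilon> r_pos by (intro mult_left_mono) auto
    also have "\<dots> = w" using r_pos by (simp add: w_def)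
    \<comment> \<open>An interval of length \<open>2 * w\<close> contains at least
      \<open>2 * w - 1\<close> integers, and \<open>w \<ge> 1\<close> because
      \<open>h \<le> \<epsilon>\<close>.\<close>
    also have "\<dots> \<le> 2 * w - 1" using w1 by simp
    also have "\<dots> \<le> real (card (A b))" using a[OF that] w1 unfolding A_def by simp linarith
    finally show ?thesis .
  qed
  let ?Q = "PiE B A"
  have "?Q \<subseteq> G h" using Aab(2) by (force simp: G_def PiE_iff)
  moreover have "norm (pt h f - t1) \<le> \<epsilon>" if f: "f \<in> ?Q" for f
  proof -
    have "norm (pt h f - t1) \<le> D * (\<epsilon> / D)"
    proof (rule norm_le_coords)
      show "\<nu> \<bullet> (pt h f - t1) = 0" using t1 pt_tan by (simp add: inner_diff_right)
      fix b assume b: "b \<in> B"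
      have "f b \<in> A b" using f b by auto
      have "(pt h f - t1) \<bullet> b = (real (f b) - a b) * (h / D)"
        using h D_pos by (simp add: inner_diff_left inner_pt[OF b] a_def field_simps)
      then have "\<bar>(pt h f - t1) \<bullet> b\<bar> = \<bar>real (f b) - a b\<bar> * (h / D)" using h by (simp add: abs_mult)
      also have "\<dots> \<le> w * (h / D)" using Aab(1)[OF b \<open>f b \<in> A b\<close>] h by (intro mult_right_mono) auto
      also have "\<dots> = \<epsilon> / D" using h by (simp add: w_def)
      finally show "\<bar>(pt h f - t1) \<bullet> b\<bar> \<le> \<epsilon> / D" .
    qed (use \<epsilon> in auto)
    then show ?thesis by simp
  qed
  moreover have "(\<epsilon> / (2 * r)) ^ card B * real (2 * N h) ^ card B \<le> card ?Q"
  proof -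
    have "(\<epsilon> / (2 * r)) ^ card B * real (2 * N h) ^ card B = (\<Prod>b\<in>B. \<epsilon> / (2 * r) * real (2 * N h))"
      by (simp only: power_mult_distrib[symmetric] prod_constant)
    also have "\<dots> \<le> (\<Prod>b\<in>B. real (card (A b)))" using cA \<epsilon> r_pos by (intro prod_mono) auto
    also have "\<dots> = card ?Q" using B_fin by (simp add: card_PiE)
    finally show ?thesis .
  qed
  ultimately show ?thesis by blast
qed

lemma N_pos: "0 < h \<Longrightarrow> h \<le> r / 4 \<Longrightarrow> 2 * N h > 0"
  using N_bounds(1)[of h] by (cases "N h = 0") (auto simp: field_simps)

lemma chart_small:
  assumes "y \<in> S" "dist y0 y \<le> r1"
  obtains t where "t \<in> tangent_disc \<nu> r" "norm t \<le> r / (2 * D)" "y = \<phi> t"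
  using graph_chart_image_small[OF ch assms(1) y0, of "r / (2 * D)"] assms(2) by (auto simp: r1_def)

context
  fixes C c h :: real and X W :: "'a \<Rightarrow> 'a" and val e :: "'a \<Rightarrow> real" and E :: real
  assumes data: "macro_data S C c h X W val e E" and h0: "0 < h"
begin

lemma data_e_sum:
  assumes "Q \<subseteq> G h"
  shows "(\<Sum>f\<in>Q. (e (P h f))\<^sup>2) \<le> M0 * C * E"
proof -
  have "(\<Sum>f\<in>Q. (e (P h f))\<^sup>2) = (\<Sum>y\<in>P h ` Q. (e y)\<^sup>2)"
    using inj_on_subset[OF inj_P[OF h0] assms] by (subst sum.reindex) auto
  also have "\<dots> \<le> M0 * C * E"
  proof -
    have "finite (P h ` Q)" "P h ` Q \<subseteq> S" "overlap_le h M0 (P h ` Q)"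
      using assms finite_G finite_subset P_in_S[OF h0] by (blast, blast, intro grid_overlap[OF h0]) blast
    then show ?thesis by (rule macro_data_sum[OF data])
  qed
  finally show ?thesis .
qed

lemma data_segment:
  assumes t: "t \<in> tangent_disc \<nu> r" "t' \<in> tangent_disc \<nu> r" "norm (t - t') \<le> 2 * h"
  shows "norm (W (\<phi> t') - W (\<phi> t)) \<le> C * e (\<phi> t)"
    "\<bar>val (\<phi> t') - val (\<phi> t) - W (\<phi> t) \<bullet> (X (\<phi> t') - X (\<phi> t))\<bar> \<le> C * h * e (\<phi> t)"
proof -
  note seg = graph_chart_segment[OF ch t(1,2)]
  have "\<phi> ` closed_segment t t' \<subseteq> cball (\<phi> t) (5 * h)"
    by (rule order_trans[OF seg(3) subset_cball]) (use t h0 in simp)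
  moreover have "\<phi> t \<in> \<phi> ` closed_segment t t'" "\<phi> t' \<in> \<phi> ` closed_segment t t'" by auto
  ultimately have "norm (W (\<phi> t') - W (\<phi> t)) \<le> C * e (\<phi> t) \<and>
      \<bar>val (\<phi> t') - val (\<phi> t) - W (\<phi> t) \<bullet> (X (\<phi> t') - X (\<phi> t))\<bar> \<le> C * h * e (\<phi> t)"
    using data seg(1,2) unfolding macro_data_def by blast
  then show "norm (W (\<phi> t') - W (\<phi> t)) \<le> C * e (\<phi> t)"
    "\<bar>val (\<phi> t') - val (\<phi> t) - W (\<phi> t) \<bullet> (X (\<phi> t') - X (\<phi> t))\<bar> \<le> C * h * e (\<phi> t)" by auto
qed

lemma data_step:
  assumes f: "f \<in> G h" and b: "b \<in> B" "Suc (f b) < 2 * N h"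
  shows "norm (W (P h (f(b := Suc (f b)))) - W (P h f)) \<le> C * e (P h f)"
    "\<bar>val (P h (f(b := Suc (f b)))) - val (P h f) - W (P h f) \<bullet> (X (P h (f(b := Suc (f b)))) - X (P h f))\<bar> \<le> C * h * e (P h f)"
    "norm (X (P h (f(b := Suc (f b)))) - X (P h f)) \<le> 2 * h + 2 * (c * h\<^sup>2)"
proof -
  let ?f = "f(b := Suc (f b))"
  have f': "?f \<in> G h" using f b by (auto simp: G_def PiE_iff extensional_def)
  have n: "norm (pt h f - pt h ?f) \<le> h"
  proof -
    have "norm (pt h f - pt h ?f) = h / D"
      using pt_step[OF b(1), of h f] B_norm[OF b(1)] h0 by (subst norm_minus_commute) simp
    also have "\<dots> \<le> h" using D_pos h0 by (simp add: field_simps)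
    finally show ?thesis .
  qed
  note * = data_segment[OF pt_mem[OF h0 f] pt_mem[OF h0 f']]
  show "norm (W (P h ?f) - W (P h f)) \<le> C * e (P h f)"
    "\<bar>val (P h ?f) - val (P h f) - W (P h f) \<bullet> (X (P h ?f) - X (P h f))\<bar> \<le> C * h * e (P h f)"
    using * n h0 by (auto simp: P_def)
  have "norm (P h ?f - P h f) \<le> 2 * h"
    using P_dist_le[OF h0 f pt_mem[OF h0 f']] n by (simp add: P_def norm_minus_commute)
  moreover have "norm (X (P h ?f) - P h ?f) \<le> c * h\<^sup>2" "norm (X (P h f) - P h f) \<le> c * h\<^sup>2"
    using data P_in_S[OF h0 f] P_in_S[OF h0 f'] by (auto simp: macro_data_def)
  moreover have "X (P h ?f) - X (P h f) = (X (P h ?f) - P h ?f) + (P h ?f - P h f) - (X (P h f) - P h f)" by simp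
  ultimately show "norm (X (P h ?f) - X (P h f)) \<le> 2 * h + 2 * (c * h\<^sup>2)"
    by (smt (verit) norm_triangle_ineq norm_triangle_ineq4)
qed

end

end

section \<open>Gradient bounds over one chart\<close>

context chart_grid
begin

lemma hN: "0 < h \<Longrightarrow> h\<^sup>2 * (real (2 * N h))\<^sup>2 \<le> 4 * r\<^sup>2"
proof -
  assume h: "0 < h"
  have "h * real (2 * N h) \<le> 2 * r" using N_bounds(2)[OF h] h by (simp add: pos_le_divide_eq mult.commute)
  then have "(h * real (2 * N h))\<^sup>2 \<le> (2 * r)\<^sup>2" using h by (intro power_mono) auto
  then show ?thesis by (simp add: power_mult_distrib)
qed

text \<open>An arbitrary set \<open>Y\<close> is moved to the grid: each of its points has a grid
  point within \<open>2 * h\<close>, the two gradients differ by at most \<open>C * e y\<close>, and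
  at most \<open>m\<close> points of \<open>Y\<close> go to the same grid point.\<close>

lemma good_of_grid:
  assumes C: "C \<ge> 0" and h1: "h1 > 0"
    and K: "\<And>h X W val e E. 0 < h \<Longrightarrow> h \<le> h1 \<Longrightarrow> macro_data S C c h X W val e E \<Longrightarrow>
      h\<^sup>2 * (\<Sum>f\<in>G h. (norm (W (P h f)))\<^sup>2) \<le> K * E"
  shows "good_point S C c y0"
  unfolding good_point_def
\<comment> \<open>\<open>2 * K\<close> comes from the grid sum, \<open>2 * C ^ 3\<close> from the
  squares of the differences \<open>C * e y\<close>, whose energies sum to at most
  \<open>m * C * E\<close>.\<close>
proof (rule exI[of _ r1], rule conjI[OF r1_pos], rule exI[of _ "2 * K + 2 * C ^ 3"],
    rule exI[of _ "min (min h1 1) (r / 4)"], intro conjI allI impI)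
  show "min (min h1 1) (r / 4) > 0" using h1 r_pos by simp
  fix h X W val e E Y m
  assume h: "0 < h" "h \<le> min (min h1 1) (r / 4)" and data: "macro_data S C c h X W val e E"
    and Y: "finite Y" "Y \<subseteq> S \<inter> ball y0 r1" and ov: "overlap_le h m Y"
  have E0: "E \<ge> 0" using data by (simp add: macro_data_def)
  have "\<forall>y. \<exists>f. y \<in> Y \<longrightarrow> f \<in> G h \<and> dist (P h f) y \<le> 2 * h \<and> norm (W y) \<le> norm (W (P h f)) + C * e y"
  proof (intro allI)
    fix y
    show "\<exists>f. y \<in> Y \<longrightarrow> f \<in> G h \<and> dist (P h f) y \<le> 2 * h \<and> norm (W y) \<le> norm (W (P h f)) + C * e y"
    proof (cases "y \<in> Y")
      case True
      then have "y \<in> S" "dist y0 y \<le> r1" using Y by auto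
      then obtain t where t: "t \<in> tangent_disc \<nu> r" "norm t \<le> r / (2 * D)" "y = \<phi> t" by (rule chart_small)
      have "\<nu> \<bullet> t = 0" using t by (simp add: tangent_disc_def)
      then obtain f where f: "f \<in> G h" "norm (t - pt h f) \<le> h" using near_grid_point[of h t] h t by auto
      have "dist (P h f) y \<le> 2 * h" using P_dist_le[OF h(1) f(1) t(1)] f(2) t(3)
        by (simp add: dist_norm norm_minus_commute)
      moreover have "norm (W (P h f) - W y) \<le> C * e y"
        using data_segment(1)[OF data h(1) t(1) pt_mem[OF h(1) f(1)]] f(2) h t(3) by (simp add: P_def)
      ultimately show ?thesis using f(1) norm_triangle_ineq2[of "W y" "W (P h f)"]
        by (intro exI[of _ f]) (simp add: norm_minus_commute)
    qed simp
  qed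
  from choice[OF this] obtain F where F: "\<forall>y. y \<in> Y \<longrightarrow> F y \<in> G h \<and> dist (P h (F y)) y \<le> 2 * h \<and>
      norm (W y) \<le> norm (W (P h (F y))) + C * e y" by (rule exE)
  have "(norm (W y))\<^sup>2 \<le> 2 * (norm (W (P h (F y))))\<^sup>2 + 2 * C\<^sup>2 * (e y)\<^sup>2" if "y \<in> Y" for y
  proof -
    have "(norm (W y))\<^sup>2 \<le> (norm (W (P h (F y))) + C * e y)\<^sup>2" using F that by (intro power_mono) auto
    also have "\<dots> \<le> 2 * (norm (W (P h (F y))))\<^sup>2 + 2 * (C * e y)\<^sup>2"
      using sum_squares_bound[of "norm (W (P h (F y)))" "C * e y"] by (simp add: power2_sum)
    finally show ?thesis by (simp add: power_mult_distrib)
  qed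
  then have "(\<Sum>y\<in>Y. (norm (W y))\<^sup>2) \<le> (\<Sum>y\<in>Y. 2 * (norm (W (P h (F y))))\<^sup>2 + 2 * C\<^sup>2 * (e y)\<^sup>2)"
    by (intro sum_mono) auto
  also have "\<dots> = 2 * (\<Sum>y\<in>Y. (norm (W (P h (F y))))\<^sup>2) + 2 * C\<^sup>2 * (\<Sum>y\<in>Y. (e y)\<^sup>2)"
    by (simp add: sum.distrib sum_distrib_left)
  also have "(\<Sum>y\<in>Y. (norm (W (P h (F y))))\<^sup>2) \<le> real m * (\<Sum>f\<in>G h. (norm (W (P h f)))\<^sup>2)"
  proof -
    have "(\<Sum>y\<in>Y. (norm (W (P h (F y))))\<^sup>2) = (\<Sum>f\<in>G h. \<Sum>y\<in>{y\<in>Y. F y = f}. (norm (W (P h (F y))))\<^sup>2)"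
      using F Y(1) finite_G by (intro sum.group[symmetric]) auto
    also have "\<dots> = (\<Sum>f\<in>G h. real (card {y\<in>Y. F y = f}) * (norm (W (P h f)))\<^sup>2)" by simp
    also have "\<dots> \<le> (\<Sum>f\<in>G h. real m * (norm (W (P h f)))\<^sup>2)"
    proof (intro sum_mono mult_right_mono)
      fix f
      have "{y\<in>Y. F y = f} \<subseteq> Y \<inter> cball (P h f) (10 * h)"
      proof
        fix y assume "y \<in> {y\<in>Y. F y = f}"
        then have "y \<in> Y" "dist (P h f) y \<le> 2 * h" using F by auto
        then show "y \<in> Y \<inter> cball (P h f) (10 * h)" using h by simp
      qed
      then have "card {y\<in>Y. F y = f} \<le> card (Y \<inter> cball (P h f) (10 * h))" using Y by (intro card_mono) auto
      then show "real (card {y\<in>Y. F y = f}) \<le> real m" 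
        using ov[unfolded overlap_le_def, rule_format, of "P h f"] by linarith
    qed auto
    finally show ?thesis by (simp add: sum_distrib_left)
  qed
  also have "(\<Sum>y\<in>Y. (e y)\<^sup>2) \<le> real m * C * E"
    by (rule macro_data_sum[OF data _ _ ov]) (use Y in auto)
  finally have "(\<Sum>y\<in>Y. (norm (W y))\<^sup>2) \<le> 2 * (real m * (\<Sum>f\<in>G h. (norm (W (P h f)))\<^sup>2)) + 2 * C\<^sup>2 * (real m * C * E)"
    by (simp add: mult_left_mono)
  then have "h\<^sup>2 * (\<Sum>y\<in>Y. (norm (W y))\<^sup>2) \<le> h\<^sup>2 * (2 * (real m * (\<Sum>f\<in>G h. (norm (W (P h f)))\<^sup>2)) + 2 * C\<^sup>2 * (real m * C * E))"
    by (intro mult_left_mono) auto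
  also have "\<dots> = 2 * real m * (h\<^sup>2 * (\<Sum>f\<in>G h. (norm (W (P h f)))\<^sup>2)) + h\<^sup>2 * (2 * C\<^sup>2 * (real m * C * E))"
    by (simp add: algebra_simps)
  also have "\<dots> \<le> 2 * real m * (K * E) + 1 * (2 * C\<^sup>2 * (real m * C * E))"
  proof (intro add_mono mult_left_mono mult_right_mono)
    show "h\<^sup>2 * (\<Sum>f\<in>G h. (norm (W (P h f)))\<^sup>2) \<le> K * E" using K h data by auto
    show "h\<^sup>2 \<le> 1" using h by (simp add: power_le_one)
  qed (use C E0 in auto)
  also have "\<dots> = real m * (2 * K + 2 * C ^ 3) * E" by (simp add: algebra_simps power2_eq_square power3_eq_cube)
  finally show "h\<^sup>2 * (\<Sum>y\<in>Y. (norm (W y))\<^sup>2) \<le> real m * (2 * K + 2 * C ^ 3) * E" .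
qed

text \<open>A cluster of grid points near \<open>y1\<close> is a fixed fraction of the grid around
  \<open>y0\<close>, so \<open>grid_spread\<close> applies. What matters is that the admissible
  distance \<open>r1\<close> belongs to the chart at \<open>y0\<close> and not to \<open>y1\<close>:
  read backwards, every point of \<open>S\<close> within \<open>r1\<close> of a bad point is
  bad.\<close>

lemma good_if_near_good:
  assumes C: "C \<ge> 0" and y1: "y1 \<in> S" "dist y0 y1 \<le> r1" and good: "good_point S C c y1"
  shows "good_point S C c y0"
proof -
  obtain r2 K h2 where r2: "r2 > 0" and h2: "h2 > 0" and
    K: "\<And>h X W val e E Y m. \<lbrakk>0 < h; h \<le> h2; macro_data S C c h X W val e E; finite Y; Y \<subseteq> S \<inter> ball y1 r2;
      overlap_le h m Y\<rbrakk> \<Longrightarrow> h\<^sup>2 * (\<Sum>y\<in>Y. (norm (W y))\<^sup>2) \<le> real m * K * E"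
    using good unfolding good_point_def by blast
  obtain t1 where t1: "t1 \<in> tangent_disc \<nu> r" "norm t1 \<le> r / (2 * D)" "y1 = \<phi> t1" using chart_small[OF y1] .
  \<comment> \<open>A third of \<open>r2\<close>, because \<open>\<phi>\<close> may double the
    distance \<epsilon> between parameters.\<close>
  define \<epsilon> where "\<epsilon> = min (r / 4) (r2 / 3)"
  have \<epsilon>: "0 < \<epsilon>" "\<epsilon> \<le> r / 4" "2 * \<epsilon> < r2" using r_pos r2 by (auto simp: \<epsilon>_def min_def)
  define \<kappa> where "\<kappa> = (\<epsilon> / (2 * r)) ^ card B"
  have \<kappa>: "\<kappa> > 0" using \<epsilon> r_pos by (simp add: \<kappa>_def)
  let ?K = "2 / \<kappa> * (M0 * K) + 2 / \<kappa> * 4 ^ card B * (4 * r\<^sup>2) * (C\<^sup>2 * (M0 * C))"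
  show ?thesis
  proof (rule good_of_grid[OF C, of "min h2 (min (r / 8) \<epsilon>)" _ ?K])
    show "min h2 (min (r / 8) \<epsilon>) > 0" using h2 r_pos \<epsilon> by simp
    fix h X W val e E
    assume h: "0 < h" "h \<le> min h2 (min (r / 8) \<epsilon>)" and data: "macro_data S C c h X W val e E"
    have E0: "E \<ge> 0" using data by (simp add: macro_data_def)
    obtain Q where Q: "Q \<subseteq> G h" "\<And>f. f \<in> Q \<Longrightarrow> norm (pt h f - t1) \<le> \<epsilon>" "\<kappa> * real (2 * N h) ^ card B \<le> card Q"
      using grid_cluster[of t1 \<epsilon> h] t1 \<epsilon> h unfolding \<kappa>_def by (auto simp: tangent_disc_def)
    have QY: "P h ` Q \<subseteq> S \<inter> ball y1 r2"
    proof
      fix y assume "y \<in> P h ` Q"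
      then obtain f where f: "f \<in> Q" "y = P h f" by blast
      then have "norm (y1 - y) \<le> 2 * \<epsilon>" "y \<in> S"
        using P_dist_le[OF h(1) _ t1(1), of f] Q(1,2) P_in_S[OF h(1)] t1(3) by (force simp: norm_minus_commute)+
      then show "y \<in> S \<inter> ball y1 r2" using \<epsilon> by (simp add: dist_norm)
    qed
    have "(\<Sum>f\<in>Q. (norm (W (P h f)))\<^sup>2) = (\<Sum>y\<in>P h ` Q. (norm (W y))\<^sup>2)"
      using inj_on_subset[OF inj_P[OF h(1)] Q(1)] by (subst sum.reindex) auto
    then have 1: "h\<^sup>2 * (\<Sum>f\<in>Q. (norm (W (P h f)))\<^sup>2) \<le> M0 * K * E"
      using K[OF h(1) _ data _ QY grid_overlap[OF h(1)]] h Q(1) finite_G finite_subset[OF Q(1)] by auto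
    have 2: "(\<Sum>f\<in>G h. (norm (W (P h f)))\<^sup>2) \<le> 2 / \<kappa> * (\<Sum>f\<in>Q. (norm (W (P h f)))\<^sup>2)
        + 2 / \<kappa> * 4 ^ card B * real (2 * N h) ^ 2 * (\<Sum>f\<in>G h. (C * e (P h f))\<^sup>2)"
      unfolding G_def
    proof (rule grid_spread[OF B_fin])
      show "0 < 2 * N h" using N_pos[of h] h by simp
      show "Q \<subseteq> PiE B (\<lambda>_. {..<2 * N h})" using Q(1) by (simp add: G_def)
    qed (use data_step(1)[OF data h(1)] \<kappa> Q(3) in \<open>auto simp: G_def\<close>)
    have 3: "(\<Sum>f\<in>G h. (C * e (P h f))\<^sup>2) \<le> C\<^sup>2 * (M0 * C * E)"
      using data_e_sum[OF data h(1), of "G h"] by (simp add: power_mult_distrib sum_distrib_left[symmetric] mult_left_mono)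
    have "h\<^sup>2 * (\<Sum>f\<in>G h. (norm (W (P h f)))\<^sup>2) \<le> h\<^sup>2 * (2 / \<kappa> * (\<Sum>f\<in>Q. (norm (W (P h f)))\<^sup>2)
        + 2 / \<kappa> * 4 ^ card B * real (2 * N h) ^ 2 * (\<Sum>f\<in>G h. (C * e (P h f))\<^sup>2))"
      using 2 by (intro mult_left_mono) auto
    also have "\<dots> = 2 / \<kappa> * (h\<^sup>2 * (\<Sum>f\<in>Q. (norm (W (P h f)))\<^sup>2))
        + 2 / \<kappa> * 4 ^ card B * (h\<^sup>2 * real (2 * N h) ^ 2) * (\<Sum>f\<in>G h. (C * e (P h f))\<^sup>2)"
      by (simp add: algebra_simps)
    also have "\<dots> \<le> 2 / \<kappa> * (M0 * K * E) + 2 / \<kappa> * 4 ^ card B * (4 * r\<^sup>2) * (C\<^sup>2 * (M0 * C * E))"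
      using \<kappa> by (intro add_mono mult_left_mono mult_mono 1 3 hN[OF h(1)] sum_nonneg mult_nonneg_nonneg) auto
    also have "\<dots> = ?K * E" by (simp add: algebra_simps)
    finally show "h\<^sup>2 * (\<Sum>f\<in>G h. (norm (W (P h f)))\<^sup>2) \<le> ?K * E" .
  qed
qed

text \<open>On a patch the Poincare inequality makes \<open>W\<close> nearly constant and \<open>val\<close> nearly affine, and an
  affine function is controlled by its values on a set that lies in no hyperplane.\<close>

lemma good_if_nonflat:
  assumes C: "C \<ge> 0" and c: "c \<ge> 0" and nf: "\<And>m. m \<noteq> 0 \<Longrightarrow> \<exists>y\<in>S. dist y0 y \<le> r1 \<and> m \<bullet> (y - y0) \<noteq> 0"
  shows "good_point S C c y0"
proof -
  let ?V = "(\<lambda>y. y - y0) ` {y \<in> S. dist y0 y \<le> r1}"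
  obtain J c0 where J: "J \<subseteq> ?V" "finite J" "0 < c0" "\<And>g. \<exists>v\<in>J. c0 * norm g \<le> \<bar>g \<bullet> v\<bar>"
    using nonflat_quantitative[of ?V] nf by blast
  \<comment> \<open>Cluster points then fix positions on the discrete surface up to
    \<open>3 * (c0 / 16)\<close>, so the errors of two clusters together stay below
    \<open>c0 / 2\<close>.\<close>
  define \<epsilon> where "\<epsilon> = min (r / 4) (c0 / 16)"
  have \<epsilon>: "0 < \<epsilon>" "\<epsilon> \<le> r / 4" "\<epsilon> \<le> c0 / 16" using r_pos J by (auto simp: \<epsilon>_def)
  define \<kappa> where "\<kappa> = (\<epsilon> / (2 * r)) ^ card B"
  have \<kappa>: "\<kappa> > 0" using \<epsilon> r_pos by (simp add: \<kappa>_def)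
  \<comment> \<open>Multiplied by the square of \<open>h\<close>, the Poincare constant of the grid
    is at most \<open>q\<close>.\<close>
  define q where "q = (4::real) ^ card B * (4 * r\<^sup>2)"
  have q0: "q \<ge> 0" by (simp add: q_def)
  \<comment> \<open>\<open>K1\<close> belongs to the deviation of \<open>val\<close> from an affine
    function, \<open>K2\<close> to the bound on the constant gradient \<open>g\<close>,
    \<open>K3\<close> to the oscillation of the gradient around \<open>g\<close>; \<open>K4\<close>
    combines them.\<close>
  define K1 where "K1 = q * (2 * C\<^sup>2 + 32 * (q * C\<^sup>2))"
  define K2 where "K2 = 32 / (\<kappa>\<^sup>2 * c0\<^sup>2)"
  define K3 where "K3 = 2 * (q * C\<^sup>2)"
  define K4 where "K4 = 2 * (2 * K2 * (C + C * K3 + K1)) + K3"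
  have K0: "K1 \<ge> 0" "K2 > 0" "K3 \<ge> 0" "K4 \<ge> 0"
    using q0 C \<kappa> J by (auto simp: K1_def K2_def K3_def K4_def)
  define h1 where "h1 = min (min (min (r / 8) \<epsilon>) (min 1 (c0 / (16 * (c + 1))))) (min (1 / (c + 1)) (1 / (4 * K2 * C + 1)))"
  show ?thesis
  proof (rule good_of_grid[OF C, of h1 _ "K4 * (M0 * C)"])
    have "4 * K2 * C + 1 > 0" using K0 C by (smt (verit) mult_nonneg_nonneg)
    then show "h1 > 0" using r_pos \<epsilon> c J by (simp add: h1_def)
    fix h X W val e E
    assume h: "0 < h" "h \<le> h1" and data: "macro_data S C c h X W val e E"
    have E0: "E \<ge> 0" using data by (simp add: macro_data_def)
    have hs: "h \<le> r / 8" "h \<le> r / 4" "h \<le> \<epsilon>" "h \<le> 1" "h \<le> c0 / (16 * (c + 1))" "h \<le> 1 / (c + 1)" "h \<le> 1 / (4 * K2 * C + 1)"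
      using h r_pos by (auto simp: h1_def)
    have h2: "h\<^sup>2 \<le> h" "h\<^sup>2 \<le> 1" using h hs by (auto simp: power2_eq_square mult_le_cancel_left1 mult_le_one)
    have ch1: "c * h \<le> 1" using hs(6) h c by (simp add: pos_le_divide_eq algebra_simps)
    have ch2: "c * h\<^sup>2 \<le> c0 / 16"
    proof -
      have "c * h\<^sup>2 \<le> (c + 1) * h" using h2 c h by (intro mult_mono) auto
      also have "\<dots> \<le> c0 / 16" using hs(5) c by (simp add: pos_le_divide_eq algebra_simps)
      finally show ?thesis .
    qed
    \<comment> \<open>In \<open>macro_data\<close> the values are themselves bounded by the
      gradient, which threatens circularity; for small \<open>h\<close> the returning term has a
      factor of at most 1/2 and is absorbed.\<close>
    have hK: "2 * (K2 * C * h\<^sup>2) \<le> 1 / 2"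
    proof -
      have "(4 * K2 * C + 1) * h \<le> 1" using hs(7) K0 C by (simp add: pos_le_divide_eq add_nonneg_pos mult.commute)
      then have "4 * K2 * C * h \<le> 1" using h by (simp add: algebra_simps)
      moreover have "4 * K2 * C * h\<^sup>2 \<le> 4 * K2 * C * h" using h2 K0 C by (intro mult_left_mono) auto
      ultimately show ?thesis by simp
    qed
    let ?n = "2 * N h"
    let ?G = "PiE B (\<lambda>_. {..<?n})"
    have Geq: "G h = ?G" by (simp add: G_def)
    have n0: "0 < ?n" using N_pos[of h] h hs by simp
    have cG: "real (card (G h)) = real ?n ^ card B" unfolding G_def using B_fin by (simp add: card_PiE)
    have cGpos: "real (card (G h)) > 0" unfolding cG using n0 by simp
    define En where "En = (\<Sum>f\<in>G h. (e (P h f))\<^sup>2)"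
    have En: "En \<ge> 0" "En \<le> M0 * C * E"
      using data_e_sum[OF data h(1), of "G h"] by (auto simp: En_def intro: sum_nonneg)
    define u where "u f = W (P h f)" for f
    obtain f0 where f0: "f0 \<in> G h" "(\<Sum>f\<in>G h. (norm (u f - u f0))\<^sup>2) \<le> 4 ^ card B * real ?n ^ 2 * (\<Sum>f\<in>G h. (C * e (P h f))\<^sup>2)"
      using grid_poincare_center[OF B_fin n0, of u "\<lambda>f. C * e (P h f)"] data_step(1)[OF data h(1)]
      unfolding u_def G_def by blast
    define g where "g = u f0"
    define Wd where "Wd = (\<Sum>f\<in>G h. (norm (u f - g))\<^sup>2)"
    have Wd0: "Wd \<ge> 0" unfolding Wd_def by (intro sum_nonneg) auto
    have CEn: "(\<Sum>f\<in>G h. (C * e (P h f))\<^sup>2) = C\<^sup>2 * En"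
      by (simp add: En_def power_mult_distrib sum_distrib_left)
    have hWd: "h\<^sup>2 * Wd \<le> q * C\<^sup>2 * En"
    proof -
      have "h\<^sup>2 * Wd \<le> h\<^sup>2 * (4 ^ card B * real ?n ^ 2 * (C\<^sup>2 * En))"
        using f0(2) unfolding CEn Wd_def g_def by (intro mult_left_mono) auto
      also have "\<dots> = 4 ^ card B * (h\<^sup>2 * real ?n ^ 2) * (C\<^sup>2 * En)" by (simp add: algebra_simps)
      also have "\<dots> \<le> 4 ^ card B * (4 * r\<^sup>2) * (C\<^sup>2 * En)"
        using hN[OF h(1)] En C by (intro mult_right_mono mult_left_mono) auto
      finally show ?thesis by (simp add: q_def)
    qed
    \<comment> \<open>Subtracting the linear function with fixed gradient \<open>g\<close> leaves
      small increments, and a second use of the Poincare inequality makes \<open>a\<close> nearly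
      constant.\<close>
    define a where "a f = val (P h f) - g \<bullet> X (P h f)" for f
    \<comment> \<open>\<open>4 * h\<close> bounds one grid step on the discrete surface:
      \<open>2 * h\<close> on \<open>S\<close> and two displacements of at most
      \<open>h\<close>.\<close>
    define e2 where "e2 f = C * h * e (P h f) + 4 * h * norm (u f - g)" for f
    have step_a: "norm (a (f(b := Suc (f b))) - a f) \<le> e2 f"
      if "f \<in> ?G" "b \<in> B" "Suc (f b) < ?n" for f b
    proof -
      let ?f = "f(b := Suc (f b))"
      note ds = data_step[OF data h(1), of f b]
      have f: "f \<in> G h" using that by (simp add: G_def)
      have "a ?f - a f = (val (P h ?f) - val (P h f) - W (P h f) \<bullet> (X (P h ?f) - X (P h f)))
          + (u f - g) \<bullet> (X (P h ?f) - X (P h f))"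
        by (simp add: a_def u_def algebra_simps)
      moreover have "\<bar>(u f - g) \<bullet> (X (P h ?f) - X (P h f))\<bar> \<le> 4 * h * norm (u f - g)"
      proof -
        have "c * h\<^sup>2 \<le> h" using mult_right_mono[OF ch1, of h] h by (simp add: power2_eq_square mult.assoc)
        then have "norm (X (P h ?f) - X (P h f)) \<le> 4 * h" using ds(3)[OF f that(2,3)] by linarith
        then show ?thesis using Cauchy_Schwarz_ineq2[of "u f - g" "X (P h ?f) - X (P h f)"]
            mult_left_mono[of "norm (X (P h ?f) - X (P h f))" "4 * h" "norm (u f - g)"] by (simp add: mult.commute)
      qed
      ultimately show ?thesis using ds(2)[OF f that(2,3)] unfolding e2_def real_norm_def by linarith
    qed
    obtain f1 where f1: "f1 \<in> G h" "(\<Sum>f\<in>G h. (norm (a f - a f1))\<^sup>2) \<le> 4 ^ card B * real ?n ^ 2 * (\<Sum>f\<in>G h. (e2 f)\<^sup>2)"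
      using grid_poincare_center[OF B_fin n0, of a e2] step_a unfolding Geq by blast
    define er where "er f = a f - a f1" for f
    define Er where "Er = (\<Sum>f\<in>G h. (er f)\<^sup>2)"
    have Er0: "Er \<ge> 0" unfolding Er_def by (intro sum_nonneg) auto
    have e2s: "(\<Sum>f\<in>G h. (e2 f)\<^sup>2) \<le> 2 * C\<^sup>2 * h\<^sup>2 * En + 32 * h\<^sup>2 * Wd"
    proof -
      have "(e2 f)\<^sup>2 \<le> 2 * C\<^sup>2 * h\<^sup>2 * (e (P h f))\<^sup>2 + 32 * h\<^sup>2 * (norm (u f - g))\<^sup>2" for f
      proof -
        have "(e2 f)\<^sup>2 \<le> 2 * (C * h * e (P h f))\<^sup>2 + 2 * (4 * h * norm (u f - g))\<^sup>2"
          using norm_add_sq_le[of "C * h * e (P h f)" "4 * h * norm (u f - g)"] unfolding e2_def by simp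
        then show ?thesis by (simp add: power_mult_distrib)
      qed
      then have "(\<Sum>f\<in>G h. (e2 f)\<^sup>2) \<le> (\<Sum>f\<in>G h. 2 * C\<^sup>2 * h\<^sup>2 * (e (P h f))\<^sup>2 + 32 * h\<^sup>2 * (norm (u f - g))\<^sup>2)"
        by (intro sum_mono)
      then show ?thesis by (simp add: sum.distrib sum_distrib_left[symmetric] En_def Wd_def)
    qed
    have hEr: "h\<^sup>2 * Er \<le> K1 * En"
    proof -
      have "h\<^sup>2 * Er \<le> h\<^sup>2 * (4 ^ card B * real ?n ^ 2 * (\<Sum>f\<in>G h. (e2 f)\<^sup>2))"
        using f1(2) unfolding Er_def er_def by (intro mult_left_mono) auto
      also have "\<dots> = 4 ^ card B * (h\<^sup>2 * real ?n ^ 2) * (\<Sum>f\<in>G h. (e2 f)\<^sup>2)" by (simp add: algebra_simps)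
      also have "\<dots> \<le> 4 ^ card B * (4 * r\<^sup>2) * (2 * C\<^sup>2 * h\<^sup>2 * En + 32 * h\<^sup>2 * Wd)"
        by (intro mult_mono[OF mult_left_mono[OF hN[OF h(1)]] e2s]) (auto intro: sum_nonneg)
      also have "\<dots> = q * (2 * C\<^sup>2 * (h\<^sup>2 * En) + 32 * (h\<^sup>2 * Wd))" by (simp add: q_def)
      also have "\<dots> \<le> q * (2 * C\<^sup>2 * (1 * En) + 32 * (q * C\<^sup>2 * En))"
        using q0 h2 En hWd by (intro mult_left_mono add_mono mult_right_mono) auto
      also have "\<dots> = K1 * En" by (simp add: K1_def algebra_simps)
      finally show ?thesis .
    qed
    define Uq where "Uq f = (val (P h f))\<^sup>2 + (er f)\<^sup>2" for f
    have Uq0: "Uq f \<ge> 0" for f by (simp add: Uq_def)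
    have XP: "norm (X (P h f) - \<phi> t) \<le> 3 * (c0 / 16)"
      if f: "f \<in> G h" and t: "t \<in> tangent_disc \<nu> r" "norm (pt h f - t) \<le> \<epsilon>" for f t
    proof -
      have "norm (\<phi> t - P h f) \<le> 2 * \<epsilon>" using P_dist_le[OF h(1) f t(1)] t(2) by (simp add: norm_minus_commute)
      moreover have "norm (X (P h f) - P h f) \<le> c0 / 16"
        using data P_in_S[OF h(1) f] ch2 unfolding macro_data_def by (meson order_trans)
      ultimately show ?thesis using norm_triangle_ineq4[of "X (P h f) - P h f" "\<phi> t - P h f"] \<epsilon>(3) by simp
    qed
    obtain v where v: "v \<in> J" "c0 * norm g \<le> \<bar>g \<bullet> v\<bar>" using J(4) by blast
    then obtain y where y: "y \<in> S" "dist y0 y \<le> r1" "v = y - y0" using J(1) by auto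
    obtain t1 where t1: "t1 \<in> tangent_disc \<nu> r" "norm t1 \<le> r / (2 * D)" "y = \<phi> t1" using chart_small[OF y(1,2)] .
    have t0: "0 \<in> tangent_disc \<nu> r" using r_pos by (simp add: tangent_disc_def)
    have "\<phi> 0 = y0" by (rule graph_chart_zero[OF ch y0])
    obtain Q1 where Q1: "Q1 \<subseteq> G h" "\<And>f. f \<in> Q1 \<Longrightarrow> norm (pt h f - t1) \<le> \<epsilon>" "\<kappa> * real ?n ^ card B \<le> card Q1"
      using grid_cluster[of t1 \<epsilon> h] t1 \<epsilon> h hs unfolding \<kappa>_def by (auto simp: tangent_disc_def)
    obtain Q0 where Q0: "Q0 \<subseteq> G h" "\<And>f. f \<in> Q0 \<Longrightarrow> norm (pt h f - 0) \<le> \<epsilon>" "\<kappa> * real ?n ^ card B \<le> card Q0"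
      using grid_cluster[of 0 \<epsilon> h] \<epsilon> h hs r_pos unfolding \<kappa>_def by auto
    \<comment> \<open>After removal of \<open>er\<close>, the values at the two clusters differ by
      \<open>g \<bullet> v\<close> up to at most half of \<open>c0 * norm g\<close>. The additive
      constant \<open>a f1\<close> cancels in the difference.\<close>
    have pair: "c0\<^sup>2 / 4 * (norm g)\<^sup>2 \<le> 4 * Uq f + 4 * Uq f'" if f: "f \<in> Q1" "f' \<in> Q0" for f f'
    proof -
      have 1: "norm (X (P h f) - y) \<le> 3 * (c0 / 16)" using XP[OF _ t1(1)] Q1 f t1 by blast
      have 2: "norm (X (P h f') - y0) \<le> 3 * (c0 / 16)" using XP[OF _ t0] Q0 f \<open>\<phi> 0 = y0\<close> by (metis subsetD)
      define z where "z = (X (P h f) - y) - (X (P h f') - y0)"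
      have "norm z \<le> c0 / 2" using norm_triangle_ineq4[of "X (P h f) - y" "X (P h f') - y0"] 1 2 J(3)
        unfolding z_def by linarith
      then have 3: "\<bar>g \<bullet> z\<bar> \<le> norm g * (c0 / 2)"
        using Cauchy_Schwarz_ineq2[of g z] by (meson mult_left_mono norm_ge_zero order_trans)
      have eq: "(val (P h f) - er f) - (val (P h f') - er f') = g \<bullet> v + g \<bullet> z"
        unfolding er_def a_def z_def y(3) by (simp add: algebra_simps)
      then have 4: "c0 / 2 * norm g \<le> \<bar>(val (P h f) - er f) - (val (P h f') - er f')\<bar>"
      proof -
        have "2 * \<bar>g \<bullet> z\<bar> \<le> c0 * norm g" using 3 by (simp add: mult.commute)
        then show ?thesis unfolding eq using v(2) by linarith
      qed
      have "(c0 / 2 * norm g)\<^sup>2 \<le> ((val (P h f) - er f) - (val (P h f') - er f'))\<^sup>2"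
        using power_mono[OF 4, of 2] J(3) by simp
      also have "\<dots> \<le> 2 * (val (P h f) - er f)\<^sup>2 + 2 * (val (P h f') - er f')\<^sup>2"
        by (rule real_diff_sq_le)
      also have "\<dots> \<le> 2 * (2 * (val (P h f))\<^sup>2 + 2 * (er f)\<^sup>2) + 2 * (2 * (val (P h f'))\<^sup>2 + 2 * (er f')\<^sup>2)"
        by (intro add_mono mult_left_mono real_diff_sq_le) auto
      finally show ?thesis by (simp add: Uq_def power_mult_distrib power_divide)
    qed
    define SU where "SU = (\<Sum>f\<in>G h. Uq f)"
    \<comment> \<open>Summation of \<open>pair\<close> over both clusters, each a fraction \<kappa>
      of the grid, produces the square of \<kappa> in \<open>K2\<close>.\<close>
    have gs: "card (G h) * (norm g)\<^sup>2 \<le> K2 * SU"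
    proof -
      have QG: "card Q1 \<le> card (G h)" "card Q0 \<le> card (G h)" using Q1(1) Q0(1) finite_G by (auto intro: card_mono)
      have sumQ: "(\<Sum>f\<in>Q1. Uq f) \<le> SU" "(\<Sum>f\<in>Q0. Uq f) \<le> SU"
        unfolding SU_def using Q1(1) Q0(1) finite_G Uq0 by (auto intro: sum_mono2)
      have SU0: "SU \<ge> 0" unfolding SU_def using Uq0 by (intro sum_nonneg) auto
      have k1: "\<kappa> * card (G h) \<le> card Q1" "\<kappa> * card (G h) \<le> card Q0" using Q1(3) Q0(3) by (simp_all add: cG)
      have "(\<kappa> * card (G h)) * (\<kappa> * card (G h)) * (c0\<^sup>2 / 4 * (norm g)\<^sup>2) \<le> real (card Q1) * real (card Q0) * (c0\<^sup>2 / 4 * (norm g)\<^sup>2)"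
        using k1 \<kappa> by (intro mult_right_mono mult_mono) auto
      also have "\<dots> = (\<Sum>f\<in>Q1. \<Sum>f'\<in>Q0. c0\<^sup>2 / 4 * (norm g)\<^sup>2)" by simp
      also have "\<dots> \<le> (\<Sum>f\<in>Q1. \<Sum>f'\<in>Q0. 4 * Uq f + 4 * Uq f')" using pair by (intro sum_mono) auto
      also have "\<dots> = 4 * (real (card Q0) * (\<Sum>f\<in>Q1. Uq f)) + 4 * (real (card Q1) * (\<Sum>f\<in>Q0. Uq f))"
        by (simp add: sum.distrib sum_distrib_left[symmetric] sum_distrib_right[symmetric] algebra_simps)
      also have "\<dots> \<le> 4 * (real (card (G h)) * SU) + 4 * (real (card (G h)) * SU)"
        using QG sumQ Uq0 by (intro add_mono mult_left_mono mult_mono sum_nonneg) auto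
      finally have "real (card (G h)) * (\<kappa>\<^sup>2 * c0\<^sup>2 * (real (card (G h)) * (norm g)\<^sup>2)) \<le> real (card (G h)) * (32 * SU)"
        by (simp add: power2_eq_square algebra_simps)
      then have "\<kappa>\<^sup>2 * c0\<^sup>2 * (real (card (G h)) * (norm g)\<^sup>2) \<le> 32 * SU" using cGpos by (simp add: mult_le_cancel_left_pos)
      then show ?thesis unfolding K2_def using \<kappa> J(3) by (simp add: pos_le_divide_eq mult.commute)
    qed
    define U where "U = (\<Sum>f\<in>G h. (norm (u f))\<^sup>2)"
    have U0: "U \<ge> 0" unfolding U_def by (intro sum_nonneg) auto
    define Gg where "Gg = h\<^sup>2 * (card (G h) * (norm g)\<^sup>2)"
    have SU: "SU \<le> C * En + C * (h\<^sup>2 * U) + Er"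
    proof -
      have "Uq f \<le> C * (e (P h f))\<^sup>2 + C * (h\<^sup>2 * (norm (u f))\<^sup>2) + (er f)\<^sup>2" if "f \<in> G h" for f
        using data P_in_S[OF h(1) that] unfolding macro_data_def Uq_def u_def by (simp add: algebra_simps)
      then have "SU \<le> (\<Sum>f\<in>G h. C * (e (P h f))\<^sup>2 + C * (h\<^sup>2 * (norm (u f))\<^sup>2) + (er f)\<^sup>2)"
        unfolding SU_def by (intro sum_mono)
      then show ?thesis by (simp add: sum.distrib sum_distrib_left En_def U_def Er_def)
    qed
    have U: "h\<^sup>2 * U \<le> 2 * Gg + K3 * En"
    proof -
      have "U \<le> (\<Sum>f\<in>G h. 2 * (norm g)\<^sup>2 + 2 * (norm (u f - g))\<^sup>2)"
        unfolding U_def by (intro sum_mono norm_sq_le_diff)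
      also have "\<dots> = 2 * (card (G h) * (norm g)\<^sup>2) + 2 * Wd"
        by (simp add: sum.distrib sum_distrib_left Wd_def)
      finally have "h\<^sup>2 * U \<le> h\<^sup>2 * (2 * (card (G h) * (norm g)\<^sup>2) + 2 * Wd)" by (intro mult_left_mono) auto
      also have "\<dots> = 2 * Gg + 2 * (h\<^sup>2 * Wd)" by (simp add: Gg_def algebra_simps)
      also have "\<dots> \<le> 2 * Gg + K3 * En" using hWd by (simp add: K3_def)
      finally show ?thesis .
    qed
    have "Gg \<le> h\<^sup>2 * (K2 * SU)" unfolding Gg_def using gs by (intro mult_left_mono) auto
    also have "\<dots> \<le> h\<^sup>2 * (K2 * (C * En + C * (h\<^sup>2 * U) + Er))" using SU K0 by (intro mult_left_mono) auto
    also have "\<dots> = K2 * (C * (h\<^sup>2 * En)) + K2 * C * h\<^sup>2 * (h\<^sup>2 * U) + K2 * (h\<^sup>2 * Er)" by (simp add: algebra_simps)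
    also have "\<dots> \<le> K2 * (C * (1 * En)) + K2 * C * h\<^sup>2 * (2 * Gg + K3 * En) + K2 * (K1 * En)"
      using K0 C h2 En U hEr by (intro add_mono mult_left_mono mult_right_mono) auto
    also have "\<dots> = 2 * (K2 * C * h\<^sup>2) * Gg + (K2 * C * En + K2 * C * h\<^sup>2 * (K3 * En) + K2 * (K1 * En))"
      by (simp add: algebra_simps)
    \<comment> \<open>The first term is now at most half of \<open>Gg\<close> and moves to the left
      side.\<close>
    also have "\<dots> \<le> 1 / 2 * Gg + (K2 * C * En + K2 * C * 1 * (K3 * En) + K2 * (K1 * En))"
      using hK K0 C En h2 by (intro add_mono mult_right_mono mult_left_mono) (auto simp: Gg_def)
    finally have Gg: "Gg \<le> 2 * K2 * (C + C * K3 + K1) * En" by (simp add: algebra_simps)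
    have "h\<^sup>2 * U \<le> K4 * En" using U Gg by (simp add: K4_def algebra_simps)
    also have "\<dots> \<le> K4 * (M0 * C * E)" using En K0 by (intro mult_left_mono) auto
    finally show "h\<^sup>2 * (\<Sum>f\<in>G h. (norm (W (P h f)))\<^sup>2) \<le> K4 * (M0 * C) * E"
      by (simp add: U_def u_def mult.assoc)
  qed
qed

end

section \<open>Global estimate on the surface\<close>

lemma chart_grid_exists:
  fixes S :: "'a::euclidean_space set"
  assumes "graph_chart S y0 \<nu> r \<rho> \<phi>" "y0 \<in> S"
  shows "\<exists>B. chart_grid S y0 \<nu> r \<rho> \<phi> B (real DIM('a))"
proof -
  have "subspace {t. \<nu> \<bullet> t = 0}" by (rule subspace_hyperplane)
  note orthonormal_basis_subspace[OF this]
  then obtain B where B: "B \<subseteq> {t. \<nu> \<bullet> t = 0}" "pairwise orthogonal B" "\<And>x. x \<in> B \<Longrightarrow> norm x = 1"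
      "independent B" "card B = dim {t. \<nu> \<bullet> t = 0}" "span B = {t. \<nu> \<bullet> t = 0}"
    by metis
  have "chart_grid S y0 \<nu> r \<rho> \<phi> B (real DIM('a))"
    by standard (use assms B independent_imp_finite dim_subset_UNIV in \<open>auto\<close>)
  then show ?thesis by blast
qed

text \<open>The points that are not good form a compact, relatively open subset of the surface. Near a point
  of maximal norm this subset would be a piece of a hyperplane, so the point is the midpoint of a
  segment in it, contradicting the strict convexity of the norm.\<close>

lemma all_points_good:
  fixes S :: "'a::euclidean_space set"
  assumes dim: "DIM('a) \<ge> 2" and S: "compact S" and charts: "\<And>y. y \<in> S \<Longrightarrow> \<exists>\<nu> r \<rho> \<phi>. graph_chart S y \<nu> r \<rho> \<phi>"
    and C: "C \<ge> 0" and c: "c \<ge> 0" and y: "y \<in> S"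
  shows "good_point S C c y"
proof (rule ccontr)
  assume ng: "\<not> good_point S C c y"
  define Bad where "Bad = {y \<in> S. \<not> good_point S C c y}"
  \<comment> \<open>Every point of the half ball inherits the constants of the full ball.\<close>
  have "openin (top_of_set S) {y \<in> S. good_point S C c y}"
    unfolding openin_contains_ball
  proof (intro conjI ballI)
    fix z assume "z \<in> {y \<in> S. good_point S C c y}"
    then obtain r K h1 where z: "z \<in> S" "r > 0" "h1 > 0" and
      K: "\<And>h X W val e E Y m. \<lbrakk>0 < h; h \<le> h1; macro_data S C c h X W val e E; finite Y; Y \<subseteq> S \<inter> ball z r;
      overlap_le h m Y\<rbrakk> \<Longrightarrow> h\<^sup>2 * (\<Sum>y\<in>Y. (norm (W y))\<^sup>2) \<le> real m * K * E"
      unfolding good_point_def by blast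
    have "good_point S C c z'" if "z' \<in> ball z (r / 2)" for z'
    proof -
      have "ball z' (r / 2) \<subseteq> ball z r" using that by (simp add: ball_subset_ball_iff dist_commute)
      then have sub: "S \<inter> ball z' (r / 2) \<subseteq> S \<inter> ball z r" by auto
      show ?thesis
        unfolding good_point_def
      proof (rule exI[of _ "r / 2"], intro conjI)
        show "\<exists>K. \<exists>h1>0. \<forall>h X W val e E Y m. 0 < h \<longrightarrow> h \<le> h1 \<longrightarrow> macro_data S C c h X W val e E \<longrightarrow> finite Y \<longrightarrow>
          Y \<subseteq> S \<inter> ball z' (r / 2) \<longrightarrow> overlap_le h m Y \<longrightarrow> h\<^sup>2 * (\<Sum>y\<in>Y. (norm (W y))\<^sup>2) \<le> real m * K * E"
          by (rule exI[of _ K], rule exI[of _ h1], intro conjI allI impI)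
            (use z in simp, rule K, assumption+, rule order_trans, assumption, rule sub, assumption)
      qed (use z in simp)
    qed
    then show "\<exists>e>0. ball z e \<inter> S \<subseteq> {y \<in> S. good_point S C c y}" using z(2) by (intro exI[of _ "r / 2"]) auto
  qed auto
  then have "closedin (top_of_set S) (S - {y \<in> S. good_point S C c y})" by (simp add: openin_closedin_eq)
  moreover have "S - {y \<in> S. good_point S C c y} = Bad" by (auto simp: Bad_def)
  ultimately have "compact Bad" using closedin_compact[OF S] by simp
  moreover have "Bad \<noteq> {}" using y ng by (auto simp: Bad_def)
  ultimately obtain x where x: "x \<in> Bad" "\<And>z. z \<in> Bad \<Longrightarrow> norm z \<le> norm x"
    using continuous_attains_sup[of Bad norm] continuous_on_norm_id by blast
  have xS: "x \<in> S" using x by (simp add: Bad_def)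
  obtain \<nu> r \<rho> \<phi> where ch: "graph_chart S x \<nu> r \<rho> \<phi>" using charts[OF xS] by blast
  obtain B where "chart_grid S x \<nu> r \<rho> \<phi> B (real DIM('a))" using chart_grid_exists[OF ch xS] by blast
  then interpret chart_grid S x \<nu> r \<rho> \<phi> B "real DIM('a)" .
  have nearBad: "z \<in> Bad" if "z \<in> S" "dist x z \<le> r1" for z
    using good_if_near_good[OF C that] x that by (auto simp: Bad_def)
  \<comment> \<open>Badness makes the surface flat: all points within \<open>r1\<close> of
    \<open>x\<close> lie in one hyperplane with normal \<open>m\<close>.\<close>
  obtain m where m: "m \<noteq> 0" "\<And>z. z \<in> S \<Longrightarrow> dist x z \<le> r1 \<Longrightarrow> m \<bullet> (z - x) = 0"
    using good_if_nonflat[OF C c] x by (auto simp: Bad_def)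
  have \<phi>0: "\<phi> 0 = x" by (rule graph_chart_zero[OF ch xS])
  have flat: "m \<bullet> (\<phi> t - x) = 0 \<and> \<phi> t \<in> Bad \<and> (\<exists>s. \<phi> t = x + t + s *\<^sub>R \<nu>)"
    if t: "\<nu> \<bullet> t = 0" "norm t \<le> r" "norm t \<le> r1 / 2" for t
  proof -
    have td: "t \<in> tangent_disc \<nu> r" "0 \<in> tangent_disc \<nu> r" using t r_pos by (auto simp: tangent_disc_def)
    then have "norm (\<phi> t - \<phi> 0) \<le> 2 * norm (t - 0)" "\<phi> t \<in> S" "\<exists>s. \<phi> t = x + t + s *\<^sub>R \<nu>"
      using ch unfolding graph_chart_def by blast+
    moreover then have "dist x (\<phi> t) \<le> r1" using t by (simp add: \<phi>0 dist_norm norm_minus_commute)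
    ultimately show ?thesis using m nearBad by blast
  qed
  define k where "k = min r (r1 / 2)"
  have k: "k > 0" using r_pos r1_pos by (simp add: k_def)
  have kk: "k \<le> r" "k \<le> r1 / 2" by (auto simp: k_def)
  have \<nu>1: "norm \<nu> = 1" using ch by (simp add: graph_chart_def)
  \<comment> \<open>If \<open>m\<close> were tangential, the point of the graph over a parameter in
    direction \<open>m\<close> would leave the hyperplane.\<close>
  have m\<nu>: "m \<bullet> \<nu> \<noteq> 0"
  proof
    assume *: "m \<bullet> \<nu> = 0"
    define t where "t = k *\<^sub>R sgn m"
    have "\<nu> \<bullet> t = 0" using * by (simp add: t_def sgn_div_norm inner_commute)
    moreover have "norm t = k" using k m by (simp add: t_def norm_sgn)
    ultimately obtain s where "m \<bullet> (\<phi> t - x) = 0" "\<phi> t = x + t + s *\<^sub>R \<nu>"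
      using flat[of t] kk by auto
    then have "m \<bullet> t = 0" using * by (simp add: inner_add_right)
    then show False using k m by (simp add: t_def sgn_div_norm)
  qed
  obtain t' where t': "t' \<noteq> 0" "\<nu> \<bullet> t' = 0"
    using orthogonal_to_vector_exists[OF dim, of \<nu>] by (auto simp: orthogonal_def)
  define t where "t = k *\<^sub>R sgn t'"
  have t: "\<nu> \<bullet> t = 0" "norm t = k" "t \<noteq> 0" using t' k by (auto simp: t_def sgn_div_norm)
  obtain s where s: "m \<bullet> (\<phi> t - x) = 0" "\<phi> t \<in> Bad" "\<phi> t = x + t + s *\<^sub>R \<nu>"
    using flat[of t] t kk by auto
  obtain s' where s': "m \<bullet> (\<phi> (-t) - x) = 0" "\<phi> (-t) \<in> Bad" "\<phi> (-t) = x + (-t) + s' *\<^sub>R \<nu>"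
    using flat[of "-t"] t kk by auto
  have "m \<bullet> t + s * (m \<bullet> \<nu>) = 0" "- (m \<bullet> t) + s' * (m \<bullet> \<nu>) = 0"
    using s(1,3) s'(1,3) by (simp_all add: inner_add_right inner_diff_right)
  \<comment> \<open>The points over \<open>t\<close> and \<open>-t\<close> lie in a hyperplane
    transversal to \<open>\<nu>\<close>, hence symmetrically about \<open>x\<close>.\<close>
  then have "(s + s') * (m \<bullet> \<nu>) = 0" by (simp add: algebra_simps)
  then have ss: "s' = - s" using m\<nu> by simp
  define w where "w = t + s *\<^sub>R \<nu>"
  have pm: "\<phi> t = x + w" "\<phi> (-t) = x - w" using s(3) s'(3) ss by (simp_all add: w_def)
  have "\<nu> \<bullet> w = s" using t \<nu>1 by (simp add: w_def inner_add_right dot_square_norm)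
  then have "w \<noteq> 0" using t by (auto simp: w_def)
  have "norm (x + w) \<le> norm x" "norm (x - w) \<le> norm x" using x(2) s(2) s'(2) pm by auto
  then have "(norm (x + w))\<^sup>2 \<le> (norm x)\<^sup>2" "(norm (x - w))\<^sup>2 \<le> (norm x)\<^sup>2" by (auto intro: power_mono)
  \<comment> \<open>The sum of the two inequalities, in which the mixed terms cancel.\<close>
  then have "2 * (w \<bullet> w) \<le> 0"
    by (simp add: power2_norm_eq_inner inner_add_left inner_add_right inner_diff_left inner_diff_right inner_commute)
  then show False using \<open>w \<noteq> 0\<close> inner_gt_zero_iff[of w] by linarith
qed

lemma sum_cover_le:
  fixes f :: "'a \<Rightarrow> real"
  assumes "finite T" "finite Y" "\<And>y. y \<in> Y \<Longrightarrow> f y \<ge> 0" and cov: "Y \<subseteq> (\<Union>z\<in>T. A z)"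
  shows "(\<Sum>y\<in>Y. f y) \<le> (\<Sum>z\<in>T. \<Sum>y\<in>Y \<inter> A z. f y)"
proof -
  have "(\<Sum>y\<in>Y. f y) \<le> (\<Sum>y\<in>Y. \<Sum>z\<in>T. if y \<in> A z then f y else 0)"
  proof (rule sum_mono)
    fix y assume y: "y \<in> Y"
    then obtain z where z: "z \<in> T" "y \<in> A z" using cov by blast
    have "(if y \<in> A z then f y else 0) \<le> (\<Sum>z\<in>T. if y \<in> A z then f y else 0)"
      using assms(1,3) y z by (intro member_le_sum) auto
    then show "f y \<le> (\<Sum>z\<in>T. if y \<in> A z then f y else 0)" using z by simp
  qed
  also have "\<dots> = (\<Sum>z\<in>T. \<Sum>y\<in>Y. if y \<in> A z then f y else 0)" by (rule sum.swap)
  also have "\<dots> = (\<Sum>z\<in>T. \<Sum>y\<in>Y \<inter> A z. f y)" using assms(2) by (simp add: sum.inter_restrict)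
  finally show ?thesis .
qed

text \<open>Finitely many good balls cover \<open>S\<close>. Their constants add up, in absolute
  value since goodness does not fix their sign.\<close>

theorem macro_estimate:
  fixes S :: "'a::euclidean_space set"
  assumes dim: "DIM('a) \<ge> 2" and S: "compact S" and charts: "\<And>y. y \<in> S \<Longrightarrow> \<exists>\<nu> r \<rho> \<phi>. graph_chart S y \<nu> r \<rho> \<phi>"
    and C: "C \<ge> 0" and c: "c \<ge> 0"
  shows "\<exists>h1>0. \<exists>K\<ge>0. \<forall>h X W val e E Y m. 0 < h \<longrightarrow> h \<le> h1 \<longrightarrow> macro_data S C c h X W val e E \<longrightarrow>
     finite Y \<longrightarrow> Y \<subseteq> S \<longrightarrow> overlap_le h m Y \<longrightarrow> h\<^sup>2 * (\<Sum>y\<in>Y. (norm (W y))\<^sup>2) \<le> real m * K * E"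
proof -
  let ?P = "\<lambda>y r K h1. \<forall>h X W val e E Y m.
     0 < h \<longrightarrow> h \<le> h1 \<longrightarrow> macro_data S C c h X W val e E \<longrightarrow> finite Y \<longrightarrow> Y \<subseteq> S \<inter> ball y r \<longrightarrow>
     overlap_le h m Y \<longrightarrow> h\<^sup>2 * (\<Sum>y\<in>Y. (norm (W y))\<^sup>2) \<le> real m * K * E"
  have "\<forall>y\<in>S. \<exists>p. fst p > 0 \<and> snd (snd p) > 0 \<and> ?P y (fst p) (fst (snd p)) (snd (snd p))"
  proof
    fix y assume "y \<in> S"
    then have "good_point S C c y" using all_points_good[OF dim S charts C c] by blast
    then obtain r K h1 where "r > 0" "h1 > 0" "?P y r K h1" unfolding good_point_def by blast
    then show "\<exists>p. fst p > 0 \<and> snd (snd p) > 0 \<and> ?P y (fst p) (fst (snd p)) (snd (snd p))"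
      by (intro exI[of _ "(r, K, h1)"]) simp
  qed
  from bchoice[OF this] obtain p where
    p: "\<forall>y\<in>S. fst (p y) > 0 \<and> snd (snd (p y)) > 0 \<and> ?P y (fst (p y)) (fst (snd (p y))) (snd (snd (p y)))" by (rule exE)
  define r K h' where "r y = fst (p y)" and "K y = fst (snd (p y))" and "h' y = snd (snd (p y))" for y
  have pos: "r y > 0" "h' y > 0" if "y \<in> S" for y using p that by (auto simp: r_def h'_def)
  have PK: "?P y (r y) (K y) (h' y)" if "y \<in> S" for y using p that unfolding r_def h'_def K_def by simp
  have "S \<subseteq> (\<Union>y\<in>S. ball y (r y))"
  proof
    fix x assume "x \<in> S"
    then show "x \<in> (\<Union>y\<in>S. ball y (r y))" using pos(1)[of x] by (intro UN_I[of x]) auto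
  qed
  then obtain T where T: "T \<subseteq> S" "finite T" "S \<subseteq> (\<Union>y\<in>T. ball y (r y))"
    by (rule compactE_image[OF S open_ball])
  define h1 where "h1 = Min (insert 1 (h' ` T))"
  have h1: "h1 > 0" using T pos by (auto simp: h1_def)
  have h1le: "h1 \<le> h' y" if "y \<in> T" for y unfolding h1_def using T that by (intro Min_le) auto
  show ?thesis
  proof (rule exI[of _ h1], rule conjI[OF h1], rule exI[of _ "\<Sum>y\<in>T. \<bar>K y\<bar>"], intro conjI allI impI)
    show "0 \<le> (\<Sum>y\<in>T. \<bar>K y\<bar>)" by (intro sum_nonneg) auto
    fix h X W val e E Y m
    assume h: "0 < h" "h \<le> h1" and data: "macro_data S C c h X W val e E" and Y: "finite Y" "Y \<subseteq> S" and ov: "overlap_le h m Y"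
    have E0: "E \<ge> 0" using data by (simp add: macro_data_def)
    have "h\<^sup>2 * (\<Sum>y\<in>Y \<inter> ball z (r z). (norm (W y))\<^sup>2) \<le> real m * \<bar>K z\<bar> * E" if z: "z \<in> T" for z
    proof -
      have "overlap_le h m (Y \<inter> ball z (r z))"
        unfolding overlap_le_def
      proof
        fix x
        have "card (Y \<inter> ball z (r z) \<inter> cball x (10 * h)) \<le> card (Y \<inter> cball x (10 * h))"
          using Y by (intro card_mono) auto
        then show "card (Y \<inter> ball z (r z) \<inter> cball x (10 * h)) \<le> m" using ov[unfolded overlap_le_def, rule_format, of x] by linarith
      qed
      then have "h\<^sup>2 * (\<Sum>y\<in>Y \<inter> ball z (r z). (norm (W y))\<^sup>2) \<le> real m * K z * E"
        using T(1) z h h1le[OF z] Y by (intro PK[rule_format, OF _ h(1) _ data]) auto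
      also have "\<dots> \<le> real m * \<bar>K z\<bar> * E" using E0 by (intro mult_right_mono mult_left_mono) auto
      finally show ?thesis .
    qed
    then have "(\<Sum>z\<in>T. h\<^sup>2 * (\<Sum>y\<in>Y \<inter> ball z (r z). (norm (W y))\<^sup>2)) \<le> (\<Sum>z\<in>T. real m * \<bar>K z\<bar> * E)" by (rule sum_mono)
    moreover have "(\<Sum>y\<in>Y. (norm (W y))\<^sup>2) \<le> (\<Sum>z\<in>T. \<Sum>y\<in>Y \<inter> ball z (r z). (norm (W y))\<^sup>2)"
    proof -
      show ?thesis using Y T by (intro sum_cover_le) auto
    qed
    then have "h\<^sup>2 * (\<Sum>y\<in>Y. (norm (W y))\<^sup>2) \<le> h\<^sup>2 * (\<Sum>z\<in>T. \<Sum>y\<in>Y \<inter> ball z (r z). (norm (W y))\<^sup>2)"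
      by (intro mult_left_mono) auto
    ultimately show "h\<^sup>2 * (\<Sum>y\<in>Y. (norm (W y))\<^sup>2) \<le> real m * (\<Sum>y\<in>T. \<bar>K y\<bar>) * E"
      by (simp add: sum_distrib_left sum_distrib_right)
  qed
qed

section \<open>Facet connectivity of simplicial meshes\<close>

definition facet_adjacent :: "'a::euclidean_space set \<Rightarrow> 'a set \<Rightarrow> bool" where
  "facet_adjacent K K' \<longleftrightarrow> K \<noteq> K' \<and> (K \<inter> K') facet_of K \<and> (K \<inter> K') facet_of K'"

text \<open>A segment of \<open>K\<close> crossing the hyperplane would have an interior point in
  \<open>F\<close>, since a face is cut out of \<open>K\<close> by its affine hull; the face
  property would then put the endpoints into the hyperplane.\<close>

lemma convex_halfspace_of_facet:
  fixes F K :: "'a::euclidean_space set"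
  assumes K: "convex K" and F: "F face_of K" and hull: "affine hull F = {x. n \<bullet> x = \<alpha>}"
  shows "(\<forall>x\<in>K. \<alpha> \<le> n \<bullet> x) \<or> (\<forall>x\<in>K. n \<bullet> x \<le> \<alpha>)"
proof (rule ccontr)
  assume "\<not> ?thesis"
  then obtain a b where ab: "a \<in> K" "b \<in> K" "n \<bullet> a < \<alpha>" "\<alpha> < n \<bullet> b" by (auto simp: not_le)
  define u where "u = (\<alpha> - n \<bullet> a) / (n \<bullet> b - n \<bullet> a)"
  have u: "0 < u" "u < 1" using ab by (auto simp: u_def field_simps)
  define p where "p = (1 - u) *\<^sub>R a + u *\<^sub>R b"
  have "n \<bullet> p = n \<bullet> a + u * (n \<bullet> b - n \<bullet> a)" by (simp add: p_def inner_add_right algebra_simps)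
  also have "\<dots> = \<alpha>" using ab by (simp add: u_def)
  finally have "p \<in> affine hull F" using hull by simp
  moreover have "p \<in> K" unfolding p_def using ab u K by (simp add: convexD_alt)
  moreover have "F = affine hull F \<inter> K" using face_of_imp_eq_affine_Int[OF K F] .
  ultimately have pF: "p \<in> F" by blast
  have "a \<noteq> b" using ab by auto
  then have "p \<in> open_segment a b" using u by (auto simp: p_def in_segment)
  then have "a \<in> F" using F pF ab unfolding face_of_def by blast
  then have "n \<bullet> a = \<alpha>" using hull hull_inc[of a F affine] by auto
  then show False using ab by simp
qed

locale simplicial_mesh =
  fixes \<K> :: "'a::euclidean_space set set"
  assumes fin: "finite \<K>" and simplex: "\<And>K. K \<in> \<K> \<Longrightarrow> int DIM('a) simplex K"
    and face: "\<And>K K'. K \<in> \<K> \<Longrightarrow> K' \<in> \<K> \<Longrightarrow> (K \<inter> K') face_of K"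
begin

lemma conv: "K \<in> \<K> \<Longrightarrow> convex K" and comp: "K \<in> \<K> \<Longrightarrow> compact K" and clo: "K \<in> \<K> \<Longrightarrow> closed K"
  using simplex convex_simplex compact_simplex closed_simplex by blast+

lemma dim: "K \<in> \<K> \<Longrightarrow> aff_dim K = int DIM('a)"
  using simplex aff_dim_simplex by blast

lemma int_ne: "K \<in> \<K> \<Longrightarrow> interior K \<noteq> {}"
proof -
  assume K: "K \<in> \<K>"
  have "affine hull K = UNIV" using dim[OF K] by (simp add: aff_dim_eq_full)
  then have "rel_interior K = interior K" by (rule rel_interior_interior)
  moreover have "K \<noteq> {}" using dim[OF K] by (metis aff_dim_empty of_nat_0_le_iff neg_0_le_iff_le not_one_le_zero)
  ultimately show ?thesis using rel_interior_eq_empty[OF conv[OF K]] by simp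
qed

text \<open>A proper face of a convex set has smaller dimension.\<close>

lemma full_dim_eq:
  assumes "K \<in> \<K>" "K' \<in> \<K>" "aff_dim (K \<inter> K') = int DIM('a)"
  shows "K = K'"
proof -
  have "K \<inter> K' = K" if "K \<in> \<K>" "K' \<in> \<K>" "aff_dim (K \<inter> K') = int DIM('a)" for K K'
    using face_of_aff_dim_lt[OF conv[OF that(1)] face[OF that(1,2)]] dim[OF that(1)] that(3) by force
  from this[of K K'] this[of K' K] show ?thesis using assms by (simp add: Int_commute)
qed

lemma int_dim_less: "K \<in> \<K> \<Longrightarrow> K' \<in> \<K> \<Longrightarrow> K \<noteq> K' \<Longrightarrow> aff_dim (K \<inter> K') \<le> int DIM('a) - 1"
  using full_dim_eq aff_dim_le_DIM[of "K \<inter> K'"] by fastforce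

lemma interior_Int_eq:
  assumes "K \<in> \<K>" "K' \<in> \<K>" "interior K \<inter> K' \<noteq> {}"
  shows "K = K'"
proof -
  have "K \<inter> K' = K" using face_of_disjoint_interior[OF face[OF assms(1,2)]] assms(3) interior_subset[of K] by blast
  then show ?thesis using full_dim_eq[OF assms(1,2)] dim[OF assms(1)] by simp
qed

lemma adjacentI:
  assumes "K \<in> \<K>" "K' \<in> \<K>" "K \<noteq> K'" "aff_dim (K \<inter> K') \<ge> int DIM('a) - 1" "K \<inter> K' \<noteq> {}"
  shows "facet_adjacent K K'"
  using assms int_dim_less[OF assms(1-3)] face[OF assms(1,2)] face[OF assms(2,1)] dim[OF assms(1)] dim[OF assms(2)]
  by (simp add: facet_adjacent_def facet_of_def Int_commute)

text \<open>A segment in general position avoids all intersections of codimension at least two.\<close>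

lemma star_connected:
  assumes x: "x \<in> interior (\<Union>\<K>)" and K: "K \<in> \<K>" "x \<in> K" and K': "K' \<in> \<K>" "x \<in> K'"
  shows "(K, K') \<in> {(A, B). A \<in> \<K> \<and> B \<in> \<K> \<and> x \<in> A \<and> x \<in> B \<and> facet_adjacent A B}\<^sup>*"
proof (rule ccontr)
  let ?R = "{(A, B). A \<in> \<K> \<and> B \<in> \<K> \<and> x \<in> A \<and> x \<in> B \<and> facet_adjacent A B}"
  assume no: "(K, K') \<notin> ?R\<^sup>*"
  define \<S> where "\<S> = {L \<in> \<K>. x \<in> L}"
  define \<C> where "\<C> = {L \<in> \<S>. (K, L) \<in> ?R\<^sup>*}"
  have fS: "finite \<S>" using fin by (simp add: \<S>_def)
  have "closed (\<Union>(\<K> - \<S>))" using fin clo by (intro closed_Union) auto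
  then have "open (interior (\<Union>\<K>) - \<Union>(\<K> - \<S>))" by (intro open_Diff) auto
  moreover have "x \<in> interior (\<Union>\<K>) - \<Union>(\<K> - \<S>)" using x by (auto simp: \<S>_def)
  ultimately obtain e where e: "e > 0" "ball x e \<subseteq> interior (\<Union>\<K>) - \<Union>(\<K> - \<S>)"
    by (meson open_contains_ball)
  have eS: "ball x e \<subseteq> \<Union>\<S>" using e(2) interior_subset[of "\<Union>\<K>"] by blast
  have meets: "interior L \<inter> ball x e \<noteq> {}" if "L \<in> \<K>" "x \<in> L" for L
  proof -
    have "x \<in> closure (interior L)"
      using that convex_closure_interior[OF conv[OF that(1)] int_ne[OF that(1)]] closure_subset by blast
    then obtain y where "y \<in> interior L" "dist y x < e" using e(1) by (auto simp: closure_approachable)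
    then show ?thesis by (auto simp: dist_commute)
  qed
  obtain a where a: "a \<in> interior K" "a \<in> ball x e" using meets[OF K] by blast
  \<comment> \<open>Together with \<open>a\<close>, an intersection of codimension at least two
    spans an affine set of dimension at most \<open>DIM('a) - 1\<close>, a null set. A segment from
    \<open>a\<close> to a point \<open>b\<close> outside of \<open>Z\<close> meets such
    intersections at most in \<open>a\<close>.\<close>
  define Z where "Z = (\<Union>(A, B)\<in>{(A, B). A \<in> \<S> \<and> B \<in> \<S> \<and> aff_dim (A \<inter> B) \<le> int DIM('a) - 2}. affine hull (insert a (A \<inter> B)))"
  have "negligible Z"
    unfolding Z_def
  proof (rule negligible_Union)
    have "{(A, B). A \<in> \<S> \<and> B \<in> \<S> \<and> aff_dim (A \<inter> B) \<le> int DIM('a) - 2} \<subseteq> \<S> \<times> \<S>" by auto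
    then show "finite ((\<lambda>(A, B). affine hull (insert a (A \<inter> B))) ` {(A, B). A \<in> \<S> \<and> B \<in> \<S> \<and> aff_dim (A \<inter> B) \<le> int DIM('a) - 2})"
      using fS finite_subset by blast
    fix H assume "H \<in> (\<lambda>(A, B). affine hull (insert a (A \<inter> B))) ` {(A, B). A \<in> \<S> \<and> B \<in> \<S> \<and> aff_dim (A \<inter> B) \<le> int DIM('a) - 2}"
    then obtain A B where p: "H = affine hull (insert a (A \<inter> B))" "aff_dim (A \<inter> B) \<le> int DIM('a) - 2" by auto
    then have "aff_dim (affine hull (insert a (A \<inter> B))) < int DIM('a)" by (simp add: aff_dim_insert)
    then obtain n b where "n \<noteq> 0" "affine hull (insert a (A \<inter> B)) \<subseteq> {x. n \<bullet> x = b}"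
      by (rule aff_lowdim_subset_hyperplane)
    then show "negligible H"
      using negligible_subset[OF negligible_hyperplane[of n b]] p by auto
  qed
  have "interior K' \<inter> ball x e - Z \<noteq> {}"
  proof
    assume "interior K' \<inter> ball x e - Z = {}"
    then have "negligible (interior K' \<inter> ball x e)" using negligible_subset[OF \<open>negligible Z\<close>] by blast
    then show False using open_not_negligible[of "interior K' \<inter> ball x e"] meets[OF K'] by auto
  qed
  then obtain b where b: "b \<in> interior K'" "b \<in> ball x e" "b \<notin> Z" by blast
  have seg: "closed_segment a b \<subseteq> \<Union>\<S>" using a b eS closed_segment_subset[of a "ball x e" b] by auto
  have KC: "K \<in> \<C>" using K by (auto simp: \<C>_def \<S>_def)
  have K'C: "K' \<in> \<S> - \<C>" using K' no by (auto simp: \<C>_def \<S>_def)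
  have "\<C> \<subseteq> \<S>" by (auto simp: \<C>_def)
  have "\<Union>\<C> \<inter> \<Union>(\<S> - \<C>) \<inter> closed_segment a b \<noteq> {}"
  proof
    assume "\<Union>\<C> \<inter> \<Union>(\<S> - \<C>) \<inter> closed_segment a b = {}"
    moreover have "closed_segment a b \<subseteq> \<Union>\<C> \<union> \<Union>(\<S> - \<C>)" using seg \<open>\<C> \<subseteq> \<S>\<close> by blast
    moreover have "closed (\<Union>\<C>)" "closed (\<Union>(\<S> - \<C>))"
      using fS clo finite_subset[OF \<open>\<C> \<subseteq> \<S>\<close>] by (auto intro!: closed_Union simp: \<C>_def \<S>_def)
    ultimately have "\<Union>\<C> \<inter> closed_segment a b = {} \<or> \<Union>(\<S> - \<C>) \<inter> closed_segment a b = {}"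
      by (intro connected_closedD) auto
    then show False using KC K'C a(1) b(1) interior_subset by (meson disjoint_iff UnionI ends_in_segment subsetD)
  qed
  then obtain z L1 L2 where z: "z \<in> closed_segment a b" "z \<in> L1" "z \<in> L2" and L: "L1 \<in> \<C>" "L2 \<in> \<S> - \<C>" by blast
  have L': "L1 \<in> \<K>" "L2 \<in> \<K>" "x \<in> L1" "x \<in> L2" "L1 \<noteq> L2" "(K, L1) \<in> ?R\<^sup>*"
    using L by (auto simp: \<C>_def \<S>_def)
  have "aff_dim (L1 \<inter> L2) \<le> int DIM('a) - 2"
  proof (rule ccontr)
    assume "\<not> ?thesis"
    then have "facet_adjacent L1 L2" using z L' by (intro adjacentI) auto
    then have "(L1, L2) \<in> ?R" using L' by auto
    then have "(K, L2) \<in> ?R\<^sup>*" using L'(6) by (rule rtrancl_into_rtrancl[rotated])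
    then show False using L by (auto simp: \<C>_def)
  qed
  then have hZ: "affine hull (insert a (L1 \<inter> L2)) \<subseteq> Z" using L \<open>\<C> \<subseteq> \<S>\<close> unfolding Z_def by blast
  show False
  proof (cases "z = a")
    case True
    then have "K = L2" using interior_Int_eq[OF K(1) L'(2)] a z by blast
    then show False using L KC by simp
  next
    case False
    obtain u where u: "z = (1 - u) *\<^sub>R a + u *\<^sub>R b" "0 \<le> u" using z(1) by (auto simp: in_segment)
    then have "u \<noteq> 0" using False by auto
    \<comment> \<open>The point \<open>b\<close> lies on the line through \<open>a\<close> and
      \<open>z\<close>, which is contained in \<open>Z\<close>.\<close>
    have "b = (1 - 1 / u) *\<^sub>R a + (1 / u) *\<^sub>R z"
      using \<open>u \<noteq> 0\<close> by (simp add: u(1) algebra_simps)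
    moreover have "a \<in> affine hull (insert a (L1 \<inter> L2))" "z \<in> affine hull (insert a (L1 \<inter> L2))"
      using z by (auto intro: hull_inc)
    ultimately have "b \<in> affine hull (insert a (L1 \<inter> L2))"
      using mem_affine[OF affine_affine_hull, of a _ z "1 - 1 / u" "1 / u"] by auto
    then show False using hZ b by blast
  qed
qed

text \<open>Elements reached and elements not reached cover \<open>\<Gamma>\<close> by two closed
  sets, so connectedness gives a common point on \<open>\<Gamma>\<close>. There
  \<open>star_connected\<close> continues the chain through elements that contain this point and
  therefore meet \<open>\<Gamma>\<close>.\<close>

lemma connected_chain:
  assumes \<Gamma>: "connected \<Gamma>" "\<Gamma> \<subseteq> interior (\<Union>\<K>)" and K: "K \<in> \<K>" "K \<inter> \<Gamma> \<noteq> {}" and K': "K' \<in> \<K>" "K' \<inter> \<Gamma> \<noteq> {}"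
  shows "(K, K') \<in> {(A, B). A \<in> \<K> \<and> B \<in> \<K> \<and> A \<inter> \<Gamma> \<noteq> {} \<and> B \<inter> \<Gamma> \<noteq> {} \<and> facet_adjacent A B}\<^sup>*"
proof (rule ccontr)
  let ?R = "{(A, B). A \<in> \<K> \<and> B \<in> \<K> \<and> A \<inter> \<Gamma> \<noteq> {} \<and> B \<inter> \<Gamma> \<noteq> {} \<and> facet_adjacent A B}"
  assume no: "(K, K') \<notin> ?R\<^sup>*"
  define \<S> where "\<S> = {L \<in> \<K>. L \<inter> \<Gamma> \<noteq> {}}"
  define \<C> where "\<C> = {L \<in> \<S>. (K, L) \<in> ?R\<^sup>*}"
  have fS: "finite \<S>" using fin by (simp add: \<S>_def)
  have CS: "\<C> \<subseteq> \<S>" by (auto simp: \<C>_def)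
  have "\<Union>\<C> \<inter> \<Union>(\<S> - \<C>) \<inter> \<Gamma> \<noteq> {}"
  proof
    assume "\<Union>\<C> \<inter> \<Union>(\<S> - \<C>) \<inter> \<Gamma> = {}"
    moreover have "\<Gamma> \<subseteq> \<Union>\<C> \<union> \<Union>(\<S> - \<C>)"
    proof
      fix x assume "x \<in> \<Gamma>"
      moreover then obtain L where "L \<in> \<K>" "x \<in> L" using \<Gamma>(2) interior_subset[of "\<Union>\<K>"] by blast
      ultimately show "x \<in> \<Union>\<C> \<union> \<Union>(\<S> - \<C>)" by (auto simp: \<S>_def)
    qed
    moreover have "closed (\<Union>\<C>)" "closed (\<Union>(\<S> - \<C>))"
      using fS clo finite_subset[OF CS] by (auto intro!: closed_Union simp: \<C>_def \<S>_def)
    ultimately have "\<Union>\<C> \<inter> \<Gamma> = {} \<or> \<Union>(\<S> - \<C>) \<inter> \<Gamma> = {}" by (intro connected_closedD[OF \<Gamma>(1)]) auto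
    moreover have "K \<in> \<C>" "K' \<in> \<S> - \<C>" using K K' no by (auto simp: \<C>_def \<S>_def)
    ultimately show False using K(2) K'(2) by blast
  qed
  then obtain x L1 L2 where x: "x \<in> \<Gamma>" "x \<in> L1" "x \<in> L2" and L: "L1 \<in> \<C>" "L2 \<in> \<S> - \<C>" by blast
  have "(L1, L2) \<in> {(A, B). A \<in> \<K> \<and> B \<in> \<K> \<and> x \<in> A \<and> x \<in> B \<and> facet_adjacent A B}\<^sup>*"
    using x L \<Gamma>(2) by (intro star_connected) (auto simp: \<C>_def \<S>_def)
  then have "(L1, L2) \<in> ?R\<^sup>*" by (rule rtrancl_mono[THEN subsetD, rotated]) (use x in auto)
  moreover have "(K, L1) \<in> ?R\<^sup>*" using L by (auto simp: \<C>_def)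
  ultimately have "(K, L2) \<in> ?R\<^sup>*" by (rule rtrancl_trans[rotated])
  then show False using L by (auto simp: \<C>_def)
qed

text \<open>From a relative interior point of \<open>F\<close>, a sufficiently short move into
  \<open>K2\<close> also stays in \<open>K1\<close>. The intersection then contains \<open>F\<close>
  and a point off its hyperplane, so it has full dimension.\<close>

lemma same_side_eq:
  assumes K: "K1 \<in> \<K>" "K2 \<in> \<K>" and F: "F face_of K1" "F \<subseteq> K2" and hull: "affine hull F = {x. n \<bullet> x = \<alpha>}" and n: "n \<noteq> 0"
    and side: "\<And>x. x \<in> K1 \<Longrightarrow> \<alpha> \<le> n \<bullet> x" "\<And>x. x \<in> K2 \<Longrightarrow> \<alpha> \<le> n \<bullet> x"
  shows "K1 = K2"
proof -
  have off: "\<exists>a\<in>L. n \<bullet> a > \<alpha>" if "L \<in> \<K>" "\<And>x. x \<in> L \<Longrightarrow> \<alpha> \<le> n \<bullet> x" for L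
  proof (rule ccontr)
    assume "\<not> ?thesis"
    then have "L \<subseteq> {x. n \<bullet> x = \<alpha>}" using that(2) by (force simp: not_less)
    then have "aff_dim L \<le> aff_dim {x. n \<bullet> x = \<alpha>}" by (rule aff_dim_subset)
    then show False using dim[OF that(1)] n by simp
  qed
  obtain a1 where a1: "a1 \<in> K1" "n \<bullet> a1 > \<alpha>" using off[OF K(1) side(1)] by blast
  obtain a2 where a2: "a2 \<in> K2" "n \<bullet> a2 > \<alpha>" using off[OF K(2) side(2)] by blast
  have "F \<noteq> {}"
  proof
    assume "F = {}"
    then have "aff_dim {x. n \<bullet> x = \<alpha>} = -1" using hull by (metis affine_hull_empty aff_dim_empty)
    then show False using n by simp
  qed
  then obtain f0 where f0: "f0 \<in> rel_interior F"
    using rel_interior_eq_empty[OF face_of_imp_convex[OF F(1)]] conv[OF K(1)] by blast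
  then obtain e where e: "e > 0" "ball f0 e \<inter> affine hull F \<subseteq> F" and f0F: "f0 \<in> F"
    by (auto simp: mem_rel_interior_ball)
  have nf0: "n \<bullet> f0 = \<alpha>" using f0F hull hull_inc[of f0 F affine] by auto
  \<comment> \<open>\<open>l\<close> matches the heights of \<open>a1\<close> and \<open>a2\<close>
    over the hyperplane, so that \<open>w\<close> is tangential. Below, \<open>\<epsilon>\<close>
    keeps \<open>f\<close> inside \<open>F\<close> and the weight \<open>\<epsilon> * l\<close> of
    \<open>a1\<close> at most 1/2.\<close>
  define l where "l = (n \<bullet> a2 - \<alpha>) / (n \<bullet> a1 - \<alpha>)"
  have l: "l > 0" using a1 a2 by (simp add: l_def)
  define w where "w = (a2 - f0) - l *\<^sub>R (a1 - f0)"
  have nw: "n \<bullet> w = 0" using a1 by (simp add: w_def inner_diff_right nf0 l_def)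
  define \<epsilon> where "\<epsilon> = min (min 1 (1 / (2 * l))) (e / (2 * (norm w + 1)))"
  have nwp: "norm w + 1 > 0" using norm_ge_zero[of w] by linarith
  have \<epsilon>: "0 < \<epsilon>" "\<epsilon> \<le> 1" "\<epsilon> * l \<le> 1 / 2" "2 * \<epsilon> * norm w < e"
  proof -
    show "0 < \<epsilon>" "\<epsilon> \<le> 1" using l e nwp by (auto simp: \<epsilon>_def)
    have "\<epsilon> \<le> 1 / (2 * l)" by (simp add: \<epsilon>_def)
    then show "\<epsilon> * l \<le> 1 / 2" using l by (simp add: field_simps)
    have "\<epsilon> \<le> e / (2 * (norm w + 1))" by (simp add: \<epsilon>_def)
    then have "2 * \<epsilon> * (norm w + 1) \<le> e" using nwp by (simp add: pos_le_divide_eq mult.commute mult.left_commute)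
    then show "2 * \<epsilon> * norm w < e" using \<open>0 < \<epsilon>\<close> by (simp add: algebra_simps)
  qed
  define f where "f = f0 + (\<epsilon> / (1 - \<epsilon> * l)) *\<^sub>R w"
  have q: "0 < 1 - \<epsilon> * l" "\<epsilon> / (1 - \<epsilon> * l) \<le> 2 * \<epsilon>" "0 \<le> \<epsilon> / (1 - \<epsilon> * l)"
    using \<epsilon> by (auto simp: field_simps)
  have "f \<in> F"
  proof -
    have "n \<bullet> f = \<alpha>" by (simp add: f_def inner_add_right nw nf0)
    moreover have "dist f0 f < e"
    proof -
      have "dist f f0 = \<epsilon> / (1 - \<epsilon> * l) * norm w" using abs_of_nonneg[OF q(3)] by (simp only: f_def dist_norm add_diff_cancel_left' norm_scaleR)
      also have "\<dots> \<le> 2 * \<epsilon> * norm w" using q(2) by (intro mult_right_mono) auto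
      finally show ?thesis using \<epsilon>(4) dist_commute[of f f0] by linarith
    qed
    ultimately show ?thesis using e(2) hull by auto
  qed
  define z where "z = f0 + \<epsilon> *\<^sub>R (a2 - f0)"
  have "(1 - \<epsilon> * l) *\<^sub>R f = (1 - \<epsilon> * l) *\<^sub>R f0 + \<epsilon> *\<^sub>R w"
    using q(1) by (simp add: f_def scaleR_add_right)
  then have "z = (1 - \<epsilon> * l) *\<^sub>R f + (\<epsilon> * l) *\<^sub>R a1"
    by (simp add: z_def w_def algebra_simps)
  moreover have "f \<in> K1" using \<open>f \<in> F\<close> face_of_imp_subset[OF F(1)] by blast
  ultimately have z1: "z \<in> K1" using conv[OF K(1)] a1(1) \<epsilon> l q(1)
    by (simp add: convexD_alt)
  have "z = (1 - \<epsilon>) *\<^sub>R f0 + \<epsilon> *\<^sub>R a2" by (simp add: z_def algebra_simps)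
  then have z2: "z \<in> K2" using conv[OF K(2)] a2(1) \<epsilon> f0F F(2) by (auto simp: convexD_alt)
  have "n \<bullet> z = \<alpha> + \<epsilon> * (n \<bullet> a2 - \<alpha>)" by (simp add: z_def inner_add_right inner_diff_right nf0)
  then have "z \<notin> affine hull F" using hull a2 \<epsilon>(1) by simp
  then have "aff_dim (insert z F) = aff_dim F + 1" by (simp add: aff_dim_insert)
  also have "aff_dim F = int DIM('a) - 1" using hull n aff_dim_affine_hull[of F] aff_dim_hyperplane[OF n, of \<alpha>] by simp
  finally have "aff_dim (insert z F) = int DIM('a)" by simp
  moreover have "insert z F \<subseteq> K1 \<inter> K2" using z1 z2 F face_of_imp_subset[OF F(1)] by blast
  ultimately have "aff_dim (K1 \<inter> K2) = int DIM('a)" using aff_dim_subset[of "insert z F" "K1 \<inter> K2"] aff_dim_le_DIM[of "K1 \<inter> K2"] by simp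
  then show ?thesis using full_dim_eq[OF K] by blast
qed

end

section \<open>Normal jumps of piecewise linear functions\<close>

lemma facet_affine_hull:
  fixes F K :: "'a::euclidean_space set"
  assumes "F facet_of K" "aff_dim K = int DIM('a)" "unit_normal_to F n"
  shows "\<exists>\<alpha>. affine hull F = {x. n \<bullet> x = \<alpha>}"
proof -
  obtain f0 where f0: "f0 \<in> F" using assms(1) by (auto simp: facet_of_def)
  have n: "n \<noteq> 0" using assms(3) by (intro notI) (simp add: unit_normal_to_def)
  let ?H = "{x. n \<bullet> x = n \<bullet> f0}"
  have "F \<subseteq> ?H"
  proof
    fix x assume "x \<in> F"
    then have "n \<bullet> (x - f0) = 0" using assms(3) f0 unfolding unit_normal_to_def by blast
    then show "x \<in> ?H" by (simp add: inner_diff_right)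
  qed
  moreover have "aff_dim F = aff_dim ?H" using assms(1,2) n by (simp add: facet_of_def)
  ultimately have "affine hull F = affine hull ?H" by (simp add: aff_dim_eq_full_gen)
  also have "\<dots> = ?H" by (simp add: affine_hyperplane hull_same)
  finally show ?thesis by blast
qed

text \<open>A linear form that is constant on a facet is a multiple of the normal: a short move from
  a relative interior point along its tangential part stays in \<open>F\<close>.\<close>

lemma affine_agree_on_facet:
  fixes F :: "'a::euclidean_space set"
  assumes hull: "affine hull F = {x. n \<bullet> x = \<alpha>}" and F: "convex F" "F \<noteq> {}" and n: "norm n = 1"
    and eq: "\<And>x y. x \<in> F \<Longrightarrow> y \<in> F \<Longrightarrow> g \<bullet> (x - y) = 0"
  shows "norm g = \<bar>n \<bullet> g\<bar>"
proof -
  obtain f0 where "f0 \<in> rel_interior F" using rel_interior_eq_empty[OF F(1)] F(2) by blast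
  then obtain e where e: "e > 0" "ball f0 e \<inter> affine hull F \<subseteq> F" and f0: "f0 \<in> F"
    by (auto simp: mem_rel_interior_ball)
  define z where "z = g - (n \<bullet> g) *\<^sub>R n"
  have nn: "n \<bullet> n = 1" using n by (simp add: dot_square_norm)
  have nz: "n \<bullet> z = 0" using nn by (simp add: z_def inner_diff_right)
  define k where "k = e / (2 * (norm z + 1))"
  have zp: "norm z + 1 > 0" using norm_ge_zero[of z] by linarith
  have k: "k > 0" using e zp by (simp add: k_def)
  have "e / (2 * y) * y = e / 2" if "y > 0" for y using that by simp
  from this[OF zp] have "k * (norm z + 1) = e / 2" by (simp add: k_def)
  then have "k * norm z < e" using k e by (simp add: algebra_simps)
  then have "f0 + k *\<^sub>R z \<in> ball f0 e" using k by (simp add: dist_norm)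
  moreover have "n \<bullet> (f0 + k *\<^sub>R z) = \<alpha>" using f0 hull hull_inc[of f0 F affine] nz by (auto simp: inner_add_right)
  ultimately have "f0 + k *\<^sub>R z \<in> F" using e(2) hull by auto
  then have "g \<bullet> (k *\<^sub>R z) = 0" using eq[OF _ f0, of "f0 + k *\<^sub>R z"] by simp
  then have gz: "g \<bullet> z = 0" using k by simp
  have "z \<bullet> z = 0"
  proof -
    have "z \<bullet> z = g \<bullet> z - (n \<bullet> g) * (n \<bullet> z)" by (simp add: z_def[of ] inner_diff_left)
    then show ?thesis using gz nz by simp
  qed
  then have "g = (n \<bullet> g) *\<^sub>R n" by (simp add: z_def)
  then have "norm g = \<bar>n \<bullet> g\<bar> * norm n" by (metis norm_scaleR)
  then show ?thesis using n by simp
qed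

text \<open>In a finite relation reachability needs at most \<open>card R\<close> steps.\<close>

lemma chain_difference_bound:
  fixes u :: "'c \<Rightarrow> 'b::real_normed_vector" and m :: real
  assumes R: "finite R" and chain: "(a, b) \<in> R\<^sup>*" and step: "\<And>x y. (x, y) \<in> R \<Longrightarrow> norm (u x - u y) \<le> m" and m: "m \<ge> 0"
  shows "norm (u a - u b) \<le> card R * m"
proof -
  obtain n where n: "n \<le> card R" "(a, b) \<in> R ^^ n" using chain rtrancl_finite_eq_relpow[OF R] by auto
  have "norm (u a - u b) \<le> n * m" if "(a, b) \<in> R ^^ n" for n b
    using that
  proof (induction n arbitrary: b)
    case (Suc n)
    then obtain y where y: "(a, y) \<in> R ^^ n" "(y, b) \<in> R" by auto
    have "norm (u a - u b) \<le> norm (u a - u y) + norm (u y - u b)"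
      using norm_triangle_ineq[of "u a - u y" "u y - u b"] by simp
    also have "\<dots> \<le> n * m + m" using Suc.IH[OF y(1)] step[OF y(2)] by linarith
    finally show ?case by (simp add: algebra_simps)
  qed simp
  from this[OF n(2)] have "norm (u a - u b) \<le> n * m" .
  also have "\<dots> \<le> card R * m" using n(1) m by (intro mult_right_mono) auto
  finally show ?thesis .
qed

text \<open>The affine extension of \<open>v\<close> from \<open>K\<close> to the whole space, by
  which pieces from different elements can be compared at one point.\<close>

definition elem_affine :: "'a::euclidean_space set \<Rightarrow> ('a \<Rightarrow> real) \<Rightarrow> 'a \<Rightarrow> real" where
  "elem_affine K v z = elem_grad K v \<bullet> z + (SOME b. \<forall>x\<in>K. v x = elem_grad K v \<bullet> x + b)"

context simplicial_mesh
begin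

text \<open>The description in \<open>elem_grad\<close> needs uniqueness: two candidate gradients
  would disagree along their difference inside a ball contained in \<open>K\<close>.\<close>

lemma elem_grad_eq:
  assumes v: "v \<in> P1_space \<K>" and K: "K \<in> \<K>"
  shows "\<exists>b. \<forall>x\<in>K. v x = elem_grad K v \<bullet> x + b"
proof -
  obtain g b where g: "\<forall>x\<in>K. v x = g \<bullet> x + b" using v K unfolding P1_space_def by blast
  have "\<exists>!g. \<exists>b. \<forall>x\<in>K. v x = g \<bullet> x + b"
  proof (rule ex1I[of _ g])
    show "\<exists>b. \<forall>x\<in>K. v x = g \<bullet> x + b" using g by blast
    fix g' assume "\<exists>b. \<forall>x\<in>K. v x = g' \<bullet> x + b"
    then obtain b' where g': "\<forall>x\<in>K. v x = g' \<bullet> x + b'" by blast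
    obtain p where "p \<in> interior K" using int_ne[OF K] by blast
    then obtain e where e: "e > 0" "cball p e \<subseteq> K" by (meson mem_interior_cball)
    define z where "z = p + e *\<^sub>R sgn (g' - g)"
    have "z \<in> cball p e" using e by (simp add: z_def dist_norm norm_sgn)
    then have "z \<in> K" "p \<in> K" using e by auto
    then have "g \<bullet> z + b = g' \<bullet> z + b'" "g \<bullet> p + b = g' \<bullet> p + b'" using g g' by metis+
    then have "(g' - g) \<bullet> z = (g' - g) \<bullet> p" unfolding inner_diff_left by linarith
    then have "e * ((g' - g) \<bullet> sgn (g' - g)) = 0" by (simp add: z_def inner_add_right)
    then have "(g' - g) \<bullet> sgn (g' - g) = 0" using e by simp
    then have "norm (g' - g) = 0"
      by (simp add: sgn_div_norm dot_square_norm power2_eq_square)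
    then show "g' = g" by simp
  qed
  then show ?thesis unfolding elem_grad_def by (rule theI')
qed

lemma elem_affine_eq:
  assumes "v \<in> P1_space \<K>" "K \<in> \<K>" "x \<in> K"
  shows "elem_affine K v x = v x"
  using bspec[OF someI_ex[OF elem_grad_eq[OF assms(1,2)]] assms(3)] by (simp only: elem_affine_def)

lemma elem_affine_diff: "elem_affine K v z - elem_affine K v z' = elem_grad K v \<bullet> (z - z')"
  by (simp add: elem_affine_def inner_diff_right)

text \<open>\<open>side_elem\<close> refers to the submesh \<open>\<C>\<close>; by
  \<open>same_side_eq\<close> its description picks \<open>A\<close> and, for the opposite normal,
  \<open>A'\<close>. The tangential parts of both gradients agree because \<open>v\<close> has one
  value at each point of \<open>F\<close>.\<close>

lemma normal_jump_aux:
  assumes v: "v \<in> P1_space \<K>" and C: "\<C> \<subseteq> \<K>" "A \<in> \<C>" "A' \<in> \<C>" and adj: "facet_adjacent A A'"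
    and F: "F = A \<inter> A'" and n: "unit_normal_to F n"
    and hull: "affine hull F = {x. n \<bullet> x = \<alpha>}" and side: "\<And>x. x \<in> A \<Longrightarrow> \<alpha> \<le> n \<bullet> x" "\<And>x. x \<in> A' \<Longrightarrow> n \<bullet> x \<le> \<alpha>"
  shows "norm (elem_grad A v - elem_grad A' v) = \<bar>normal_jump \<C> F n v\<bar>"
proof -
  have A: "A \<in> \<K>" "A' \<in> \<K>" using C by auto
  have fac: "F face_of A" "F face_of A'" "F \<noteq> {}" "F \<subseteq> A" "F \<subseteq> A'"
    using adj F by (auto simp: facet_adjacent_def facet_of_def)
  have n1: "norm n = 1" using n by (simp add: unit_normal_to_def)
  then have n0: "n \<noteq> 0" by (intro notI) simp
  have F\<alpha>: "n \<bullet> y = \<alpha>" if "y \<in> F" for y using that hull hull_inc[of y F affine] by auto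
  have hull': "affine hull F = {x. (- n) \<bullet> x = - \<alpha>}" using hull by simp
  have s1: "side_elem \<C> F n = A"
    unfolding side_elem_def
  proof (rule the_equality)
    show "A \<in> \<C> \<and> F \<subseteq> A \<and> (\<forall>x\<in>A. \<forall>y\<in>F. 0 \<le> n \<bullet> (x - y))"
      using C fac side(1) F\<alpha> by (simp add: inner_diff_right)
    fix L assume L: "L \<in> \<C> \<and> F \<subseteq> L \<and> (\<forall>x\<in>L. \<forall>y\<in>F. 0 \<le> n \<bullet> (x - y))"
    have "\<alpha> \<le> n \<bullet> x" if "x \<in> L" for x
    proof -
      obtain y where "y \<in> F" using fac by blast
      then show ?thesis using L that F\<alpha>[of y] by (force simp: inner_diff_right)
    qed
    then have "A = L" using L C fac side(1) n0 by (intro same_side_eq[of A L F n \<alpha>] hull) auto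
    then show "L = A" by simp
  qed
  have s2: "side_elem \<C> F (- n) = A'"
    unfolding side_elem_def
  proof (rule the_equality)
    show "A' \<in> \<C> \<and> F \<subseteq> A' \<and> (\<forall>x\<in>A'. \<forall>y\<in>F. 0 \<le> (- n) \<bullet> (x - y))"
      using C fac side(2) F\<alpha> by (simp add: inner_diff_right)
    fix L assume L: "L \<in> \<C> \<and> F \<subseteq> L \<and> (\<forall>x\<in>L. \<forall>y\<in>F. 0 \<le> (- n) \<bullet> (x - y))"
    have "- \<alpha> \<le> (- n) \<bullet> x" if "x \<in> L" for x
    proof -
      obtain y where "y \<in> F" using fac by blast
      then show ?thesis using L that F\<alpha>[of y] by (force simp: inner_diff_right)
    qed
    then have "A' = L" using L C fac side(2) n0 by (intro same_side_eq[of A' L F "- n" "- \<alpha>"] hull') auto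
    then show "L = A'" by simp
  qed
  have "norm (elem_grad A v - elem_grad A' v) = \<bar>n \<bullet> (elem_grad A v - elem_grad A' v)\<bar>"
  proof (rule affine_agree_on_facet[OF hull _ fac(3) n1])
    show "convex F" using face_of_imp_convex[OF fac(1)] conv[OF A(1)] by simp
    fix x y assume "x \<in> F" "y \<in> F"
    then have xy: "x \<in> A" "y \<in> A" "x \<in> A'" "y \<in> A'" using F by auto
    have "elem_grad A v \<bullet> (x - y) = v x - v y" "elem_grad A' v \<bullet> (x - y) = v x - v y"
      using elem_affine_diff[of A v x y] elem_affine_diff[of A' v x y] elem_affine_eq[OF v] A xy by auto
    then show "(elem_grad A v - elem_grad A' v) \<bullet> (x - y) = 0" by (simp add: inner_diff_left)
  qed
  then show ?thesis by (simp add: normal_jump_def s1 s2 inner_diff_right)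
qed

text \<open>The normal may point into either element; the absolute value removes the
  orientation.\<close>

lemma normal_jump_eq:
  assumes v: "v \<in> P1_space \<K>" and C: "\<C> \<subseteq> \<K>" "K \<in> \<C>" "K' \<in> \<C>" and adj: "facet_adjacent K K'"
    and n: "unit_normal_to (K \<inter> K') n"
  shows "norm (elem_grad K v - elem_grad K' v) = \<bar>normal_jump \<C> (K \<inter> K') n v\<bar>"
proof -
  let ?F = "K \<inter> K'"
  have K: "K \<in> \<K>" "K' \<in> \<K>" "K \<noteq> K'" using C adj by (auto simp: facet_adjacent_def)
  have fac: "?F facet_of K" "?F facet_of K'" using adj by (auto simp: facet_adjacent_def)
  have n1: "n \<noteq> 0" using n by (intro notI) (simp add: unit_normal_to_def)
  obtain \<alpha> where hull: "affine hull ?F = {x. n \<bullet> x = \<alpha>}" using facet_affine_hull[OF fac(1) dim[OF K(1)] n] by blast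
  have hull': "affine hull ?F = {x. (- n) \<bullet> x = - \<alpha>}" using hull by simp
  have h1: "(\<forall>x\<in>K. \<alpha> \<le> n \<bullet> x) \<or> (\<forall>x\<in>K. n \<bullet> x \<le> \<alpha>)"
    using convex_halfspace_of_facet[OF conv[OF K(1)] facet_of_imp_face_of[OF fac(1)] hull] .
  have h2: "(\<forall>x\<in>K'. \<alpha> \<le> n \<bullet> x) \<or> (\<forall>x\<in>K'. n \<bullet> x \<le> \<alpha>)"
    using convex_halfspace_of_facet[OF conv[OF K(2)] facet_of_imp_face_of[OF fac(2)] hull] .
  have x1: "\<not> ((\<forall>x\<in>K. \<alpha> \<le> n \<bullet> x) \<and> (\<forall>x\<in>K'. \<alpha> \<le> n \<bullet> x))"
    using same_side_eq[OF K(1,2) facet_of_imp_face_of[OF fac(1)] _ hull n1] K(3) by auto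
  have x2: "\<not> ((\<forall>x\<in>K. n \<bullet> x \<le> \<alpha>) \<and> (\<forall>x\<in>K'. n \<bullet> x \<le> \<alpha>))"
    using same_side_eq[OF K(1,2) facet_of_imp_face_of[OF fac(1)] _ hull'] n1 K(3) by auto
  consider "\<forall>x\<in>K. \<alpha> \<le> n \<bullet> x" "\<forall>x\<in>K'. n \<bullet> x \<le> \<alpha>" | "\<forall>x\<in>K'. \<alpha> \<le> n \<bullet> x" "\<forall>x\<in>K. n \<bullet> x \<le> \<alpha>"
    using h1 h2 x1 x2 by blast
  then show ?thesis
  proof cases
    case 1 then show ?thesis using normal_jump_aux[OF v C adj refl n hull] by blast
  next
    case 2
    have adj': "facet_adjacent K' K" using adj by (auto simp: facet_adjacent_def Int_commute)
    show ?thesis using normal_jump_aux[OF v C(1,3,2) adj', of ?F n \<alpha>] 2 n hull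
      by (simp add: Int_commute norm_minus_commute)
  qed
qed

text \<open>The two affine pieces agree at \<open>z0\<close>, so their difference is linear in the
  offset from it.\<close>

lemma elem_affine_jump:
  assumes v: "v \<in> P1_space \<K>" and K: "K \<in> \<K>" "K' \<in> \<K>" and z0: "z0 \<in> K \<inter> K'"
  shows "\<bar>elem_affine K v z - elem_affine K' v z\<bar> \<le> norm (elem_grad K v - elem_grad K' v) * norm (z - z0)"
proof -
  have "elem_affine K v z - elem_affine K' v z = (elem_grad K v - elem_grad K' v) \<bullet> (z - z0)"
    using elem_affine_diff[of K v z z0] elem_affine_diff[of K' v z z0] elem_affine_eq[OF v K(1), of z0] elem_affine_eq[OF v K(2), of z0] z0
    by (simp add: inner_diff_left)
  then show ?thesis using Cauchy_Schwarz_ineq2 by simp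
qed

end

section \<open>Element counts and facet measures in quasi-uniform meshes\<close>

locale regular_mesh = simplicial_mesh \<K> for \<K> :: "'a::euclidean_space set set" +
  fixes \<sigma> q h :: real
  assumes sr: "shape_regular \<sigma> \<K>" and qu: "quasi_uniform q h \<K>" and h: "h > 0" and ne: "\<K> \<noteq> {}" and dim2: "DIM('a) \<ge> 2"
begin

text \<open>One element and a positive \<open>h\<close> force both signs.\<close>

lemma q_sigma_pos: "q > 0" "\<sigma> > 0"
proof -
  obtain K where K: "K \<in> \<K>" using ne by blast
  have "h \<le> q * diameter K" using qu K by (simp add: quasi_uniform_def)
  moreover have d0: "diameter K \<ge> 0" using comp[OF K] compact_imp_bounded diameter_ge_0 by blast
  ultimately show "q > 0" using h by (smt (verit) mult_nonpos_nonneg)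
  have "diameter K > 0" using \<open>h \<le> q * diameter K\<close> h d0 by (cases "diameter K = 0") auto
  moreover obtain r where "0 < r" "diameter K \<le> \<sigma> * r" using sr K by (auto simp: shape_regular_def)
  ultimately show "\<sigma> > 0" by (smt (verit) mult_nonpos_nonneg)
qed

lemma inner_ball:
  assumes K: "K \<in> \<K>"
  shows "\<exists>x. cball x (h / (q * \<sigma>)) \<subseteq> K"
proof -
  obtain x r where x: "cball x r \<subseteq> K" "0 < r" "diameter K \<le> \<sigma> * r" using sr K by (auto simp: shape_regular_def)
  have "h \<le> q * diameter K" using qu K by (simp add: quasi_uniform_def)
  also have "\<dots> \<le> q * (\<sigma> * r)" using x q_sigma_pos by (intro mult_left_mono) auto
  finally have "h / (q * \<sigma>) \<le> r" using q_sigma_pos by (simp add: pos_divide_le_eq mult_ac)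
  then show ?thesis using x(1) subset_cball by blast
qed

lemma diam_le: "K \<in> \<K> \<Longrightarrow> x \<in> K \<Longrightarrow> y \<in> K \<Longrightarrow> dist x y \<le> h"
  using diameter_bounded_bound[OF compact_imp_bounded[OF comp], of K x y] qu by (force simp: quasi_uniform_def)

text \<open>The elements contain disjoint balls of radius \<open>h / (q * \<sigma>)\<close>, all
  inside the ball of radius \<open>(R + 1) * h\<close> about \<open>z\<close>.\<close>

lemma card_near_le:
  assumes R: "R \<ge> 0"
  shows "real (card {K \<in> \<K>. K \<inter> cball z (R * h) \<noteq> {}}) \<le> ((R + 1) * (q * \<sigma>)) ^ DIM('a)"
proof -
  let ?I = "{K \<in> \<K>. K \<inter> cball z (R * h) \<noteq> {}}"
  let ?r = "h / (q * \<sigma>)"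
  have r: "?r > 0" using h q_sigma_pos by simp
  obtain x where x: "\<And>K. K \<in> \<K> \<Longrightarrow> cball (x K) ?r \<subseteq> K" using inner_ball by metis
  have bK: "ball (x K) ?r \<subseteq> interior K" if "K \<in> \<K>" for K
    using x[OF that] ball_subset_cball by (intro interior_maximal) auto
  have "real (card ?I) * ?r ^ DIM('a) \<le> ((R + 1) * h) ^ DIM('a)"
  proof (rule ball_packing[where c=x and p=z])
    show "finite ?I" using fin by simp
    show "disjoint_family_on (\<lambda>K. ball (x K) ?r) ?I"
      unfolding disjoint_family_on_def
    proof (intro ballI impI)
      fix K L assume KL: "K \<in> ?I" "L \<in> ?I" "K \<noteq> L"
      have "interior K \<inter> L = {}" using interior_Int_eq[of K L] KL by blast
      then show "ball (x K) ?r \<inter> ball (x L) ?r = {}" using bK[of K] bK[of L] interior_subset[of L] KL by blast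
    qed
    fix K assume K: "K \<in> ?I"
    then obtain y where y: "y \<in> K" "dist z y \<le> R * h" by auto
    show "ball (x K) ?r \<subseteq> cball z ((R + 1) * h)"
    proof
      fix w assume "w \<in> ball (x K) ?r"
      then have "w \<in> K" using bK[of K] interior_subset[of K] K by blast
      then have "dist y w \<le> h" using diam_le y K by auto
      then show "w \<in> cball z ((R + 1) * h)" using y dist_triangle[of z w y] by (simp add: algebra_simps)
    qed
  qed (use r R h in auto)
  then have "real (card ?I) \<le> ((R + 1) * h) ^ DIM('a) / ?r ^ DIM('a)" using r by (simp add: pos_le_divide_eq)
  also have "\<dots> = ((R + 1) * (q * \<sigma>)) ^ DIM('a)"
    using h q_sigma_pos by (simp add: power_divide[symmetric])
  finally show ?thesis .
qed

text \<open>An element is the cone over its facet with the opposite vertex as apex. Contracting the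
  facet to the apex sweeps out the element and with it an inscribed ball, so the facet has measure
  at least of order \<open>h ^ (DIM('a) - 1)\<close>.\<close>

lemma facet_measure:
  assumes K: "K \<in> \<K>" and F: "F facet_of K"
  shows "F \<in> sets borel" "emeasure surface_measure F < top"
    "unit_ball_vol (real DIM('a)) * (h / (q * \<sigma>)) ^ DIM('a) \<le> sweep_const DIM('a) * h * measure surface_measure F"
proof -
  have s1: "DIM('a) - 1 \<ge> 1" using dim2 by simp
  have FK: "F \<subseteq> K" using F by (rule facet_of_imp_subset)
  have "closed F" using face_of_imp_closed[OF conv[OF K] clo[OF K] facet_of_imp_face_of[OF F]] .
  then show FB: "F \<in> sets borel" by simp
  have em: "emeasure surface_measure F = hausdorff_outer (DIM('a) - 1) F"
    by (rule emeasure_hausdorff_measure[OF s1 FB])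
  have "aff_dim F < int DIM('a)" using F dim[OF K] by (simp add: facet_of_def)
  then obtain a b where ab: "a \<noteq> 0" "F \<subseteq> {x. a \<bullet> x = b}" by (rule aff_lowdim_subset_hyperplane)
  have "bounded F" using FK comp[OF K] compact_imp_bounded bounded_subset by blast
  then show fin: "emeasure surface_measure F < top"
    unfolding em using hausdorff_outer_hyperplane_finite[OF dim2 _ ab] by simp
  obtain C where C: "\<not> affine_dependent C" "K = convex hull C" using simplex[OF K] by (auto simp: simplex_def)
  obtain u where u: "u \<in> C" "F = convex hull (C - {u})"
    using F C facet_of_convex_hull_affine_independent[OF C(1), of F] by auto
  have uK: "u \<in> K" using u C hull_inc by auto
  have Cne: "C - {u} \<noteq> {}" using F u by (auto simp: facet_of_def)
  have Kseg: "K \<subseteq> {(1 - s) *\<^sub>R f + s *\<^sub>R u |f s. f \<in> F \<and> s \<in> {0..1}}"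
  proof
    fix x assume "x \<in> K"
    then have "x \<in> convex hull (insert u (C - {u}))" using C u by (simp add: insert_absorb)
    then obtain s t f where s: "0 \<le> s" "0 \<le> t" "s + t = 1" "f \<in> F" "x = s *\<^sub>R u + t *\<^sub>R f"
      using convex_hull_insert[OF Cne, of u] u by auto
    then have "t = 1 - s" by simp
    then have "x = (1 - s) *\<^sub>R f + s *\<^sub>R u" "s \<in> {0..1}" using s by simp_all
    then show "x \<in> {(1 - s) *\<^sub>R f + s *\<^sub>R u |f s. f \<in> F \<and> s \<in> {0..1}}" using s by blast
  qed
  have sw: "emeasure lborel K \<le> ennreal (sweep_const DIM('a) * h) * hausdorff_outer (DIM('a) - 1) F"
  proof (rule sweep_volume[OF dim2 h _ Kseg])
    show "K \<in> sets lborel" using clo[OF K] by simp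
    fix a a' :: 'a and s :: real assume s: "s \<in> {0..1}"
    have "((1 - s) *\<^sub>R a + s *\<^sub>R u) - ((1 - s) *\<^sub>R a' + s *\<^sub>R u) = (1 - s) *\<^sub>R (a - a')" by (simp add: algebra_simps)
    then show "norm (((1 - s) *\<^sub>R a + s *\<^sub>R u) - ((1 - s) *\<^sub>R a' + s *\<^sub>R u)) \<le> norm (a - a')"
      using s by (simp add: mult_left_le_one_le)
  next
    fix a s s' assume a: "a \<in> F"
    have "((1 - s) *\<^sub>R a + s *\<^sub>R u) - ((1 - s') *\<^sub>R a + s' *\<^sub>R u) = (s - s') *\<^sub>R (u - a)" by (simp add: algebra_simps)
    then have "norm (((1 - s) *\<^sub>R a + s *\<^sub>R u) - ((1 - s') *\<^sub>R a + s' *\<^sub>R u)) = dist u a * \<bar>s - s'\<bar>"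
      by (simp add: dist_norm)
    also have "\<dots> \<le> h * \<bar>s - s'\<bar>" using diam_le[OF K uK, of a] a FK by (intro mult_right_mono) auto
    finally show "norm (((1 - s) *\<^sub>R a + s *\<^sub>R u) - ((1 - s') *\<^sub>R a + s' *\<^sub>R u)) \<le> h * \<bar>s - s'\<bar>" .
  qed
  obtain x where x: "cball x (h / (q * \<sigma>)) \<subseteq> K" using inner_ball[OF K] by blast
  have "ennreal (unit_ball_vol (real DIM('a)) * (h / (q * \<sigma>)) ^ DIM('a)) = emeasure lborel (cball x (h / (q * \<sigma>)))"
    using h q_sigma_pos by (simp add: emeasure_cball)
  also have "\<dots> \<le> emeasure lborel K" using x clo[OF K] by (intro emeasure_mono) auto
  also have "\<dots> \<le> ennreal (sweep_const DIM('a) * h) * emeasure surface_measure F" using sw em by simp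
  also have "\<dots> = ennreal (sweep_const DIM('a) * h) * ennreal (measure surface_measure F)"
    using fin by (simp add: emeasure_eq_ennreal_measure less_top)
  also have "\<dots> = ennreal (sweep_const DIM('a) * h * measure surface_measure F)"
    using h sweep_const_pos[of "DIM('a)"] by (simp add: ennreal_mult)
  finally show "unit_ball_vol (real DIM('a)) * (h / (q * \<sigma>)) ^ DIM('a) \<le> sweep_const DIM('a) * h * measure surface_measure F"
    using h sweep_const_pos[of "DIM('a)"] by (subst (asm) ennreal_le_iff) auto
qed

end

section \<open>The perturbed surface\<close>

text \<open>By Brouwer's theorem the projection of the perturbed surface to the tangent plane covers a disc.\<close>

lemma perturbed_surface_measure_lower:
  fixes S :: "'a::euclidean_space set"
  assumes dim2: "DIM('a) \<ge> 2" and S: "compact S"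
    and charts: "\<And>y. y \<in> S \<Longrightarrow> \<exists>\<nu> r \<rho> \<phi>. graph_chart S y \<nu> r \<rho> \<phi>" and c: "c \<ge> 0"
  shows "\<exists>h1>0. \<forall>z\<in>S. \<forall>h. 0 < h \<and> h \<le> h1 \<longrightarrow>
    (\<forall>X. continuous_on S X \<longrightarrow> (\<forall>y\<in>S. norm (X y - y) \<le> c * h\<^sup>2) \<longrightarrow>
      ennreal (unit_ball_vol (real DIM('a)) * (h / 32) ^ DIM('a))
        \<le> ennreal (sweep_const DIM('a) * (2 * h)) * hausdorff_outer (DIM('a) - 1) (X ` S \<inter> cball (X z) h))"
proof (rule compact_uniform_scale[OF S])
  fix y0 assume y0: "y0 \<in> S"
  then obtain \<nu> r \<rho> \<phi> where ch: "graph_chart S y0 \<nu> r \<rho> \<phi>" using charts by blast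
  have \<nu>: "norm \<nu> = 1" "\<nu> \<bullet> \<nu> = 1" and r: "r > 0" and \<rho>: "\<rho> > 0" using ch by (auto simp: graph_chart_def dot_square_norm)
  define Pr where "Pr x = x - (\<nu> \<bullet> x) *\<^sub>R \<nu>" for x
  have Pr_orth: "\<nu> \<bullet> Pr x = 0" for x by (simp add: Pr_def inner_diff_right \<nu>)
  have Pr_diff: "Pr (x - y) = Pr x - Pr y" for x y
    by (simp add: Pr_def inner_diff_right algebra_simps)
  have Pr_le: "norm (Pr x) \<le> norm x" for x
  proof -
    have "(norm x)\<^sup>2 = (norm (Pr x))\<^sup>2 + (\<nu> \<bullet> x)\<^sup>2"
      unfolding power2_norm_eq_inner Pr_def
      by (simp add: inner_diff_left inner_diff_right \<nu> inner_commute power2_eq_square)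
    then have "(norm (Pr x))\<^sup>2 \<le> (norm x)\<^sup>2" using zero_le_power2[of "\<nu> \<bullet> x"] by linarith
    then show ?thesis by (rule power2_le_imp_le) simp
  qed
  define r0 where "r0 = min (min \<rho> (r / 2)) (1 / (32 * (c + 1)))"
  have r0: "r0 > 0" using r \<rho> c by (simp add: r0_def)
  show "\<exists>r>0. \<forall>z\<in>S \<inter> ball y0 r. \<forall>h. 0 < h \<and> h \<le> r \<longrightarrow>
    (\<forall>X. continuous_on S X \<longrightarrow> (\<forall>y\<in>S. norm (X y - y) \<le> c * h\<^sup>2) \<longrightarrow>
      ennreal (unit_ball_vol (real DIM('a)) * (h / 32) ^ DIM('a))
        \<le> ennreal (sweep_const DIM('a) * (2 * h)) * hausdorff_outer (DIM('a) - 1) (X ` S \<inter> cball (X z) h))"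
  proof (rule exI[of _ r0], intro conjI ballI allI impI)
    fix z h X
    assume z: "z \<in> S \<inter> ball y0 r0" and "0 < h \<and> h \<le> r0" and X: "continuous_on S X" and "\<forall>y\<in>S. norm (X y - y) \<le> c * h\<^sup>2"
    then have h: "0 < h" "h \<le> r0" and Xc: "\<And>y. y \<in> S \<Longrightarrow> norm (X y - y) \<le> c * h\<^sup>2" by auto
    have hs: "h \<le> \<rho>" "h \<le> r / 2" "h \<le> 1 / (32 * (c + 1))" using h by (auto simp: r0_def)
    have ch2: "c * h\<^sup>2 \<le> h / 32"
    proof -
      have "32 * (c + 1) * h \<le> 1" using hs(3) c by (simp add: pos_le_divide_eq mult.commute)
      then have "c * h \<le> 1 / 32" using h(1) by (simp add: algebra_simps)
      then have "c * h * h \<le> 1 / 32 * h" using h by (intro mult_right_mono) auto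
      then show ?thesis by (simp add: power2_eq_square mult.assoc)
    qed
    have Xh: "norm (X y - y) \<le> h / 32" if "y \<in> S" for y using Xc[OF that] ch2 by linarith
    have "dist y0 z \<le> \<rho>" "dist y0 z \<le> r / 2" using z by (auto simp: r0_def)
    then obtain t0 where t0: "t0 \<in> tangent_disc \<nu> r" "norm t0 \<le> r / 2" "z = \<phi> t0"
      using graph_chart_image_small[OF ch _ y0, of z "r / 2"] z by blast
    \<comment> \<open>The radius \<open>h / 8\<close> exceeds the sum of \<open>h / 16\<close>, the
      bound for the distance of the target \<open>\<zeta>\<close> from \<open>t0\<close>, and
      \<open>h / 32\<close>, the bound for the deviation of \<open>f\<close> from the
      identity.\<close>
    define E where "E = {t. \<nu> \<bullet> t = 0} \<inter> cball t0 (h / 8)"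
    have t0E: "t0 \<in> E" using t0 h by (simp add: E_def tangent_disc_def)
    have Esub: "E \<subseteq> tangent_disc \<nu> r"
    proof
      fix t assume t: "t \<in> E"
      have "norm t \<le> norm t0 + norm (t - t0)" using norm_triangle_ineq[of t0 "t - t0"] by simp
      then show "t \<in> tangent_disc \<nu> r" using t t0 h hs by (auto simp: E_def tangent_disc_def dist_norm norm_minus_commute)
    qed
    have \<phi>S: "\<phi> t \<in> S" if "t \<in> E" for t using ch Esub that unfolding graph_chart_def by blast
    define f where "f t = Pr (X (\<phi> t) - y0)" for t
    have Pr\<phi>: "Pr (\<phi> t - y0) = t" if t: "t \<in> E" for t
    proof -
      obtain s where s: "\<phi> t = y0 + t + s *\<^sub>R \<nu>" using ch Esub t unfolding graph_chart_def by blast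
      have "\<nu> \<bullet> t = 0" using t by (simp add: E_def)
      then show ?thesis by (simp add: s Pr_def inner_add_right \<nu> algebra_simps)
    qed
    have ft: "norm (f t - t) \<le> h / 32" if t: "t \<in> E" for t
    proof -
      have "f t - t = Pr (X (\<phi> t) - \<phi> t)" using Pr\<phi>[OF t] unfolding f_def Pr_diff by (simp add: algebra_simps)
      then show ?thesis using Pr_le[of "X (\<phi> t) - \<phi> t"] Xh[OF \<phi>S[OF t]] by simp
    qed
    have contf: "continuous_on E f"
      unfolding f_def Pr_def
      by (intro continuous_intros continuous_on_compose2[OF X] continuous_on_subset[OF graph_chart_continuous[OF ch] Esub])
        (use \<phi>S in auto)
    \<comment> \<open>Translation along the normal through heights from \<open>- h\<close> to
      \<open>h\<close>, which sweeps a piece of the discrete surface over a small ball around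
      \<open>X z\<close>.\<close>
    let ?\<Psi> = "\<lambda>a s. a + ((2 * s - 1) * h) *\<^sub>R \<nu>"
    have cover: "cball (X z) (h / 32) \<subseteq> {?\<Psi> a s |a s. a \<in> X ` S \<inter> cball (X z) h \<and> s \<in> {0..1}}"
    proof
      fix w assume w: "w \<in> cball (X z) (h / 32)"
      define \<zeta> where "\<zeta> = Pr (w - y0)"
      have \<zeta>0: "norm (\<zeta> - t0) \<le> h / 16"
      proof -
        have "\<zeta> - t0 = Pr (w - X z) + (f t0 - t0)" unfolding \<zeta>_def f_def t0(3) Pr_diff by simp
        then have "norm (\<zeta> - t0) \<le> norm (Pr (w - X z)) + norm (f t0 - t0)" by (simp only: norm_triangle_ineq)
        moreover have "norm (Pr (w - X z)) \<le> h / 32" using Pr_le[of "w - X z"] w by (simp add: dist_norm norm_minus_commute)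
        ultimately show ?thesis using ft[OF t0E] by simp
      qed
      \<comment> \<open>A fixed point of \<open>T\<close> solves
        \<open>f t = \<zeta>\<close>.\<close>
      define T where "T t = t - f t + \<zeta>" for t
      obtain t where t: "t \<in> E" "T t = t"
      proof (rule brouwer[of E T])
        show "compact E" unfolding E_def by (intro closed_Int_compact closed_hyperplane) auto
        show "convex E" unfolding E_def by (intro convex_Int convex_hyperplane) auto
        show "E \<noteq> {}" using t0E by blast
        show "continuous_on E T" unfolding T_def by (intro continuous_intros contf)
        show "T \<in> E \<rightarrow> E"
        proof
          fix t assume t: "t \<in> E"
          have "T t - t0 = (\<zeta> - t0) - (f t - t)" by (simp add: T_def)
          then have "norm (T t - t0) \<le> norm (\<zeta> - t0) + norm (f t - t)" by (simp only: norm_triangle_ineq4)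
          then have "norm (T t - t0) \<le> h / 8" using \<zeta>0 ft[OF t] h by linarith
          moreover have "\<nu> \<bullet> T t = 0" using t by (simp add: T_def f_def \<zeta>_def inner_add_right inner_diff_right Pr_orth E_def)
          ultimately show "T t \<in> E" by (simp add: E_def dist_norm norm_minus_commute)
        qed
      qed
      have "f t = \<zeta>" using t(2) by (simp add: T_def)
      then have P0: "Pr (w - X (\<phi> t)) = 0" unfolding f_def \<zeta>_def Pr_diff by simp
      define s where "s = \<nu> \<bullet> (w - X (\<phi> t))"
      have ws: "w = X (\<phi> t) + s *\<^sub>R \<nu>" using P0 unfolding Pr_def s_def by (simp add: algebra_simps)
      have "norm (\<phi> t - \<phi> t0) \<le> 2 * norm (t - t0)" using ch Esub t(1) t0(1) unfolding graph_chart_def by blast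
      moreover have "norm (t - t0) \<le> h / 8" using t(1) by (simp add: E_def dist_norm norm_minus_commute)
      moreover have "X (\<phi> t) - X z = (X (\<phi> t) - \<phi> t) + (\<phi> t - \<phi> t0) - (X z - z)" using t0(3) by simp
      moreover have "norm (X (\<phi> t) - \<phi> t) \<le> h / 32" "norm (X z - z) \<le> h / 32" using Xh \<phi>S t(1) z by auto
      ultimately have Xd: "norm (X (\<phi> t) - X z) \<le> h / 2"
        using norm_triangle_ineq4[of "(X (\<phi> t) - \<phi> t) + (\<phi> t - \<phi> t0)" "X z - z"] norm_triangle_ineq[of "X (\<phi> t) - \<phi> t" "\<phi> t - \<phi> t0"] h by simp
      have "norm (w - X (\<phi> t)) \<le> norm (w - X z) + norm (X (\<phi> t) - X z)"
        using norm_triangle_ineq4[of "w - X z" "X (\<phi> t) - X z"] by simp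
      also have "\<dots> \<le> h / 32 + h / 2" using w Xd by (simp add: dist_norm norm_minus_commute)
      also have "norm (w - X (\<phi> t)) = \<bar>s\<bar>" by (simp add: ws \<nu>)
      finally have s: "\<bar>s\<bar> \<le> h" using h by simp
      define s' where "s' = (s / h + 1) / 2"
      have "s' \<in> {0..1}" using s h by (auto simp: s'_def abs_le_iff field_simps)
      moreover have "2 * ((x + 1) / 2) - 1 = x" for x :: real by (simp add: field_simps)
      then have "2 * s' - 1 = s / h" unfolding s'_def .
      then have "(2 * s' - 1) * h = s" using h by simp
      then have "w = ?\<Psi> (X (\<phi> t)) s'" by (simp add: ws)
      moreover have "X (\<phi> t) \<in> X ` S \<inter> cball (X z) h" using \<phi>S[OF t(1)] Xd h by (simp add: dist_norm norm_minus_commute)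
      ultimately show "w \<in> {?\<Psi> a s |a s. a \<in> X ` S \<inter> cball (X z) h \<and> s \<in> {0..1}}" by blast
    qed
    have "emeasure lborel (cball (X z) (h / 32)) \<le> ennreal (sweep_const DIM('a) * (2 * h)) * hausdorff_outer (DIM('a) - 1) (X ` S \<inter> cball (X z) h)"
    proof (rule sweep_volume[OF dim2 _ _ cover])
      fix a :: 'a and s s' :: real
      have "?\<Psi> a s - ?\<Psi> a s' = (2 * h * (s - s')) *\<^sub>R \<nu>" by (simp add: algebra_simps)
      then show "norm (?\<Psi> a s - ?\<Psi> a s') \<le> 2 * h * \<bar>s - s'\<bar>" using h by (simp add: \<nu> abs_mult)
    qed (use h in auto)
    then show "ennreal (unit_ball_vol (real DIM('a)) * (h / 32) ^ DIM('a))
        \<le> ennreal (sweep_const DIM('a) * (2 * h)) * hausdorff_outer (DIM('a) - 1) (X ` S \<inter> cball (X z) h)"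
      using h by (simp add: emeasure_cball)
  qed (rule r0)
qed

section \<open>The nearest point map\<close>

lemma closest_point_infdist:
  fixes S :: "'a::euclidean_space set"
  assumes "closed S" "S \<noteq> {}"
  shows "closest_point S x \<in> S" "dist x (closest_point S x) = infdist x S"
proof -
  note * = closest_point_exists[OF assms, of x]
  show "closest_point S x \<in> S" using * by blast
  show "dist x (closest_point S x) = infdist x S"
  proof (rule antisym)
    show "dist x (closest_point S x) \<le> infdist x S"
      using * assms(2) by (auto simp: infdist_def intro!: cINF_greatest)
    show "infdist x S \<le> dist x (closest_point S x)" using * by (intro infdist_le) blast
  qed
qed

text \<open>By uniqueness the graph consists of all pairs that realise the distance, a closed set; a
  closed graph with values in a compact set belongs to a continuous map.\<close>

lemma continuous_on_closest_point_unique: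
  fixes S T :: "'a::euclidean_space set"
  assumes S: "compact S" "S \<noteq> {}" and T: "closed T" and uniq: "\<And>x. x \<in> T \<Longrightarrow> \<exists>!y. y \<in> S \<and> dist x y = infdist x S"
  shows "continuous_on T (closest_point S)"
proof (rule continuous_from_closed_graph[OF S(1)])
  note cp = closest_point_infdist[OF compact_imp_closed[OF S(1)] S(2)]
  show "closest_point S \<in> T \<rightarrow> S" using cp(1) by blast
  have eq: "(\<lambda>x. (x, closest_point S x)) ` T = (T \<times> S) \<inter> {p. dist (fst p) (snd p) = infdist (fst p) S}"
  proof (intro equalityI subsetI)
    fix p assume "p \<in> (T \<times> S) \<inter> {p. dist (fst p) (snd p) = infdist (fst p) S}"
    then obtain x y where p: "p = (x, y)" "x \<in> T" "y \<in> S" "dist x y = infdist x S" by auto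
    then have "y = closest_point S x" using uniq[OF p(2)] cp[of x] by blast
    then show "p \<in> (\<lambda>x. (x, closest_point S x)) ` T" using p by blast
  qed (use cp in auto)
  have "closed {p :: 'a \<times> 'a. dist (fst p) (snd p) = infdist (fst p) S}"
    by (intro closed_Collect_eq continuous_intros)
  then show "closed ((\<lambda>x. (x, closest_point S x)) ` T)"
    unfolding eq using T compact_imp_closed[OF S(1)] by (intro closed_Int closed_Times)
qed

lemma interior_frontier_open_empty: "open D \<Longrightarrow> interior (frontier D) = {}"
proof (rule ccontr)
  assume D: "open D" and ne: "interior (frontier D) \<noteq> {}"
  have "interior (frontier D) \<inter> D = {}"
    using D interior_subset[of "frontier D"] by (auto simp: frontier_def interior_open)
  then have "interior (frontier D) \<inter> closure D = {}" by (simp add: open_Int_closure_eq_empty)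
  then show False using ne interior_subset[of "frontier D"] by (auto simp: frontier_def)
qed

section \<open>Estimates on the cut mesh\<close>

lemma sum_over_near_le:
  fixes w :: "'p \<Rightarrow> real"
  assumes A: "finite A" and Y: "finite Y" and w: "\<And>p. p \<in> A \<Longrightarrow> w p \<ge> 0"
    and card: "\<And>p. p \<in> A \<Longrightarrow> card {y \<in> Y. near y p} \<le> m"
  shows "(\<Sum>y\<in>Y. \<Sum>p\<in>{p \<in> A. near y p}. w p) \<le> real m * (\<Sum>p\<in>A. w p)"
proof -
  have "(\<Sum>y\<in>Y. \<Sum>p\<in>{p \<in> A. near y p}. w p) = (\<Sum>y\<in>Y. \<Sum>p\<in>A. if near y p then w p else 0)"
    using A by (simp add: sum.inter_filter)
  also have "\<dots> = (\<Sum>p\<in>A. \<Sum>y\<in>Y. if near y p then w p else 0)" by (rule sum.swap)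
  also have "\<dots> = (\<Sum>p\<in>A. real (card {y \<in> Y. near y p}) * w p)"
    using Y by (simp add: sum.inter_filter[symmetric])
  also have "\<dots> \<le> (\<Sum>p\<in>A. real m * w p)"
    using w card by (intro sum_mono mult_right_mono) auto
  finally show ?thesis by (simp add: sum_distrib_left)
qed

text \<open>One fixed mesh and function, with \<open>X\<close> in the role of the inverse of the
  nearest point projection. The derived constants depend on \<open>q\<close>,
  \<open>\<sigma>\<close>, \<open>\<kappa>\<close> and the dimension only, which makes them uniform
  in \<open>h\<close> and in the cut.\<close>

locale cut_setting = regular_mesh \<K> \<sigma> q h for \<K> :: "'a::euclidean_space set set" and \<sigma> q h +
  fixes S Sh :: "'a set" and X :: "'a \<Rightarrow> 'a" and c \<kappa> :: real and v :: "'a \<Rightarrow> real"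
  assumes v: "v \<in> P1_space \<K>" and X: "continuous_on S X" and XS: "X ` S = Sh"
    and X_close: "\<And>y. y \<in> S \<Longrightarrow> norm (X y - y) \<le> c * h\<^sup>2"
    and Sh_comp: "compact Sh" and Sh_int: "Sh \<subseteq> interior (\<Union>\<K>)"
    and Sh_fin: "hausdorff_outer (DIM('a) - 1) Sh < top"
    and small: "c * h \<le> 1 / 2" "h \<le> 1" and c0: "c \<ge> 0"
    and \<kappa>: "\<kappa> > 0" "\<And>y. y \<in> S \<Longrightarrow> \<kappa> * h ^ (DIM('a) - 1) \<le> measure surface_measure (Sh \<inter> cball (X y) h)"
    and local_conn: "\<And>y y'. y \<in> S \<Longrightarrow> y' \<in> S \<Longrightarrow> dist y y' \<le> 2 * h \<Longrightarrow>
      \<exists>\<Gamma>. \<Gamma> \<subseteq> S \<and> connected \<Gamma> \<and> y \<in> \<Gamma> \<and> y' \<in> \<Gamma> \<and> \<Gamma> \<subseteq> cball y (5 * h)"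
begin

lemma X_near: "y \<in> S \<Longrightarrow> norm (X y - y) \<le> h / 2"
proof -
  assume "y \<in> S"
  then have "norm (X y - y) \<le> c * h\<^sup>2" by (rule X_close)
  also have "\<dots> \<le> 1 / 2 * h" using mult_right_mono[OF small(1), of h] h by (simp add: power2_eq_square)
  finally show ?thesis by simp
qed

text \<open>The count of \<open>card_near_le\<close> for radius \<open>8 * h\<close>, whence
  \<open>9 = 8 + 1\<close>; likewise the 12 in \<open>M12\<close> belongs to radius
  \<open>11 * h\<close>.\<close>

definition M :: nat where "M = nat \<lceil>(9 * (q * \<sigma>)) ^ DIM('a)\<rceil>"
definition M12 :: nat where "M12 = nat \<lceil>(12 * (q * \<sigma>)) ^ DIM('a)\<rceil>"

lemma card_near: "card {K \<in> \<K>. K \<inter> cball z (8 * h) \<noteq> {}} \<le> M"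
  using card_near_le[of 8 z] unfolding M_def by (simp add: le_nat_iff) linarith

lemma card_near': "R \<le> 8 \<Longrightarrow> card {K \<in> \<K>. K \<inter> cball z (R * h) \<noteq> {}} \<le> M"
proof -
  assume "R \<le> 8"
  then have "cball z (R * h) \<subseteq> cball z (8 * h)" using h by (intro subset_cball mult_right_mono) auto
  then have "card {K \<in> \<K>. K \<inter> cball z (R * h) \<noteq> {}} \<le> card {K \<in> \<K>. K \<inter> cball z (8 * h) \<noteq> {}}"
    using fin by (intro card_mono) auto
  then show ?thesis using card_near[of z] by linarith
qed

lemma card_near12: "card {K \<in> \<K>. K \<inter> cball z (11 * h) \<noteq> {}} \<le> M12"
  using card_near_le[of 11 z] unfolding M12_def by (simp add: le_nat_iff) linarith

definition Kh :: "'a set set" where "Kh = cut_mesh \<K> Sh"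
definition Adj :: "('a set \<times> 'a set) set" where "Adj = {(A, B). A \<in> Kh \<and> B \<in> Kh \<and> facet_adjacent A B}"
definition jmp :: "'a set \<times> 'a set \<Rightarrow> real" where
  "jmp p = (norm (elem_grad (fst p) v - elem_grad (snd p) v))\<^sup>2"
text \<open>The elements of a chain meet the image under \<open>X\<close> of a connected piece of
  \<open>S\<close> around \<open>y\<close>, which lies within \<open>6 * h\<close> of
  \<open>y\<close>; radius \<open>7 * h\<close> covers it.\<close>

definition near :: "'a \<Rightarrow> 'a set \<times> 'a set \<Rightarrow> bool" where "near y p \<longleftrightarrow> fst p \<inter> cball y (7 * h) \<noteq> {}"
definition J2 :: "'a \<Rightarrow> real" where "J2 y = (\<Sum>p\<in>{p \<in> Adj. near y p}. jmp p)"
definition I2 :: "'a set \<Rightarrow> real" where "I2 A = (LINT x:A|surface_measure. (v x)\<^sup>2)"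
text \<open>The power of \<open>h\<close> turns the integral into a mean: by the lower bound on
  surface measure, \<open>V2 y\<close> is at least \<kappa> times the mean square of
  \<open>v\<close> over this piece of the discrete surface.\<close>

definition V2 :: "'a \<Rightarrow> real" where "V2 y = I2 (Sh \<inter> cball (X y) h) / h ^ (DIM('a) - 1)"
definition e :: "'a \<Rightarrow> real" where "e y = sqrt (J2 y + V2 y)"
definition Jtot :: real where "Jtot = (\<Sum>p\<in>Adj. jmp p)"
definition Etot :: real where "Etot = Jtot + I2 Sh / h ^ (DIM('a) - 1)"
text \<open>Several elements may contain \<open>X y\<close>. Any choice will do, since by
  \<open>chain_estimate\<close> for a one-point set their gradients differ by at most a multiple of
  \<open>e y\<close>.\<close>

definition K_of :: "'a \<Rightarrow> 'a set" where "K_of y = (SOME K. K \<in> \<K> \<and> X y \<in> K)"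
definition W :: "'a \<Rightarrow> 'a" where "W y = elem_grad (K_of y) v"

lemma Kh_sub: "Kh \<subseteq> \<K>" by (auto simp: Kh_def cut_mesh_def)
lemma finite_Kh: "finite Kh" using Kh_sub fin finite_subset by blast
lemma finite_Adj: "finite Adj"
proof -
  have "Adj \<subseteq> Kh \<times> Kh" by (auto simp: Adj_def)
  then show ?thesis using finite_Kh finite_subset by blast
qed

lemma jmp_nonneg: "jmp p \<ge> 0" by (simp add: jmp_def)

lemma X_in: "y \<in> S \<Longrightarrow> X y \<in> Sh" using XS by blast

lemma K_of: assumes "y \<in> S" shows "K_of y \<in> \<K>" "X y \<in> K_of y" "K_of y \<in> Kh"
proof -
  have "X y \<in> \<Union>\<K>" using X_in[OF assms] Sh_int interior_subset by blast
  then have "\<exists>K. K \<in> \<K> \<and> X y \<in> K" by blast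
  then have *: "K_of y \<in> \<K> \<and> X y \<in> K_of y" unfolding K_of_def by (rule someI_ex)
  then show "K_of y \<in> \<K>" "X y \<in> K_of y" by auto
  then show "K_of y \<in> Kh" using X_in[OF assms] by (auto simp: Kh_def cut_mesh_def)
qed

lemma s1: "DIM('a) - 1 \<ge> 1" using dim2 by simp

lemma hp: "h ^ (DIM('a) - 1) > 0" using h by simp

lemma Sh_borel: "Sh \<in> sets borel" using Sh_comp by (simp add: compact_imp_closed borel_closed)

lemma v_cont: "continuous_on Sh v"
proof -
  have "continuous_on (\<Union>\<K>) v" using v by (simp add: P1_space_def)
  then show ?thesis using Sh_int interior_subset by (meson continuous_on_subset order_trans)
qed

lemma emeasure_Sh: "emeasure surface_measure Sh < top"
  using Sh_fin emeasure_hausdorff_measure[OF s1 Sh_borel] by simp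

lemma set_integrable_v2:
  assumes A: "A \<in> sets borel" "A \<subseteq> Sh"
  shows "set_integrable surface_measure A (\<lambda>x. (v x)\<^sup>2)"
proof -
  obtain b where b: "\<And>x. x \<in> Sh \<Longrightarrow> norm ((v x)\<^sup>2) \<le> b"
    using compact_imp_bounded[OF compact_continuous_image[OF _ Sh_comp, of "\<lambda>x. (v x)\<^sup>2"]] v_cont
    unfolding bounded_iff by (auto intro!: continuous_intros)
  have "set_integrable surface_measure Sh (\<lambda>x. (v x)\<^sup>2)"
    unfolding set_integrable_def
  proof (rule integrableI_bounded_set[where A=Sh and B=b])
    show "AE x in surface_measure. x \<in> Sh \<longrightarrow> norm (indicat_real Sh x *\<^sub>R (v x)\<^sup>2) \<le> b"
      using b by (intro AE_I2) auto
    show "(\<lambda>x. indicat_real Sh x *\<^sub>R (v x)\<^sup>2) \<in> borel_measurable surface_measure"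
      using borel_measurable_continuous_on_indicator[OF Sh_borel, of "\<lambda>x. (v x)\<^sup>2"] v_cont
      by (simp add: measurable_cong_sets[OF sets_hausdorff_measure refl] continuous_on_power)
    show "Sh \<in> sets surface_measure" using Sh_borel by simp
    show "emeasure surface_measure Sh < \<infinity>" using emeasure_Sh by simp
  qed auto
  then show ?thesis by (rule set_integrable_subset) (use A in auto)
qed

lemma I2_nonneg: "I2 A \<ge> 0"
  unfolding I2_def set_lebesgue_integral_def by (intro integral_nonneg_AE) auto

lemma J2_nonneg: "J2 y \<ge> 0" unfolding J2_def using jmp_nonneg by (intro sum_nonneg) auto
lemma V2_nonneg: "V2 y \<ge> 0" unfolding V2_def using I2_nonneg hp by simp
lemma e2: "(e y)\<^sup>2 = J2 y + V2 y" unfolding e_def using J2_nonneg V2_nonneg by simp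
lemma e_nonneg: "e y \<ge> 0" by (simp add: e_def J2_nonneg V2_nonneg)

lemma adj_grad_le:
  assumes "(A, B) \<in> Adj" "A \<inter> cball y (7 * h) \<noteq> {}"
  shows "norm (elem_grad A v - elem_grad B v) \<le> e y"
proof -
  have "jmp (A, B) \<le> J2 y" unfolding J2_def
    using assms finite_Adj jmp_nonneg by (intro member_le_sum) (auto simp: near_def)
  then have "(norm (elem_grad A v - elem_grad B v))\<^sup>2 \<le> (e y)\<^sup>2"
    unfolding e2 using V2_nonneg[of y] by (simp add: jmp_def)
  then show ?thesis by (rule power2_le_imp_le[OF _ e_nonneg])
qed

text \<open>All elements along the chain are near \<open>y\<close>, so the relation has at most the
  square of \<open>M\<close> pairs, and each pair contributes at most \<open>e y\<close>. For the
  second claim, the affine pieces of adjacent elements agree on their common facet.\<close>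

lemma chain_estimate:
  assumes \<Gamma>: "\<Gamma> \<subseteq> S" "connected \<Gamma>" "\<Gamma> \<subseteq> cball y (5 * h)"
    and A: "A \<in> \<K>" "A \<inter> X ` \<Gamma> \<noteq> {}" and B: "B \<in> \<K>" "B \<inter> X ` \<Gamma> \<noteq> {}"
  shows "norm (elem_grad A v - elem_grad B v) \<le> real (M\<^sup>2) * e y"
    "\<And>z. dist y z \<le> 8 * h \<Longrightarrow> \<bar>elem_affine A v z - elem_affine B v z\<bar> \<le> real (M\<^sup>2) * (16 * h * e y)"
proof -
  let ?R = "{(A, B). A \<in> \<K> \<and> B \<in> \<K> \<and> A \<inter> X ` \<Gamma> \<noteq> {} \<and> B \<inter> X ` \<Gamma> \<noteq> {} \<and> facet_adjacent A B}"
  have conn: "connected (X ` \<Gamma>)" using connected_continuous_image[OF continuous_on_subset[OF X \<Gamma>(1)] \<Gamma>(2)] .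
  have X\<Gamma>: "X ` \<Gamma> \<subseteq> Sh" using \<Gamma>(1) XS by blast
  have chain: "(A, B) \<in> ?R\<^sup>*" by (rule connected_chain[OF conn order_trans[OF X\<Gamma> Sh_int] A B])
  have X6: "X ` \<Gamma> \<subseteq> cball y (6 * h)"
  proof
    fix x assume "x \<in> X ` \<Gamma>"
    then obtain u where u: "u \<in> \<Gamma>" "x = X u" by blast
    then have "dist y u \<le> 5 * h" "norm (X u - u) \<le> h / 2" using \<Gamma> X_near by auto
    then show "x \<in> cball y (6 * h)" using u dist_triangle[of y x u] h by (simp add: dist_norm norm_minus_commute)
  qed
  have near6: "C \<inter> cball y (6 * h) \<noteq> {}" if "C \<inter> X ` \<Gamma> \<noteq> {}" for C using that X6 by blast
  have sub67: "cball y (6 * h) \<subseteq> cball y (7 * h)" using h by (intro subset_cball) auto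
  have RA: "(C, D) \<in> Adj" if "(C, D) \<in> ?R" for C D
    using that X\<Gamma> by (auto simp: Adj_def Kh_def cut_mesh_def)
  have "?R \<subseteq> {K \<in> \<K>. K \<inter> cball y (6 * h) \<noteq> {}} \<times> {K \<in> \<K>. K \<inter> cball y (6 * h) \<noteq> {}}" using near6 by auto
  moreover have "finite ({K \<in> \<K>. K \<inter> cball y (6 * h) \<noteq> {}} \<times> {K \<in> \<K>. K \<inter> cball y (6 * h) \<noteq> {}})"
    using fin by simp
  ultimately have fR: "finite ?R" and cR0: "card ?R \<le> card ({K \<in> \<K>. K \<inter> cball y (6 * h) \<noteq> {}} \<times> {K \<in> \<K>. K \<inter> cball y (6 * h) \<noteq> {}})"
    by (blast intro: finite_subset card_mono)+
  note cR0
  also have "\<dots> \<le> M * M" using card_near'[of 6 y] by (simp add: card_cartesian_product mult_le_mono)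
  finally have cR: "card ?R \<le> M\<^sup>2" by (simp add: power2_eq_square)
  have step: "norm (elem_grad C v - elem_grad D v) \<le> e y" if "(C, D) \<in> ?R" for C D
    using adj_grad_le[OF RA[OF that]] near6[of C] sub67 that by blast
  have "norm (elem_grad A v - elem_grad B v) \<le> card ?R * e y"
    by (rule chain_difference_bound[OF fR chain step e_nonneg])
  also have "\<dots> \<le> real (M\<^sup>2) * e y" using cR e_nonneg by (intro mult_right_mono of_nat_mono)
  finally show "norm (elem_grad A v - elem_grad B v) \<le> real (M\<^sup>2) * e y" .
  fix z assume z: "dist y z \<le> 8 * h"
  have step2: "norm (elem_affine C v z - elem_affine D v z) \<le> 16 * h * e y" if CD: "(C, D) \<in> ?R" for C D
  proof -
    have "facet_adjacent C D" using CD by auto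
    then obtain z0 where z0: "z0 \<in> C \<inter> D" by (auto simp: facet_adjacent_def facet_of_def)
    obtain x where x: "x \<in> C" "dist y x \<le> 6 * h" using near6[of C] CD by auto
    have "C \<in> \<K>" "D \<in> \<K>" using CD by auto
    have "dist x z0 \<le> h" using diam_le[OF \<open>C \<in> \<K>\<close> x(1), of z0] z0 by blast
    \<comment> \<open>At most \<open>8 * h\<close> from \<open>z\<close> to \<open>y\<close>,
      \<open>6 * h\<close> from \<open>y\<close> to the element and \<open>h\<close> inside
      it.\<close>
    then have "norm (z - z0) \<le> 16 * h"
      using z x(2) dist_triangle[of z z0 y] dist_triangle[of y z0 x] h by (simp add: dist_norm norm_minus_commute)
    moreover have "\<bar>elem_affine C v z - elem_affine D v z\<bar> \<le> norm (elem_grad C v - elem_grad D v) * norm (z - z0)"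
      by (rule elem_affine_jump[OF v \<open>C \<in> \<K>\<close> \<open>D \<in> \<K>\<close> z0])
    ultimately have "\<bar>elem_affine C v z - elem_affine D v z\<bar> \<le> e y * (16 * h)"
      using mult_mono[OF step[OF CD], of "norm (z - z0)" "16 * h"] e_nonneg by force
    then show ?thesis by (simp add: mult.commute)
  qed
  have "norm (elem_affine A v z - elem_affine B v z) \<le> card ?R * (16 * h * e y)"
    by (rule chain_difference_bound[where u="\<lambda>C. elem_affine C v z", OF fR chain step2]) (use h e_nonneg in auto)
  also have "\<dots> \<le> real (M\<^sup>2) * (16 * h * e y)" using cR e_nonneg h by (intro mult_right_mono of_nat_mono) auto
  finally show "\<bar>elem_affine A v z - elem_affine B v z\<bar> \<le> real (M\<^sup>2) * (16 * h * e y)" by simp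
qed

text \<open>A sum of all constants needed, so that it dominates each: \<open>16\<close> times the
  square of \<open>M\<close> for values along a chain, \<open>2 / \<kappa>\<close> and the term with
  \<open>1024\<close> for the energy part of a point value, \<open>4\<close> for its gradient
  part.\<close>

definition C0 :: real where "C0 = 1 + 16 * real (M\<^sup>2) + 2 / \<kappa> + 1024 * (real (M\<^sup>2))\<^sup>2 + 4"

lemma C0_bounds: "C0 \<ge> 1" "C0 \<ge> 16 * real (M\<^sup>2)" "C0 \<ge> real (M\<^sup>2)" "C0 \<ge> 2 / \<kappa> + 1024 * (real (M\<^sup>2))\<^sup>2" "C0 \<ge> 4"
proof -
  have "2 / \<kappa> > 0" "real (M\<^sup>2) \<ge> 0" "1024 * (real (M\<^sup>2))\<^sup>2 \<ge> 0" using \<kappa>(1) by auto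
  then show "C0 \<ge> 1" "C0 \<ge> 16 * real (M\<^sup>2)" "C0 \<ge> real (M\<^sup>2)" "C0 \<ge> 2 / \<kappa> + 1024 * (real (M\<^sup>2))\<^sup>2" "C0 \<ge> 4"
    unfolding C0_def by linarith+
qed

lemma increment:
  assumes \<Gamma>: "\<Gamma> \<subseteq> S" "connected \<Gamma>" "y \<in> \<Gamma>" "y' \<in> \<Gamma>" "\<Gamma> \<subseteq> cball y (5 * h)"
  shows "norm (W y' - W y) \<le> real (M\<^sup>2) * e y"
    "\<bar>v (X y') - v (X y) - W y \<bullet> (X y' - X y)\<bar> \<le> real (M\<^sup>2) * (16 * h * e y)"
proof -
  have yS: "y \<in> S" "y' \<in> S" using \<Gamma> by auto
  have A: "K_of y' \<inter> X ` \<Gamma> \<noteq> {}" "K_of y \<inter> X ` \<Gamma> \<noteq> {}" using K_of(2)[OF yS(1)] K_of(2)[OF yS(2)] \<Gamma> by auto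
  note * = chain_estimate[OF \<Gamma>(1,2,5) K_of(1)[OF yS(2)] A(1) K_of(1)[OF yS(1)] A(2)]
  show "norm (W y' - W y) \<le> real (M\<^sup>2) * e y" using *(1) by (simp add: W_def)
  have "dist y y' \<le> 5 * h" "norm (X y' - y') \<le> h / 2" using \<Gamma> yS X_near by auto
  then have d: "dist y (X y') \<le> 8 * h" using dist_triangle[of y "X y'" y'] h by (simp add: dist_norm norm_minus_commute)
  have "elem_affine (K_of y') v (X y') = v (X y')" "elem_affine (K_of y) v (X y) = v (X y)"
    using elem_affine_eq[OF v] K_of yS by auto
  then have "elem_affine (K_of y') v (X y') - elem_affine (K_of y) v (X y') = v (X y') - v (X y) - W y \<bullet> (X y' - X y)"
    using elem_affine_diff[of "K_of y" v "X y'" "X y"] by (simp add: W_def)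
  then show "\<bar>v (X y') - v (X y) - W y \<bullet> (X y' - X y)\<bar> \<le> real (M\<^sup>2) * (16 * h * e y)"
    using *(2)[OF d] by simp
qed

lemma point_value:
  assumes y: "y \<in> S"
  shows "(v (X y))\<^sup>2 \<le> C0 * ((e y)\<^sup>2 + h\<^sup>2 * (norm (W y))\<^sup>2)"
proof -
  let ?A = "Sh \<inter> cball (X y) h" let ?m = "measure surface_measure ?A" let ?Q = "real (M\<^sup>2)"
  \<comment> \<open>The square of a sum is twice bounded by twice the sum of squares:
    \<open>4 = 2 * 2\<close> and \<open>1024 = 4 * 16 * 16\<close>, where \<open>h \<le> 1\<close>
    removes a factor from the second term.\<close>
  define R where "R = 4 * h\<^sup>2 * (norm (W y))\<^sup>2 + 1024 * ?Q\<^sup>2 * (e y)\<^sup>2"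
  have AB: "?A \<in> sets borel" using Sh_borel by auto
  have pw: "(v (X y))\<^sup>2 - R \<le> 2 * (v x)\<^sup>2" if x: "x \<in> ?A" for x
  proof -
    obtain y' where y': "y' \<in> S" "x = X y'" using x XS by auto
    have "y - y' = (X y - X y') - (X y - y) + (X y' - y')" by simp
    then have "norm (y - y') \<le> norm (X y - X y') + norm (X y - y) + norm (X y' - y')"
      using norm_triangle_ineq[of "(X y - X y') - (X y - y)" "X y' - y'"] norm_triangle_ineq4[of "X y - X y'" "X y - y"] by simp
    moreover have Xd: "norm (X y' - X y) \<le> h" using x y' by (simp add: dist_norm norm_minus_commute)
    ultimately have "dist y y' \<le> 2 * h" using X_near[OF y] X_near[OF y'(1)] by (simp add: dist_norm norm_minus_commute)
    then obtain \<Gamma> where \<Gamma>: "\<Gamma> \<subseteq> S" "connected \<Gamma>" "y \<in> \<Gamma>" "y' \<in> \<Gamma>" "\<Gamma> \<subseteq> cball y (5 * h)"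
      using local_conn[OF y y'(1)] by blast
    have "\<bar>v (X y') - v (X y) - W y \<bullet> (X y' - X y)\<bar> \<le> ?Q * (16 * h * e y)" by (rule increment(2)[OF \<Gamma>])
    moreover have "\<bar>W y \<bullet> (X y' - X y)\<bar> \<le> norm (W y) * h"
      using Cauchy_Schwarz_ineq2[of "W y" "X y' - X y"] mult_left_mono[OF Xd, of "norm (W y)"] by force
    ultimately have d: "\<bar>v (X y) - v x\<bar> \<le> norm (W y) * h + ?Q * (16 * h * e y)" unfolding y'(2) by linarith
    have "(v (X y))\<^sup>2 \<le> 2 * (v x)\<^sup>2 + 2 * (v (X y) - v x)\<^sup>2" using norm_sq_le_diff[of "v (X y)" "v x"] by simp
    also have "(v (X y) - v x)\<^sup>2 \<le> (norm (W y) * h + ?Q * (16 * h * e y))\<^sup>2"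
      using power_mono[OF d, of 2] by simp
    also have "\<dots> \<le> 2 * (norm (W y) * h)\<^sup>2 + 2 * (?Q * (16 * h * e y))\<^sup>2"
      using norm_add_sq_le[of "norm (W y) * h" "?Q * (16 * h * e y)"] by (simp only: real_norm_def power2_abs)
    also have "(?Q * (16 * h * e y))\<^sup>2 \<le> 256 * ?Q\<^sup>2 * (e y)\<^sup>2"
    proof -
      have "h\<^sup>2 \<le> 1" using h small by (simp add: power_le_one)
      then have "h\<^sup>2 * (256 * ?Q\<^sup>2 * (e y)\<^sup>2) \<le> 1 * (256 * ?Q\<^sup>2 * (e y)\<^sup>2)" by (intro mult_right_mono) auto
      then show ?thesis by (simp add: power_mult_distrib mult.commute mult.left_commute)
    qed
    finally show ?thesis by (simp add: R_def power_mult_distrib algebra_simps)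
  qed
  have fm: "emeasure surface_measure ?A < top"
  proof -
    have "emeasure surface_measure ?A \<le> emeasure surface_measure Sh" using Sh_borel by (intro emeasure_mono) auto
    then show ?thesis using emeasure_Sh by (rule le_less_trans)
  qed
  have int1: "set_integrable surface_measure ?A (\<lambda>x. (v (X y))\<^sup>2 - R)"
    unfolding set_integrable_def using AB fm by (intro integrable_scaleR_left) (auto simp: integrable_indicator_iff)
  have int2: "set_integrable surface_measure ?A (\<lambda>x. 2 * (v x)\<^sup>2)"
    using set_integrable_v2[OF AB] by (intro set_integrable_mult_right) auto
  have "?m * ((v (X y))\<^sup>2 - R) = (LINT x:?A|surface_measure. (v (X y))\<^sup>2 - R)"
    using AB fm by (subst set_integral_const) auto
  also have "\<dots> \<le> (LINT x:?A|surface_measure. 2 * (v x)\<^sup>2)" using pw by (intro set_integral_mono int1 int2) auto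
  also have "\<dots> = 2 * I2 ?A" by (simp add: I2_def set_integral_mult_right)
  finally have main: "?m * ((v (X y))\<^sup>2 - R) \<le> 2 * I2 ?A" .
  \<comment> \<open>The lower bound may replace the measure only if the factor multiplied by it is
    nonnegative; otherwise the claim is trivial.\<close>
  have "(v (X y))\<^sup>2 - R \<le> 2 / \<kappa> * V2 y"
  proof (cases "(v (X y))\<^sup>2 - R \<ge> 0")
    case True
    then have "\<kappa> * h ^ (DIM('a) - 1) * ((v (X y))\<^sup>2 - R) \<le> 2 * I2 ?A"
      using mult_right_mono[OF \<kappa>(2)[OF y] True] main by linarith
    then have "(v (X y))\<^sup>2 - R \<le> 2 * I2 ?A / (\<kappa> * h ^ (DIM('a) - 1))"
      using \<kappa>(1) hp by (subst pos_le_divide_eq) (auto simp: mult.commute)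
    then show ?thesis by (simp add: V2_def)
  next
    case False
    have "2 / \<kappa> * V2 y \<ge> 0" using V2_nonneg \<kappa>(1) by simp
    then show ?thesis using False by linarith
  qed
  also have "\<dots> \<le> 2 / \<kappa> * (e y)\<^sup>2" using \<kappa>(1) J2_nonneg[of y] by (intro mult_left_mono) (auto simp: e2)
  finally have "(v (X y))\<^sup>2 \<le> (2 / \<kappa> + 1024 * ?Q\<^sup>2) * (e y)\<^sup>2 + 4 * (h\<^sup>2 * (norm (W y))\<^sup>2)"
    by (simp add: R_def algebra_simps)
  also have "\<dots> \<le> C0 * (e y)\<^sup>2 + C0 * (h\<^sup>2 * (norm (W y))\<^sup>2)"
    using C0_bounds(4,5) by (intro add_mono mult_right_mono) auto
  finally show ?thesis by (simp add: algebra_simps)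
qed

text \<open>The inequality holds pointwise under the integral: a point in the ball around
  \<open>X y\<close> is within \<open>2 * h\<close> of \<open>y\<close>, so it lies in at most
  \<open>m\<close> of the balls.\<close>

lemma V2_sum:
  assumes Y: "finite Y" "Y \<subseteq> S" and ov: "overlap_le h m Y"
  shows "(\<Sum>y\<in>Y. I2 (Sh \<inter> cball (X y) h)) \<le> real m * I2 Sh"
proof -
  let ?f = "\<lambda>A x. indicat_real A x *\<^sub>R (v x)\<^sup>2"
  have ib: "integrable surface_measure (?f A)" if "A \<in> sets borel" "A \<subseteq> Sh" for A
    using set_integrable_v2[OF that] by (simp add: set_integrable_def)
  have bor: "Sh \<inter> cball (X y) h \<in> sets borel" for y using Sh_borel by auto
  have "(\<Sum>y\<in>Y. I2 (Sh \<inter> cball (X y) h)) = (LINT x|surface_measure. (\<Sum>y\<in>Y. ?f (Sh \<inter> cball (X y) h) x))"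
    unfolding I2_def set_lebesgue_integral_def using ib[OF bor] by (subst Bochner_Integration.integral_sum) auto
  also have "\<dots> \<le> (LINT x|surface_measure. real m * ?f Sh x)"
  proof (rule integral_mono)
    show "integrable surface_measure (\<lambda>x. \<Sum>y\<in>Y. ?f (Sh \<inter> cball (X y) h) x)" using ib[OF bor] by auto
    show "integrable surface_measure (\<lambda>x. real m * ?f Sh x)" using ib[OF Sh_borel] by auto
    fix x
    have "(\<Sum>y\<in>Y. ?f (Sh \<inter> cball (X y) h) x) = (\<Sum>y\<in>{y \<in> Y. x \<in> Sh \<inter> cball (X y) h}. (v x)\<^sup>2)"
      unfolding sum.inter_filter[OF Y(1)] by (intro sum.cong) (auto simp: indicator_def)
    also have "\<dots> = real (card {y \<in> Y. x \<in> Sh \<inter> cball (X y) h}) * (v x)\<^sup>2" by simp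
    also have "\<dots> \<le> real m * ?f Sh x"
    proof (cases "x \<in> Sh")
      case True
      have "{y \<in> Y. x \<in> Sh \<inter> cball (X y) h} \<subseteq> Y \<inter> cball x (10 * h)"
      proof
        fix y assume y: "y \<in> {y \<in> Y. x \<in> Sh \<inter> cball (X y) h}"
        then have "norm (X y - y) \<le> h / 2" using X_near Y by auto
        then show "y \<in> Y \<inter> cball x (10 * h)" using y dist_triangle[of x y "X y"] h by (simp add: dist_norm norm_minus_commute)
      qed
      then have "card {y \<in> Y. x \<in> Sh \<inter> cball (X y) h} \<le> card (Y \<inter> cball x (10 * h))" using Y by (intro card_mono) auto
      also have "\<dots> \<le> m" using ov by (simp add: overlap_le_def)
      finally show ?thesis using True by (auto intro!: mult_right_mono)
    qed simp
    finally show "(\<Sum>y\<in>Y. ?f (Sh \<inter> cball (X y) h) x) \<le> real m * ?f Sh x" .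
  qed
  also have "\<dots> = real m * I2 Sh" by (simp add: I2_def set_lebesgue_integral_def)
  finally show ?thesis .
qed

lemma energy_sum:
  assumes Y: "finite Y" "Y \<subseteq> S" and ov: "overlap_le h m Y"
  shows "(\<Sum>y\<in>Y. (e y)\<^sup>2) \<le> real m * Etot"
proof -
  have "(\<Sum>y\<in>Y. J2 y) \<le> real m * Jtot"
    unfolding J2_def Jtot_def
  proof (rule sum_over_near_le[OF finite_Adj Y(1) jmp_nonneg])
    fix p assume p: "p \<in> Adj"
    then obtain A B where AB: "p = (A, B)" "A \<in> \<K>" using Kh_sub by (auto simp: Adj_def)
    obtain a0 where a0: "a0 \<in> A" using int_ne[OF AB(2)] interior_subset by blast
    \<comment> \<open>The reach \<open>7 * h\<close> of \<open>near\<close> and the diameter of the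
      element stay below the radius \<open>10 * h\<close> of \<open>overlap_le\<close>.\<close>
    have "{y \<in> Y. near y p} \<subseteq> Y \<inter> cball a0 (10 * h)"
    proof
      fix y assume y: "y \<in> {y \<in> Y. near y p}"
      then obtain a where "a \<in> A" "dist y a \<le> 7 * h" using AB by (auto simp: near_def)
      then show "y \<in> Y \<inter> cball a0 (10 * h)"
        using y diam_le[OF AB(2) a0, of a] dist_triangle[of a0 y a] h by (simp add: dist_commute)
    qed
    then have "card {y \<in> Y. near y p} \<le> card (Y \<inter> cball a0 (10 * h))" using Y by (intro card_mono) auto
    also have "\<dots> \<le> m" using ov by (simp add: overlap_le_def)
    finally show "card {y \<in> Y. near y p} \<le> m" .
  qed
  moreover have "(\<Sum>y\<in>Y. V2 y) \<le> real m * (I2 Sh / h ^ (DIM('a) - 1))"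
  proof -
    have "(\<Sum>y\<in>Y. V2 y) = (\<Sum>y\<in>Y. I2 (Sh \<inter> cball (X y) h)) / h ^ (DIM('a) - 1)"
      by (simp add: V2_def sum_divide_distrib)
    also have "\<dots> \<le> real m * I2 Sh / h ^ (DIM('a) - 1)" using V2_sum[OF assms] hp by (intro divide_right_mono) auto
    finally show ?thesis by simp
  qed
  ultimately show ?thesis by (simp add: e2 sum.distrib Etot_def algebra_simps)
qed

lemma Etot_nonneg: "Etot \<ge> 0"
  unfolding Etot_def Jtot_def using I2_nonneg[of Sh] hp jmp_nonneg by (simp add: sum_nonneg)

lemma macro_data: "macro_data S C0 c h X W (\<lambda>y. v (X y)) e Etot"
  unfolding macro_data_def
proof (intro conjI allI impI ballI)
  fix \<Gamma> y y' assume "\<Gamma> \<subseteq> S" "connected \<Gamma>" "y \<in> \<Gamma>" "y' \<in> \<Gamma>" "\<Gamma> \<subseteq> cball y (5 * h)"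
  note * = increment[OF this]
  have "real (M\<^sup>2) * e y \<le> C0 * e y" using C0_bounds(3) e_nonneg by (rule mult_right_mono)
  then show "norm (W y' - W y) \<le> C0 * e y" using *(1) by linarith
  have "real (M\<^sup>2) * (16 * h * e y) = 16 * real (M\<^sup>2) * (h * e y)" by simp
  also have "\<dots> \<le> C0 * (h * e y)" using C0_bounds(2) e_nonneg h by (intro mult_right_mono) auto
  finally show "\<bar>v (X y') - v (X y) - W y \<bullet> (X y' - X y)\<bar> \<le> C0 * h * e y" using *(2) by simp
next
  fix Y m assume "finite Y" "Y \<subseteq> S" "overlap_le h m Y"
  then have "(\<Sum>y\<in>Y. (e y)\<^sup>2) \<le> real m * Etot" by (rule energy_sum)
  also have "\<dots> = real m * 1 * Etot" by simp
  also have "\<dots> \<le> real m * C0 * Etot" using C0_bounds(1) Etot_nonneg by (intro mult_right_mono mult_left_mono) auto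
  finally show "(\<Sum>y\<in>Y. (e y)\<^sup>2) \<le> real m * C0 * Etot" .
qed (use X_close Etot_nonneg point_value in auto)

end

lemma hausdorff_outer_UN_finite:
  fixes A :: "'i \<Rightarrow> 'a::metric_space set"
  assumes "s \<ge> 1" "finite I" "\<And>i. i \<in> I \<Longrightarrow> hausdorff_outer s (A i) < top"
  shows "hausdorff_outer s (\<Union>i\<in>I. A i) < top"
  using assms(2,3)
proof (induction I rule: finite_induct)
  case empty
  show ?case using hausdorff_outer_empty[OF assms(1), where 'a='a] by simp
next
  case (insert i I)
  have "hausdorff_outer s (\<Union>i\<in>insert i I. A i) \<le> hausdorff_outer s (A i) + hausdorff_outer s (\<Union>i\<in>I. A i)"
    using hausdorff_outer_Un_le[OF assms(1)] by simp
  also have "\<dots> < top" using insert by simp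
  finally show ?case .
qed

lemma L2_norm_on_square: "(L2_norm_on N A f)\<^sup>2 = (LINT x:A|N. (f x)\<^sup>2)"
proof -
  have "(LINT x:A|N. (f x)\<^sup>2) \<ge> 0"
    unfolding set_lebesgue_integral_def by (intro integral_nonneg_AE) auto
  then show ?thesis by (simp add: L2_norm_on_def)
qed

section \<open>From points of the surface to the elements of the cut mesh\<close>

context cut_setting
begin

definition B0 :: real where "B0 = 2 * C0 + 4 + 4 * (real (M\<^sup>2))\<^sup>2"

text \<open>On an element \<open>v\<close> differs from its value at \<open>X y\<close> by at most
  \<open>h\<close> times the gradient, and the gradient of any element through \<open>X y\<close> is
  comparable with \<open>W y\<close> by a chain in the one-point set. The constant \<open>B0\<close>
  collects the factors.\<close>

lemma element_bound:
  assumes y: "y \<in> S" and K: "K \<in> \<K>" "X y \<in> K" and x: "x \<in> K"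
  shows "(v x)\<^sup>2 \<le> B0 * ((e y)\<^sup>2 + h\<^sup>2 * (norm (W y))\<^sup>2)"
proof -
  let ?Q = "real (M\<^sup>2)" let ?g = "elem_grad K v"
  have "norm (?g - W y) \<le> ?Q * e y"
    unfolding W_def using y K K_of[OF y] h by (intro chain_estimate(1)[of "{y}"]) auto
  then have "norm ?g \<le> norm (W y) + ?Q * e y" using norm_triangle_ineq[of "W y" "?g - W y"] by simp
  then have "(norm ?g)\<^sup>2 \<le> (norm (W y) + ?Q * e y)\<^sup>2" by (intro power_mono) auto
  also have "\<dots> \<le> 2 * (norm (W y))\<^sup>2 + 2 * (?Q * e y)\<^sup>2"
    using norm_add_sq_le[of "norm (W y)" "?Q * e y"] by (simp only: real_norm_def power2_abs)
  finally have g2: "h\<^sup>2 * (norm ?g)\<^sup>2 \<le> h\<^sup>2 * (2 * (norm (W y))\<^sup>2 + 2 * (?Q * e y)\<^sup>2)" by (intro mult_left_mono) auto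
  have "v x - v (X y) = ?g \<bullet> (x - X y)"
    using elem_affine_diff[of K v x "X y"] elem_affine_eq[OF v K(1)] K x by simp
  then have "\<bar>v x - v (X y)\<bar> \<le> norm ?g * norm (x - X y)" using Cauchy_Schwarz_ineq2 by simp
  also have "\<dots> \<le> norm ?g * h" using diam_le[OF K(1) x K(2)] by (intro mult_left_mono) (auto simp: dist_norm)
  finally have d0: "\<bar>v x - v (X y)\<bar> \<le> norm ?g * h" .
  have d: "(v x - v (X y))\<^sup>2 \<le> h\<^sup>2 * (norm ?g)\<^sup>2"
    using power_mono[OF d0 abs_ge_zero, of 2] by (simp add: power_mult_distrib mult.commute)
  have "h\<^sup>2 \<le> 1" using h small by (simp add: power_le_one)
  then have q1: "h\<^sup>2 * (?Q * e y)\<^sup>2 \<le> 1 * (?Q * e y)\<^sup>2" by (intro mult_right_mono) auto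
  have "(v x)\<^sup>2 \<le> 2 * (v (X y))\<^sup>2 + 2 * (v x - v (X y))\<^sup>2" using norm_sq_le_diff[of "v x" "v (X y)"] by simp
  also have "\<dots> \<le> 2 * (C0 * ((e y)\<^sup>2 + h\<^sup>2 * (norm (W y))\<^sup>2)) + 2 * (h\<^sup>2 * (2 * (norm (W y))\<^sup>2 + 2 * (?Q * e y)\<^sup>2))"
    using point_value[OF y] d g2 by linarith
  also have "\<dots> \<le> 2 * (C0 * ((e y)\<^sup>2 + h\<^sup>2 * (norm (W y))\<^sup>2)) + 4 * (h\<^sup>2 * (norm (W y))\<^sup>2) + 4 * ?Q\<^sup>2 * (e y)\<^sup>2"
    using q1 by (simp add: power_mult_distrib algebra_simps)
  also have "\<dots> \<le> B0 * ((e y)\<^sup>2 + h\<^sup>2 * (norm (W y))\<^sup>2)"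
    by (simp add: B0_def algebra_simps)
  finally show ?thesis .
qed

text \<open>Each cut element selects a point of \<open>S\<close> whose image under \<open>X\<close>
  it contains. At most \<open>M\<close> elements select the same point, the selected points have
  overlap at most \<open>M12\<close>, and an element has at most the volume of a ball of radius
  \<open>h\<close>.\<close>

lemma cut_mesh_bound:
  assumes Km: "Km \<ge> 0" "\<And>Y m. finite Y \<Longrightarrow> Y \<subseteq> S \<Longrightarrow> overlap_le h m Y \<Longrightarrow> h\<^sup>2 * (\<Sum>y\<in>Y. (norm (W y))\<^sup>2) \<le> real m * Km * Etot"
  shows "(LINT x:(\<Union>Kh)|lborel. (v x)\<^sup>2)
    \<le> unit_ball_vol (real DIM('a)) * h ^ DIM('a) * B0 * real M * real M12 * (1 + Km) * Etot"
proof -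
  let ?V = "unit_ball_vol (real DIM('a))"
  have "\<forall>K\<in>Kh. \<exists>y. y \<in> S \<and> X y \<in> K" using XS by (auto simp: Kh_def cut_mesh_def)
  from bchoice[OF this] obtain yk where yk: "\<forall>K\<in>Kh. yk K \<in> S \<and> X (yk K) \<in> K" by (rule exE)
  define Y where "Y = yk ` Kh"
  have Y: "finite Y" "Y \<subseteq> S" using yk finite_Kh by (auto simp: Y_def)
  define F where "F y = (e y)\<^sup>2 + h\<^sup>2 * (norm (W y))\<^sup>2" for y
  have F0: "F y \<ge> 0" for y by (simp add: F_def)
  have near_y: "K \<inter> cball (yk K) (1 * h) \<noteq> {}" if "K \<in> Kh" for K
  proof -
    have "X (yk K) \<in> K" "norm (X (yk K) - yk K) \<le> h / 2" using yk X_near that by auto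
    then show ?thesis using h by (auto simp: dist_norm norm_minus_commute intro!: exI[of _ "X (yk K)"])
  qed
  have ov: "overlap_le h M12 Y"
    unfolding overlap_le_def
  proof
    fix z
    have "Y \<inter> cball z (10 * h) \<subseteq> yk ` {K \<in> \<K>. K \<inter> cball z (11 * h) \<noteq> {}}"
    proof
      fix y assume "y \<in> Y \<inter> cball z (10 * h)"
      then obtain K where K: "K \<in> Kh" "y = yk K" "dist z y \<le> 10 * h" by (auto simp: Y_def)
      then obtain a where a: "a \<in> K" "dist y a \<le> h" using near_y[OF K(1)] by auto
      have "a \<in> K \<inter> cball z (11 * h)" using a K(3) dist_triangle[of z a y] by simp
      then have "K \<in> {K \<in> \<K>. K \<inter> cball z (11 * h) \<noteq> {}}" using K(1) Kh_sub by blast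
      then show "y \<in> yk ` {K \<in> \<K>. K \<inter> cball z (11 * h) \<noteq> {}}" using K(2) by blast
    qed
    then have "card (Y \<inter> cball z (10 * h)) \<le> card (yk ` {K \<in> \<K>. K \<inter> cball z (11 * h) \<noteq> {}})"
      using fin by (intro card_mono) auto
    also have "\<dots> \<le> card {K \<in> \<K>. K \<inter> cball z (11 * h) \<noteq> {}}" using fin by (intro card_image_le) auto
    also have "\<dots> \<le> M12" by (rule card_near12)
    finally show "card (Y \<inter> cball z (10 * h)) \<le> M12" .
  qed
  have FY: "(\<Sum>y\<in>Y. F y) \<le> real M12 * (1 + Km) * Etot"
  proof -
    have "(\<Sum>y\<in>Y. F y) = (\<Sum>y\<in>Y. (e y)\<^sup>2) + h\<^sup>2 * (\<Sum>y\<in>Y. (norm (W y))\<^sup>2)"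
      by (simp add: F_def sum.distrib sum_distrib_left)
    also have "\<dots> \<le> real M12 * Etot + real M12 * Km * Etot"
      using energy_sum[OF Y ov] Km(2)[OF Y ov] by linarith
    finally show ?thesis by (simp add: algebra_simps)
  qed
  have FK: "(\<Sum>K\<in>Kh. F (yk K)) \<le> real M * (\<Sum>y\<in>Y. F y)"
  proof -
    have "(\<Sum>K\<in>Kh. F (yk K)) = (\<Sum>y\<in>Y. \<Sum>K\<in>{K \<in> Kh. yk K = y}. F (yk K))"
      using finite_Kh Y by (intro sum.group[symmetric]) (auto simp: Y_def)
    also have "\<dots> = (\<Sum>y\<in>Y. real (card {K \<in> Kh. yk K = y}) * F y)" by simp
    also have "\<dots> \<le> (\<Sum>y\<in>Y. real M * F y)"
    proof (intro sum_mono mult_right_mono F0)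
      fix y
      have "{K \<in> Kh. yk K = y} \<subseteq> {K \<in> \<K>. K \<inter> cball y (1 * h) \<noteq> {}}" using near_y Kh_sub by blast
      then have "card {K \<in> Kh. yk K = y} \<le> card {K \<in> \<K>. K \<inter> cball y (1 * h) \<noteq> {}}" using fin by (intro card_mono) auto
      also have "\<dots> \<le> M" by (rule card_near') simp
      finally show "real (card {K \<in> Kh. yk K = y}) \<le> real M" by simp
    qed
    finally show ?thesis by (simp add: sum_distrib_left)
  qed
  have KB: "K \<in> sets lborel" if "K \<in> Kh" for K using clo Kh_sub that by (auto intro: borel_closed)
  have contK: "continuous_on K (\<lambda>x. (v x)\<^sup>2)" if "K \<in> Kh" for K
  proof -
    have "continuous_on (\<Union>\<K>) v" using v by (simp add: P1_space_def)
    moreover have "K \<subseteq> \<Union>\<K>" using that Kh_sub by blast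
    ultimately have "continuous_on K v" by (rule continuous_on_subset)
    then show ?thesis by (rule continuous_on_power)
  qed
  have intK: "set_integrable lborel K (\<lambda>x. (v x)\<^sup>2)" if "K \<in> Kh" for K
    using borel_integrable_compact[OF comp contK[OF that]] that Kh_sub by (auto simp: set_integrable_def)
  have vK: "(LINT x:K|lborel. (v x)\<^sup>2) \<le> ?V * h ^ DIM('a) * (B0 * F (yk K))" if K: "K \<in> Kh" for K
  proof -
    have KK: "K \<in> \<K>" using K Kh_sub by blast
    have yK: "yk K \<in> S" "X (yk K) \<in> K" using yk K by auto
    have sub: "K \<subseteq> cball (X (yk K)) h" using diam_le[OF KK yK(2)] by auto
    have fm: "emeasure lborel K < top" using emeasure_lborel_cball_finite emeasure_mono[OF sub, of lborel]
      by (metis borel_closed closed_cball le_less_trans infinity_ennreal_def sets_lborel)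
    have B0: "B0 \<ge> 0" using C0_bounds(1) by (simp add: B0_def)
    have "(LINT x:K|lborel. (v x)\<^sup>2) \<le> (LINT x:K|lborel. B0 * F (yk K))"
    proof (rule set_integral_mono[OF intK[OF K]])
      show "set_integrable lborel K (\<lambda>x. B0 * F (yk K))"
        unfolding set_integrable_def using KB[OF K] fm by (intro integrable_scaleR_left) (auto simp: integrable_indicator_iff)
      fix x assume "x \<in> K" then show "(v x)\<^sup>2 \<le> B0 * F (yk K)"
        unfolding F_def using element_bound[OF yK(1) KK yK(2)] by blast
    qed
    also have "\<dots> = measure lborel K * (B0 * F (yk K))" using KB[OF K] fm by (subst set_integral_const) auto
    also have "\<dots> \<le> ?V * h ^ DIM('a) * (B0 * F (yk K))"
    proof (intro mult_right_mono mult_nonneg_nonneg B0 F0)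
      have "measure lborel K \<le> measure lborel (cball (X (yk K)) h)"
        using sub KB[OF K] by (intro measure_mono_fmeasurable) (auto simp: fmeasurable_def emeasure_cball h less_imp_le)
      then show "measure lborel K \<le> ?V * h ^ DIM('a)" using h by (simp add: content_cball)
    qed
    finally show ?thesis .
  qed
  have UB: "\<Union>Kh \<in> sets lborel" using finite_Kh KB by (intro sets.finite_Union) auto
  have "(LINT x:(\<Union>Kh)|lborel. (v x)\<^sup>2) \<le> (LINT x|lborel. (\<Sum>K\<in>Kh. indicat_real K x *\<^sub>R (v x)\<^sup>2))"
    unfolding set_lebesgue_integral_def
  proof (rule integral_mono)
    have "compact (\<Union>Kh)" using finite_Kh comp Kh_sub by (intro compact_Union) auto
    moreover have "continuous_on (\<Union>Kh) (\<lambda>x. (v x)\<^sup>2)"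
    proof (rule continuous_on_power)
      have "continuous_on (\<Union>\<K>) v" using v by (simp add: P1_space_def)
      then show "continuous_on (\<Union>Kh) v" by (rule continuous_on_subset) (use Kh_sub in blast)
    qed
    ultimately show "integrable lborel (\<lambda>x. indicat_real (\<Union>Kh) x *\<^sub>R (v x)\<^sup>2)"
      using borel_integrable_compact by blast
    show "integrable lborel (\<lambda>x. \<Sum>K\<in>Kh. indicat_real K x *\<^sub>R (v x)\<^sup>2)"
      using intK by (intro Bochner_Integration.integrable_sum) (auto simp: set_integrable_def)
    fix x
    show "indicat_real (\<Union>Kh) x *\<^sub>R (v x)\<^sup>2 \<le> (\<Sum>K\<in>Kh. indicat_real K x *\<^sub>R (v x)\<^sup>2)"
    proof (cases "x \<in> \<Union>Kh")
      case True
      then obtain K where K: "K \<in> Kh" "x \<in> K" by blast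
      have "indicat_real K x *\<^sub>R (v x)\<^sup>2 \<le> (\<Sum>K\<in>Kh. indicat_real K x *\<^sub>R (v x)\<^sup>2)"
        using finite_Kh K(1) by (intro member_le_sum) auto
      then show ?thesis using True K by simp
    qed (auto intro!: sum_nonneg)
  qed
  also have "\<dots> = (\<Sum>K\<in>Kh. LINT x:K|lborel. (v x)\<^sup>2)"
    unfolding set_lebesgue_integral_def using intK by (intro Bochner_Integration.integral_sum) (auto simp: set_integrable_def)
  also have "\<dots> \<le> (\<Sum>K\<in>Kh. ?V * h ^ DIM('a) * (B0 * F (yk K)))" using vK by (intro sum_mono)
  also have "\<dots> = ?V * h ^ DIM('a) * B0 * (\<Sum>K\<in>Kh. F (yk K))" by (simp add: sum_distrib_left mult.assoc)
  also have "\<dots> \<le> ?V * h ^ DIM('a) * B0 * (real M * (real M12 * (1 + Km) * Etot))"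
  proof (intro mult_left_mono)
    show "(\<Sum>K\<in>Kh. F (yk K)) \<le> real M * (real M12 * (1 + Km) * Etot)"
      using FK mult_left_mono[OF FY, of "real M"] by linarith
    show "0 \<le> ?V * h ^ DIM('a) * B0" using h C0_bounds(1) by (simp add: B0_def)
  qed
  finally show ?thesis by (simp only: mult.assoc)
qed

text \<open>The normal jump is constant on a facet, so its squared norm is the measure of the facet
  times a square, and the lower bound on facet measures recovers the sum of squared jumps. The
  square of \<open>M\<close> bounds the number of ordered pairs of elements that share a given
  facet.\<close>

lemma jump_energy_bound:
  assumes \<tau>: "\<tau> > 0" and n: "\<And>F. F \<in> interior_faces Kh \<Longrightarrow> unit_normal_to F (n F)"
  shows "h ^ DIM('a) * Jtot \<le> (real (M\<^sup>2) * ((q * \<sigma>) ^ DIM('a) * sweep_const DIM('a) / unit_ball_vol (real DIM('a))) / \<tau>)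
    * (h * (face_norm \<tau> Kh n v)\<^sup>2)"
proof -
  let ?V = "unit_ball_vol (real DIM('a))"
  let ?c = "(q * \<sigma>) ^ DIM('a) * sweep_const DIM('a) / ?V"
  let ?I = "interior_faces Kh"
  let ?j = "\<lambda>F. (normal_jump Kh F (n F) v)\<^sup>2"
  have Ieq: "?I = (\<lambda>p. fst p \<inter> snd p) ` Adj"
  proof (intro set_eqI iffI)
    fix F assume "F \<in> ?I"
    then obtain K K' where K: "K \<in> Kh" "K' \<in> Kh" "K \<noteq> K'" "F = K \<inter> K'" "F facet_of K" "F facet_of K'"
      unfolding interior_faces_def by blast
    then have "(K, K') \<in> Adj" by (simp add: Adj_def facet_adjacent_def)
    then show "F \<in> (\<lambda>p. fst p \<inter> snd p) ` Adj" using K(4) by (intro image_eqI[of _ _ "(K, K')"]) simp_all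
  next
    fix F assume "F \<in> (\<lambda>p. fst p \<inter> snd p) ` Adj"
    then obtain K K' where "(K, K') \<in> Adj" "F = K \<inter> K'" by auto
    then show "F \<in> ?I" unfolding interior_faces_def Adj_def facet_adjacent_def by blast
  qed
  have fI: "finite ?I" unfolding Ieq using finite_Adj by simp
  have jmp: "jmp p = ?j (fst p \<inter> snd p)" if p: "p \<in> Adj" for p
  proof -
    obtain A B where AB: "p = (A, B)" "A \<in> Kh" "B \<in> Kh" "facet_adjacent A B" using p by (auto simp: Adj_def)
    have "A \<inter> B \<in> ?I" using p AB unfolding Ieq by force
    then show ?thesis using normal_jump_eq[OF v Kh_sub AB(2-4) n] AB by (simp add: jmp_def)
  qed
  have meas: "h ^ DIM('a) \<le> ?c * h * measure surface_measure F" and FB: "F \<in> sets borel" and Ff: "emeasure surface_measure F < top" if F: "F \<in> ?I" for F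
  proof -
    obtain K where K: "K \<in> \<K>" "F facet_of K" using F Kh_sub by (auto simp: interior_faces_def)
    note fm = facet_measure[OF K]
    show "F \<in> sets borel" "emeasure surface_measure F < top" using fm by auto
    have qs: "(q * \<sigma>) ^ DIM('a) > 0" using q_sigma_pos by simp
    have "?V * (h ^ DIM('a) / (q * \<sigma>) ^ DIM('a)) \<le> sweep_const DIM('a) * h * measure surface_measure F"
      using fm(3) by (simp add: power_divide)
    then have "?V * h ^ DIM('a) \<le> sweep_const DIM('a) * h * measure surface_measure F * (q * \<sigma>) ^ DIM('a)"
      using qs by (simp add: pos_divide_le_eq)
    then have "h ^ DIM('a) \<le> sweep_const DIM('a) * h * measure surface_measure F * (q * \<sigma>) ^ DIM('a) / ?V"
      using unit_ball_vol_pos[of "real DIM('a)"] by (simp add: pos_le_divide_eq mult.commute)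
    then show "h ^ DIM('a) \<le> ?c * h * measure surface_measure F" by (simp add: mult_ac)
  qed
  have fn: "(face_norm \<tau> Kh n v)\<^sup>2 = (\<Sum>F\<in>?I. \<tau> * (measure surface_measure F * ?j F))"
  proof -
    have "(face_norm \<tau> Kh n v)\<^sup>2 = (\<Sum>F\<in>?I. \<tau> * (L2_norm_on surface_measure F (\<lambda>_. normal_jump Kh F (n F) v))\<^sup>2)"
      using \<tau> by (simp add: face_norm_def sum_nonneg)
    also have "\<dots> = (\<Sum>F\<in>?I. \<tau> * (measure surface_measure F * ?j F))"
    proof (intro sum.cong refl)
      fix F assume F: "F \<in> ?I"
      have "(LINT x:F|surface_measure. ?j F) = measure surface_measure F * ?j F"
        using FB[OF F] Ff[OF F] by (subst set_integral_const) auto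
      then show "\<tau> * (L2_norm_on surface_measure F (\<lambda>_. normal_jump Kh F (n F) v))\<^sup>2 = \<tau> * (measure surface_measure F * ?j F)"
        by (simp add: L2_norm_on_square)
    qed
    finally show ?thesis .
  qed
  have "Jtot = (\<Sum>p\<in>Adj. ?j (fst p \<inter> snd p))" unfolding Jtot_def by (intro sum.cong jmp refl)
  also have "\<dots> = (\<Sum>F\<in>?I. \<Sum>p\<in>{p \<in> Adj. fst p \<inter> snd p = F}. ?j (fst p \<inter> snd p))"
    unfolding Ieq by (rule sum.group[symmetric]) (simp_all add: finite_Adj)
  also have "\<dots> = (\<Sum>F\<in>?I. real (card {p \<in> Adj. fst p \<inter> snd p = F}) * ?j F)" by simp
  also have "\<dots> \<le> (\<Sum>F\<in>?I. real (M\<^sup>2) * ?j F)"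
  proof (intro sum_mono mult_right_mono)
    fix F assume F: "F \<in> ?I"
    then obtain f where f: "f \<in> F" by (auto simp: interior_faces_def facet_of_def)
    let ?N = "{K \<in> \<K>. K \<inter> cball f (8 * h) \<noteq> {}}"
    have "{p \<in> Adj. fst p \<inter> snd p = F} \<subseteq> ?N \<times> ?N"
    proof
      fix p assume "p \<in> {p \<in> Adj. fst p \<inter> snd p = F}"
      moreover have "f \<in> cball f (8 * h)" using h by simp
      ultimately show "p \<in> ?N \<times> ?N" using f Kh_sub unfolding Adj_def by (cases p) auto
    qed
    then have "card {p \<in> Adj. fst p \<inter> snd p = F} \<le> card (?N \<times> ?N)" using fin by (intro card_mono) auto
    also have "\<dots> \<le> M * M" using card_near[of f] by (simp add: card_cartesian_product mult_le_mono)
    finally show "real (card {p \<in> Adj. fst p \<inter> snd p = F}) \<le> real (M\<^sup>2)"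
      unfolding power2_eq_square by (rule of_nat_mono)
  qed auto
  finally have J: "Jtot \<le> real (M\<^sup>2) * (\<Sum>F\<in>?I. ?j F)" by (simp add: sum_distrib_left)
  have "h ^ DIM('a) * Jtot \<le> h ^ DIM('a) * (real (M\<^sup>2) * (\<Sum>F\<in>?I. ?j F))" using J h by (intro mult_left_mono) auto
  also have "\<dots> = real (M\<^sup>2) * (\<Sum>F\<in>?I. h ^ DIM('a) * ?j F)" by (simp add: sum_distrib_left mult_ac)
  also have "\<dots> \<le> real (M\<^sup>2) * (\<Sum>F\<in>?I. ?c * h * measure surface_measure F * ?j F)"
    using meas by (intro mult_left_mono sum_mono mult_right_mono) auto
  also have "(\<Sum>F\<in>?I. ?c * h * measure surface_measure F * ?j F) = ?c / \<tau> * (h * (face_norm \<tau> Kh n v)\<^sup>2)"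
    unfolding fn using \<tau> by (simp add: sum_distrib_left mult_ac)
  finally show ?thesis by (simp add: mult_ac)
qed

end

text \<open>In each element the zero set lies in a hyperplane unless \<open>\<rho>\<^sub>h\<close>
  vanishes identically there. That case is excluded because the frontier of an open set has no
  interior points.\<close>

lemma zero_level_finite_measure:
  fixes \<K> :: "'a::euclidean_space set set"
  assumes dim2: "DIM('a) \<ge> 2" and mesh: "simplicial_mesh \<K>" and \<Omega>: "open \<Omega>" "closure \<Omega> = \<Union>\<K>"
    and \<rho>: "\<rho>\<^sub>h \<in> P1_space \<K>" and D: "open D" "frontier D = zero_level \<Omega> \<rho>\<^sub>h"
  shows "hausdorff_outer (DIM('a) - 1) (zero_level \<Omega> \<rho>\<^sub>h) < top"
proof -
  interpret simplicial_mesh \<K> by (rule mesh)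
  let ?Z = "zero_level \<Omega> \<rho>\<^sub>h"
  have "hausdorff_outer (DIM('a) - 1) (?Z \<inter> K) < top" if K: "K \<in> \<K>" for K
  proof -
    obtain g b where gb: "\<And>x. x \<in> K \<Longrightarrow> \<rho>\<^sub>h x = g \<bullet> x + b" using \<rho> K unfolding P1_space_def by blast
    have gb0: "g \<noteq> 0 \<or> b \<noteq> 0"
    proof (rule ccontr)
      assume "\<not> ?thesis"
      then have z: "\<rho>\<^sub>h x = 0" if "x \<in> K" for x using gb that by simp
      have "interior K \<inter> closure \<Omega> \<noteq> {}" using int_ne[OF K] interior_subset[of K] K \<Omega>(2) by blast
      then have "interior K \<inter> \<Omega> \<noteq> {}" by (simp add: open_Int_closure_eq_empty)
      moreover have "interior K \<inter> \<Omega> \<subseteq> ?Z" using z interior_subset[of K] by (auto simp: zero_level_def)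
      then have "interior K \<inter> \<Omega> \<subseteq> interior ?Z" using \<Omega>(1) by (intro interior_maximal) auto
      ultimately show False using interior_frontier_open_empty[OF D(1)] D(2) by auto
    qed
    show ?thesis
    proof (cases "g = 0")
      case True
      then have "?Z \<inter> K = {}" using gb gb0 by (auto simp: zero_level_def)
      then show ?thesis using hausdorff_outer_empty[of "DIM('a) - 1", where 'a='a] dim2 by simp
    next
      case False
      have "?Z \<inter> K \<subseteq> {x. g \<bullet> x = - b}"
      proof
        fix x assume "x \<in> ?Z \<inter> K"
        then have "\<rho>\<^sub>h x = 0" "\<rho>\<^sub>h x = g \<bullet> x + b" using gb by (auto simp: zero_level_def)
        then show "x \<in> {x. g \<bullet> x = - b}" by simp
      qed
      moreover have "bounded (?Z \<inter> K)" using compact_imp_bounded[OF comp[OF K]] bounded_subset by blast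
      ultimately show ?thesis using hausdorff_outer_hyperplane_finite[OF dim2 _ False] by blast
    qed
  qed
  then have "hausdorff_outer (DIM('a) - 1) (\<Union>K\<in>\<K>. ?Z \<inter> K) < top"
    using dim2 fin by (intro hausdorff_outer_UN_finite) auto
  moreover have "?Z \<subseteq> (\<Union>K\<in>\<K>. ?Z \<inter> K)"
  proof
    fix x assume x: "x \<in> ?Z"
    then have "x \<in> closure \<Omega>" using closure_subset[of \<Omega>] by (auto simp: zero_level_def)
    then show "x \<in> (\<Union>K\<in>\<K>. ?Z \<inter> K)" using x unfolding \<Omega>(2) by blast
  qed
  ultimately show ?thesis using hausdorff_outer_mono le_less_trans by blast
qed

lemma signed_dist_abs: "frontier D = S \<Longrightarrow> \<bar>signed_dist D x\<bar> = infdist x S"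
  by (simp add: signed_dist_def infdist_nonneg)

theorem lemma4p5:
  fixes S D :: "'a::euclidean_space set" and \<delta> \<tau> c \<sigma> q :: real
  assumes "DIM('a) \<in> {2, 3}"
    and "smooth_closed_hypersurface S"
    and "encloses D S"
    and "\<delta> > 0"
    and "\<forall>x \<in> tube D \<delta>. \<exists>!y. y \<in> S \<and> dist x y = infdist x S"
    and "\<tau> > 0"
  shows "\<exists>h\<^sub>0 > 0. \<exists>C > 0. \<forall>h (\<Omega> :: 'a set) \<K> \<rho>\<^sub>h S\<^sub>h D\<^sub>h n.
    0 < h \<and> h \<le> h\<^sub>0 \<and>
    conforming_partition \<K> \<Omega> \<and> shape_regular \<sigma> \<K> \<and> quasi_uniform q h \<K> \<and>
    tube D \<delta> \<subseteq> \<Omega> \<and>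
    \<rho>\<^sub>h \<in> P1_space \<K> \<and> S\<^sub>h = zero_level \<Omega> \<rho>\<^sub>h \<and> encloses D\<^sub>h S\<^sub>h \<and>
    approximates \<delta> c h S D S\<^sub>h D\<^sub>h \<and>
    (\<forall>F \<in> interior_faces (cut_mesh \<K> S\<^sub>h). unit_normal_to F (n F))
    \<longrightarrow> (\<forall>v \<in> cut_space \<K> S\<^sub>h.
          (L2_norm_on lborel (\<Union>(cut_mesh \<K> S\<^sub>h)) v)\<^sup>2
          \<le> C * (h * (L2_norm_on surface_measure S\<^sub>h v)\<^sup>2
                 + h * (face_norm \<tau> (cut_mesh \<K> S\<^sub>h) n v)\<^sup>2))"
proof -
  let ?d = "DIM('a)" let ?V = "unit_ball_vol (real ?d)"
  have dim2: "?d \<ge> 2" using assms(1) by auto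
  have Sc: "compact S" "S \<noteq> {}" using assms(2) by (auto simp: smooth_closed_hypersurface_def)
  have charts: "\<exists>\<nu> r \<rho> \<phi>. graph_chart S y \<nu> r \<rho> \<phi>" if "y \<in> S" for y
    by (rule smooth_closed_hypersurface_chart[OF assms(2) that])
  have frD: "frontier D = S" using assms(3) by (simp add: encloses_def)
  \<comment> \<open>Replaces \<open>c\<close>, whose sign is not given, where a nonnegative constant
    is required.\<close>
  define c' where "c' = max c 0"
  have c': "c' \<ge> 0" "c \<le> c'" by (auto simp: c'_def)
  \<comment> \<open>From here the constants of \<open>cut_setting\<close> are repeated outside of
    the locale, so that they are fixed before \<open>h\<close> and the mesh.\<close>
  define M' where "M' = nat \<lceil>(9 * (q * \<sigma>)) ^ ?d\<rceil>"
  define M12' where "M12' = nat \<lceil>(12 * (q * \<sigma>)) ^ ?d\<rceil>"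
  \<comment> \<open>The swept volume estimate solved for the measure: a ball of radius
    \<open>h / 32\<close> and a sweep of length \<open>2 * h\<close>.\<close>
  define \<kappa> where "\<kappa> = ?V / (32 ^ ?d * 2 * sweep_const ?d)"
  have \<kappa>: "\<kappa> > 0" using sweep_const_pos by (simp add: \<kappa>_def)
  define C0' where "C0' = 1 + 16 * real (M'\<^sup>2) + 2 / \<kappa> + 1024 * (real (M'\<^sup>2))\<^sup>2 + 4"
  have C0': "C0' \<ge> 0" using \<kappa> by (simp add: C0'_def)
  define B0' where "B0' = 2 * C0' + 4 + 4 * (real (M'\<^sup>2))\<^sup>2"
  have B0': "B0' \<ge> 0" using C0' by (simp add: B0'_def)
  obtain h1 Km where h1: "h1 > 0" and Km: "Km \<ge> 0" and
    macro: "\<forall>h X W val e E Y m. 0 < h \<longrightarrow> h \<le> h1 \<longrightarrow> macro_data S C0' c' h X W val e E \<longrightarrow>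
     finite Y \<longrightarrow> Y \<subseteq> S \<longrightarrow> overlap_le h m Y \<longrightarrow> h\<^sup>2 * (\<Sum>y\<in>Y. (norm (W y))\<^sup>2) \<le> real m * Km * E"
    using macro_estimate[OF dim2 Sc(1) charts C0' c'(1)] by blast
  obtain h2 where h2: "h2 > 0" and lower: "\<forall>z\<in>S. \<forall>h. 0 < h \<and> h \<le> h2 \<longrightarrow>
    (\<forall>X. continuous_on S X \<longrightarrow> (\<forall>y\<in>S. norm (X y - y) \<le> c' * h\<^sup>2) \<longrightarrow>
      ennreal (?V * (h / 32) ^ ?d) \<le> ennreal (sweep_const ?d * (2 * h)) * hausdorff_outer (?d - 1) (X ` S \<inter> cball (X z) h))"
    using perturbed_surface_measure_lower[OF dim2 Sc(1) charts c'(1)] by blast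
  obtain h3 where h3: "h3 > 0" and conn: "\<forall>y\<in>S. \<forall>h. 0 < h \<and> h \<le> h3 \<longrightarrow>
    (\<forall>y'\<in>S. dist y y' \<le> 2 * h \<longrightarrow> (\<exists>\<Gamma>. \<Gamma> \<subseteq> S \<and> connected \<Gamma> \<and> y \<in> \<Gamma> \<and> y' \<in> \<Gamma> \<and> \<Gamma> \<subseteq> cball y (5 * h)))"
    using uniformly_locally_connected[OF Sc(1) charts] by blast
  \<comment> \<open>The last bound yields \<open>c' * h \<le> 1 / 2\<close>, hence displacements of
    at most \<open>h / 2\<close>.\<close>
  define h0 where "h0 = min (min h1 h2) (min h3 (min 1 (1 / (2 * (c' + 1)))))"
  have h0: "h0 > 0" using h1 h2 h3 c' by (simp add: h0_def)
  define A where "A = ?V * B0' * real M' * real M12' * (1 + Km)"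
  have A: "A \<ge> 0" using B0' Km by (simp add: A_def)
  define Cj where "Cj = real (M'\<^sup>2) * ((q * \<sigma>) ^ ?d * sweep_const ?d / ?V) / \<tau>"
  show ?thesis
  \<comment> \<open>The summand 1 gives strict positivity, as only \<open>A \<ge> 0\<close> is
    known; \<open>Cj\<close> enters by its absolute value because the sign of
    \<open>q * \<sigma>\<close> is known only once a mesh exists.\<close>
  proof (rule exI[of _ h0], rule conjI[OF h0], rule exI[of _ "A * (1 + \<bar>Cj\<bar>) + 1"], intro conjI allI impI ballI)
    show "0 < A * (1 + \<bar>Cj\<bar>) + 1" using A by (simp add: add_nonneg_pos)
    fix h :: real and \<Omega> :: "'a set" and \<K> \<rho>\<^sub>h S\<^sub>h D\<^sub>h n v
    assume cfg: "0 < h \<and> h \<le> h0 \<and>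
      conforming_partition \<K> \<Omega> \<and> shape_regular \<sigma> \<K> \<and> quasi_uniform q h \<K> \<and>
      tube D \<delta> \<subseteq> \<Omega> \<and>
      \<rho>\<^sub>h \<in> P1_space \<K> \<and> S\<^sub>h = zero_level \<Omega> \<rho>\<^sub>h \<and> encloses D\<^sub>h S\<^sub>h \<and>
      approximates \<delta> c h S D S\<^sub>h D\<^sub>h \<and>
      (\<forall>F \<in> interior_faces (cut_mesh \<K> S\<^sub>h). unit_normal_to F (n F))"
      and "v \<in> cut_space \<K> S\<^sub>h"
    then have v: "v \<in> P1_space \<K>" by (simp add: cut_space_def)
    have h: "0 < h" "h \<le> h1" "h \<le> h2" "h \<le> h3" "h \<le> 1" "h \<le> 1 / (2 * (c' + 1))"
      using cfg by (auto simp: h0_def)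
    have tri: "triangulation \<K>" and simp: "\<forall>K\<in>\<K>. int ?d simplex K" and \<Omega>: "open \<Omega>" "closure \<Omega> = \<Union>\<K>"
      using cfg by (auto simp: conforming_partition_def)
    have enc: "open D\<^sub>h" "bounded D\<^sub>h" "frontier D\<^sub>h = S\<^sub>h" using cfg by (auto simp: encloses_def)
    have app: "S\<^sub>h \<subseteq> tube D \<delta>" "bij_betw (closest_point S) S\<^sub>h S" "\<forall>x\<in>S\<^sub>h. \<bar>signed_dist D x\<bar> \<le> c * h\<^sup>2"
      using cfg by (auto simp: approximates_def)
    have Shz: "S\<^sub>h = zero_level \<Omega> \<rho>\<^sub>h" using cfg by blast
    have mesh: "simplicial_mesh \<K>"
      using tri simp by unfold_locales (auto simp: triangulation_def)
    have Shc: "compact S\<^sub>h"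
    proof -
      have "bounded (frontier D\<^sub>h)" using bounded_subset[OF bounded_closure[OF enc(2)], of "frontier D\<^sub>h"] by (auto simp: frontier_def)
      then show ?thesis using enc(3) frontier_closed[of D\<^sub>h] by (simp add: compact_eq_bounded_closed)
    qed
    have Sh_ne: "S\<^sub>h \<noteq> {}" using app(2) Sc(2) by (auto simp: bij_betw_def)
    have Sh_int: "S\<^sub>h \<subseteq> interior (\<Union>\<K>)"
    proof -
      have "S\<^sub>h \<subseteq> \<Omega>" by (auto simp: Shz zero_level_def)
      moreover have "\<Omega> \<subseteq> interior (\<Union>\<K>)" unfolding \<Omega>(2)[symmetric] using \<Omega>(1) closure_subset by (intro interior_maximal) auto
      ultimately show ?thesis by blast
    qed
    let ?p = "closest_point S"
    have pcont: "continuous_on S\<^sub>h ?p"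
      using Sc compact_imp_closed[OF Shc] assms(5) app(1) by (intro continuous_on_closest_point_unique) auto
    \<comment> \<open>A continuous bijection from a compact set has a continuous inverse, so
      \<open>X\<close> carries connected subsets of \<open>S\<close> to connected subsets of the
      discrete surface.\<close>
    define X where "X = inv_into S\<^sub>h ?p"
    have bX: "bij_betw X S S\<^sub>h" unfolding X_def using app(2) by (rule bij_betw_inv_into)
    have Xp: "?p (X y) = y" if "y \<in> S" for y
      unfolding X_def using app(2) that by (intro f_inv_into_f) (auto simp: bij_betw_def)
    have Xcont: "continuous_on S X"
    proof -
      have "continuous_on (?p ` S\<^sub>h) X"
        using pcont Shc app(2) unfolding X_def by (intro continuous_on_inv) (auto simp: bij_betw_def)
      then show ?thesis using app(2) by (simp add: bij_betw_def)
    qed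
    have XS: "X ` S = S\<^sub>h" using bX by (simp add: bij_betw_def)
    have Xclose: "norm (X y - y) \<le> c' * h\<^sup>2" if y: "y \<in> S" for y
    proof -
      have "X y \<in> S\<^sub>h" using XS y by blast
      have "norm (X y - y) = infdist (X y) S"
        using closest_point_infdist(2)[OF compact_imp_closed[OF Sc(1)] Sc(2), of "X y"] Xp[OF y] by (simp add: dist_norm)
      also have "\<dots> = \<bar>signed_dist D (X y)\<bar>" using signed_dist_abs[OF frD] by simp
      also have "\<dots> \<le> c * h\<^sup>2" using app(3) \<open>X y \<in> S\<^sub>h\<close> by blast
      also have "\<dots> \<le> c' * h\<^sup>2" using c' by (intro mult_right_mono) auto
      finally show ?thesis .
    qed
    have Shfin: "hausdorff_outer (?d - 1) S\<^sub>h < top"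
      unfolding Shz using zero_level_finite_measure[OF dim2 mesh \<Omega> _ enc(1)] cfg enc(3) by simp
    have ne: "\<K> \<noteq> {}" using Sh_ne Sh_int by auto
    have s1: "?d - 1 \<ge> 1" using dim2 by simp
    have rm: "regular_mesh \<K> \<sigma> q h"
      using mesh cfg ne dim2 unfolding regular_mesh_def regular_mesh_axioms_def by blast
    have meas: "\<kappa> * h ^ (?d - 1) \<le> measure surface_measure (S\<^sub>h \<inter> cball (X y) h)" if y: "y \<in> S" for y
    proof -
      let ?B = "S\<^sub>h \<inter> cball (X y) h"
      have bor: "?B \<in> sets borel" using compact_imp_closed[OF Shc] by (auto intro: borel_closed)
      have em: "emeasure surface_measure ?B = hausdorff_outer (?d - 1) ?B" by (rule emeasure_hausdorff_measure[OF s1 bor])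
      have fin: "emeasure surface_measure ?B < top"
        unfolding em using hausdorff_outer_mono[of ?B S\<^sub>h] Shfin le_less_trans by blast
      have "ennreal (?V * (h / 32) ^ ?d) \<le> ennreal (sweep_const ?d * (2 * h)) * hausdorff_outer (?d - 1) (X ` S \<inter> cball (X y) h)"
        using lower y h Xcont Xclose by blast
      also have "\<dots> = ennreal (sweep_const ?d * (2 * h)) * ennreal (measure surface_measure ?B)"
        unfolding XS em[symmetric] using fin by (simp add: emeasure_eq_ennreal_measure less_top)
      also have "\<dots> = ennreal (sweep_const ?d * (2 * h) * measure surface_measure ?B)"
        using h sweep_const_pos[of ?d] by (simp add: ennreal_mult)
      finally have le: "?V * (h / 32) ^ ?d \<le> sweep_const ?d * (2 * h) * measure surface_measure ?B"
        using h sweep_const_pos[of ?d] by (subst (asm) ennreal_le_iff) auto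
      have hd: "h ^ ?d = h * h ^ (?d - 1)" by (simp add: power_eq_if)
      have "h * (?V * h ^ (?d - 1)) \<le> h * (32 ^ ?d * 2 * sweep_const ?d * measure surface_measure ?B)"
        using le unfolding power_divide hd by (simp add: pos_divide_le_eq mult_ac)
      then have "?V * h ^ (?d - 1) \<le> 32 ^ ?d * 2 * sweep_const ?d * measure surface_measure ?B"
        using h by (simp add: mult_le_cancel_left_pos)
      then show ?thesis
        unfolding \<kappa>_def using sweep_const_pos[of ?d] by (simp add: pos_divide_le_eq mult_ac)
    qed
    have small: "c' * h \<le> 1 / 2"
    proof -
      have "2 * (c' + 1) * h \<le> 1" using h(6) c' by (simp add: pos_le_divide_eq mult.commute)
      then show ?thesis using h(1) by (simp add: algebra_simps)
    qed
    have cs: "cut_setting \<K> \<sigma> q h S S\<^sub>h X c' \<kappa> v"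
      unfolding cut_setting_def cut_setting_axioms_def
      using rm v Xcont XS bX Xclose Shc Sh_int Shfin small h c'(1) \<kappa> meas conn by (simp add: bij_betw_def)
    interpret cs: cut_setting \<K> \<sigma> q h S S\<^sub>h X c' \<kappa> v by (rule cs)
    have Meq: "cs.M = M'" "cs.M12 = M12'" by (simp_all add: cs.M_def cs.M12_def M'_def M12'_def)
    have Ceq: "cs.C0 = C0'" by (simp add: cs.C0_def C0'_def Meq)
    have Beq: "cs.B0 = B0'" by (simp add: cs.B0_def B0'_def Ceq Meq)
    have "(LINT x:(\<Union>cs.Kh)|lborel. (v x)\<^sup>2) \<le> ?V * h ^ ?d * cs.B0 * real cs.M * real cs.M12 * (1 + Km) * cs.Etot"
    proof (rule cs.cut_mesh_bound[OF Km])
      fix Y m assume "finite Y" "Y \<subseteq> S" "overlap_le h m Y"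
      then show "h\<^sup>2 * (\<Sum>y\<in>Y. (norm (cs.W y))\<^sup>2) \<le> real m * Km * cs.Etot"
        using macro[rule_format, OF h(1,2) cs.macro_data[unfolded Ceq]] by blast
    qed
    also have "\<dots> = A * (h ^ ?d * cs.Etot)" by (simp add: A_def Meq Beq)
    \<comment> \<open>The factor \<open>h\<close> before the surface norm is what the volume of an
      element leaves after cancellation with the scaling of the surface integral.\<close>
    also have "h ^ ?d * cs.Etot = h ^ ?d * cs.Jtot + h * cs.I2 S\<^sub>h"
    proof -
      have "h ^ ?d = h * h ^ (?d - 1)" by (simp add: power_eq_if)
      then have "h ^ ?d * (cs.I2 S\<^sub>h / h ^ (?d - 1)) = h * cs.I2 S\<^sub>h" using h(1) by simp
      then show ?thesis by (simp only: cs.Etot_def distrib_left)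
    qed
    finally have main: "(LINT x:(\<Union>cs.Kh)|lborel. (v x)\<^sup>2) \<le> A * (h ^ ?d * cs.Jtot + h * cs.I2 S\<^sub>h)" .
    let ?f = "h * (face_norm \<tau> cs.Kh n v)\<^sup>2"
    have f0: "0 \<le> ?f" "0 \<le> h * cs.I2 S\<^sub>h" using h(1) cs.I2_nonneg by simp_all
    have nF: "unit_normal_to F (n F)" if "F \<in> interior_faces cs.Kh" for F
      using cfg that unfolding cs.Kh_def by blast
    have "h ^ ?d * cs.Jtot \<le> Cj * ?f"
      using cs.jump_energy_bound[OF assms(6) nF] unfolding Cj_def Meq .
    also have "\<dots> \<le> \<bar>Cj\<bar> * ?f" using f0(1) by (intro mult_right_mono) auto
    finally have "h ^ ?d * cs.Jtot + h * cs.I2 S\<^sub>h \<le> (1 + \<bar>Cj\<bar>) * (h * cs.I2 S\<^sub>h + ?f)"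
      using mult_nonneg_nonneg[OF abs_ge_zero[of Cj] f0(2)] f0 by (simp add: algebra_simps)
    then have "A * (h ^ ?d * cs.Jtot + h * cs.I2 S\<^sub>h) \<le> A * ((1 + \<bar>Cj\<bar>) * (h * cs.I2 S\<^sub>h + ?f))"
      using A by (rule mult_left_mono)
    also have "\<dots> \<le> (A * (1 + \<bar>Cj\<bar>) + 1) * (h * cs.I2 S\<^sub>h + ?f)" using f0 by (simp add: algebra_simps)
    finally show "(L2_norm_on lborel (\<Union>(cut_mesh \<K> S\<^sub>h)) v)\<^sup>2
      \<le> (A * (1 + \<bar>Cj\<bar>) + 1) * (h * (L2_norm_on surface_measure S\<^sub>h v)\<^sup>2 + h * (face_norm \<tau> (cut_mesh \<K> S\<^sub>h) n v)\<^sup>2)"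
      using main by (simp add: L2_norm_on_square cs.Kh_def cs.I2_def)
  qed
qed

end
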